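(* Let $g=\sqrt{2f}$ be the pressure-like function of a scalar curvature flow with a flat side satisfying the assumptions listed in the context, and let $0<T<T_c$ be as there. If the level sets $\Gamma_\epsilon(t)=\{x: g(x,t)=\epsilon\}$ of $g$ are convex, then there exists a constant $C>0$ such that $$|\nabla g|\ge C\quad\text{on } \{0< g(\cdot,t)\le 1\},\ 0\le t\le T.$$
   Context: Let $n\ge3$. For a hypersurface in $\mathbb{R}^{n+1}$, $\sigma_2=\frac12(H^2-|A|^2)=\sum_{i<j}\kappa_i\kappa_j$. A scalar curvature flow is a family $M_t=X(\Sigma,t)$ with $\partial X/\partial t=-\sigma_2\nu$, $\nu$ the outer unit normal, $X(\cdot,0)=X_0$. For a graph $x_{n+1}=f(x,t)$ this reads $$f_t=\frac{1}{2\sqrt{1+|\nabla f|^2}}\sum_{i,j,k,l=1}^n\Big(\delta_{ik}-\frac{f_if_k}{1+|\nabla f|^2}\Big)\Big(\delta_{jl}-\frac{f_jf_l}{1+|\nabla f|^2}\Big)(f_{ki}f_{lj}-f_{kj}f_{li}).$$ Setting. The initial hypersurface is compact and convex, $\Sigma=\Sigma_0\cup\Sigma_1$, where $\Sigma_0$ is a flat side contained in $\{x_{n+1}=0\}$, $\Sigma_1$ is strictly convex and lies above this hyperplane, and $\Gamma=\Sigma_0\cap\Sigma_1$. A part of $M_t$ containing the flat side is the graph $x_{n+1}=f(x,t)$ over $\Omega(t)=\{x\in\mathbb{R}^n:|Df(x,t)|<\infty\}$, $f\ge0$ convex in $x$; $\Sigma_0(t)=\{f(\cdot,t)=0\}$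 is the flat side and $\Gamma(t)$ its boundary (interface). $T_c$ is the time when the area of the flat side shrinks to zero; $0<T<T_c$ and $D_{\rho_0}=\{|x|\le\rho_0\}\subset\Sigma_0(t)$ for $0\le t\le T$, $\rho_0>0$; the domain of $f$ is contained in a ball $B_R$. Derivatives of $g=\sqrt{2f}$ at interface points are limits from $\{f>0\}$. Further assumptions: the measure of $\Sigma_0(T)$ is positive; $g$ is smooth up to the interface for a finite amount of time; $g$ is of class $C^{2+\beta}$ up to the interface (from $\{f>0\}$) for some $0<\beta<1$ for $0\le t\le T$; at $t=0$ there is $\lambda>0$ with $|\nabla g|\ge\lambda$ and $D^2_{\tau\tau}g\ge\lambda$ on $\Gamma$ for all tangential directions $\tau$; and $\max_{x\in\Omega(t)}f(x,t)\ge2$ for $0\le t\le T$ (so $\max g\ge2$). *)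

theory Defs
  imports "HOL-Analysis.Analysis"
begin

definition pd :: "'n::finite \<Rightarrow> (real ^ 'n \<Rightarrow> real) \<Rightarrow> real ^ 'n \<Rightarrow> real" where
  "pd i u x = frechet_derivative u (at x) (axis i 1)"

definition grad :: "(real ^ 'n::finite \<Rightarrow> real) \<Rightarrow> real ^ 'n \<Rightarrow> real ^ 'n" where
  "grad u x = (\<chi> i. pd i u x)"

definition hess :: "(real ^ 'n::finite \<Rightarrow> real) \<Rightarrow> real ^ 'n \<Rightarrow> real ^ 'n ^ 'n" where
  "hess u x = (\<chi> i j. pd j (pd i u) x)"

definition twice_differentiable_at :: "(real ^ 'n::finite \<Rightarrow> real) \<Rightarrow> real ^ 'n \<Rightarrow> bool" where
  "twice_differentiable_at u x \<longleftrightarrow>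
     (\<forall>\<^sub>F y in nhds x. u differentiable (at y)) \<and> grad u differentiable (at x)"

fun iterated_partial :: "'a list \<Rightarrow> ('a::euclidean_space \<Rightarrow> real) \<Rightarrow> 'a \<Rightarrow> real" where
  "iterated_partial [] u = u"
| "iterated_partial (b # bs) u = (\<lambda>z. frechet_derivative (iterated_partial bs u) (at z) b)"

definition smooth_in :: "'a::euclidean_space set \<Rightarrow> ('a \<Rightarrow> real) \<Rightarrow> bool" where
  "smooth_in P u \<longleftrightarrow>
     (\<forall>bs. set bs \<subseteq> Basis \<longrightarrow> (\<forall>z\<in>P. iterated_partial bs u differentiable (at z)))"

text \<open>Smooth in \<open>P\<close>, with every partial derivative having a limit from \<open>P\<close> at each point of
  the boundary portion \<open>I\<close>.\<close>

definition smooth_up_to :: "'a::euclidean_space set \<Rightarrow> 'a set \<Rightarrow> ('a \<Rightarrow> real) \<Rightarrow> bool" where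
  "smooth_up_to P I u \<longleftrightarrow> smooth_in P u \<and>
     (\<forall>bs. set bs \<subseteq> Basis \<longrightarrow>
       (\<forall>z\<in>I. \<exists>l. (iterated_partial bs u \<longlongrightarrow> l) (at z within P)))"

text \<open>\<open>\<nu>\<close> is the outer unit normal of the region \<open>K\<close> at \<open>p\<close>: to first order at \<open>p\<close>, the region
  is the half-space \<open>{y. (y - p) \<bullet> \<nu> \<le> 0}\<close>. This forces \<open>p \<in> frontier K\<close> and determines \<open>\<nu>\<close>.\<close>

definition outer_unit_normal :: "'a::euclidean_space set \<Rightarrow> 'a \<Rightarrow> 'a \<Rightarrow> bool" where
  "outer_unit_normal K p \<nu> \<longleftrightarrow> norm \<nu> = 1 \<and>
     (\<forall>\<epsilon>>0. \<forall>\<^sub>F y in at p.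
        (y \<in> K \<longrightarrow> (y - p) \<bullet> \<nu> \<le> \<epsilon> * norm (y - p)) \<and>
        (y \<notin> K \<longrightarrow> (y - p) \<bullet> \<nu> \<ge> - \<epsilon> * norm (y - p)))"

definition gauss_map :: "'a::euclidean_space set \<Rightarrow> 'a \<Rightarrow> 'a" where
  "gauss_map K p = (THE \<nu>. outer_unit_normal K p \<nu>)"

definition C1_region :: "'a::euclidean_space set \<Rightarrow> bool" where
  "C1_region K \<longleftrightarrow> compact K \<and> interior K \<noteq> {} \<and>
     (\<forall>p\<in>frontier K. \<exists>\<nu>. outer_unit_normal K p \<nu>) \<and>
     continuous_on (frontier K) (gauss_map K)"

text \<open>The shape operator is the differential of the Gauss map along the hypersurface. It is
  extended by \<open>0\<close> in the normal direction, which makes it a unique endomorphism of the ambient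
  space without changing the traces below; the curvatures of a round sphere are positive.\<close>

definition shape_operator :: "'a::euclidean_space set \<Rightarrow> 'a \<Rightarrow> ('a \<Rightarrow> 'a) \<Rightarrow> bool" where
  "shape_operator K p A \<longleftrightarrow>
     (gauss_map K has_derivative A) (at p within frontier K) \<and> A (gauss_map K p) = 0"

definition mean_curvature :: "('a::euclidean_space \<Rightarrow> 'a) \<Rightarrow> real" where
  "mean_curvature A = (\<Sum>b\<in>Basis. A b \<bullet> b)"

definition shape_norm_sq :: "('a::euclidean_space \<Rightarrow> 'a) \<Rightarrow> real" where
  "shape_norm_sq A = (\<Sum>b\<in>Basis. A b \<bullet> A b)"

definition sigma2 :: "('a::euclidean_space \<Rightarrow> 'a) \<Rightarrow> real" where
  "sigma2 A = ((mean_curvature A)\<^sup>2 - shape_norm_sq A) / 2"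

text \<open>\<open>M\<^sub>t = frontier (K t) = X(M\<^sub>0, t)\<close> moves with velocity \<open>- \<sigma>\<^sub>2 \<nu>\<close> for \<open>0 \<le> t < T\<^sub>c\<close>.
  The set \<open>S t\<close> is exempted: at the edge of a flat side the second fundamental form jumps, so
  there is no classical \<open>\<sigma>\<^sub>2\<close> there.\<close>

definition scalar_curvature_flow ::
  "(real \<Rightarrow> 'a::euclidean_space set) \<Rightarrow> (real \<Rightarrow> 'a set) \<Rightarrow> ('a \<Rightarrow> real \<Rightarrow> 'a) \<Rightarrow> real \<Rightarrow> bool" where
  "scalar_curvature_flow K S X Tc \<longleftrightarrow>
     (\<forall>t\<in>{0..<Tc}. C1_region (K t)) \<and>
     continuous_on (frontier (K 0) \<times> {0..<Tc}) (\<lambda>(p, t). X p t) \<and>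
     (\<forall>p\<in>frontier (K 0). X p 0 = p) \<and>
     (\<forall>t\<in>{0..<Tc}. bij_betw (\<lambda>p. X p t) (frontier (K 0)) (frontier (K t))) \<and>
     (\<forall>t\<in>{0..<Tc}. \<forall>p\<in>frontier (K 0). X p t \<notin> S t \<longrightarrow>
        (\<exists>A. shape_operator (K t) (X p t) A \<and>
             ((\<lambda>s. X p s) has_vector_derivative - sigma2 A *\<^sub>R gauss_map (K t) (X p t))
               (at t within {0..<Tc})))"

text \<open>The right-hand side of the flow equation for a graph \<open>x\<^sub>n\<^sub>+\<^sub>1 = u(x)\<close>.\<close>

definition graph_speed :: "(real ^ 'n::finite \<Rightarrow> real) \<Rightarrow> real ^ 'n \<Rightarrow> real" where
  "graph_speed u x =
     (let W2 = 1 + (norm (grad u x))\<^sup>2;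
          P = (\<lambda>i k. (if i = k then 1 else 0) - grad u x $ i * grad u x $ k / W2);
          h = (\<lambda>i j. hess u x $ i $ j)
      in 1 / (2 * sqrt W2) *
         (\<Sum>i\<in>UNIV. \<Sum>j\<in>UNIV. \<Sum>k\<in>UNIV. \<Sum>l\<in>UNIV.
            P i k * P j l * (h k i * h l j - h k j * h l i)))"

text \<open>Points of \<open>\<real>\<^sup>n\<^sup>+\<^sup>1\<close> are pairs \<open>(x, x\<^sub>n\<^sub>+\<^sub>1)\<close>.\<close>

definition contains_no_segment :: "'a::euclidean_space set \<Rightarrow> bool" where
  "contains_no_segment S \<longleftrightarrow> (\<forall>p\<in>S. \<forall>q\<in>S. closed_segment p q \<subseteq> S \<longrightarrow> p = q)"

definition convex_with_flat_side :: "((real ^ 'n::finite) \<times> real) set \<Rightarrow> bool" where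
  "convex_with_flat_side K \<longleftrightarrow>
     (let M = frontier K; S0 = {p\<in>M. snd p = 0}; S1 = closure (M - S0) in
        compact K \<and> convex K \<and> interior (fst ` S0) \<noteq> {} \<and>
        (\<forall>p\<in>M - S0. snd p > 0) \<and> contains_no_segment S1)"

definition flat_side :: "(real \<Rightarrow> (real ^ 'n::finite) set) \<Rightarrow> (real \<Rightarrow> real ^ 'n \<Rightarrow> real) \<Rightarrow> real \<Rightarrow> (real ^ 'n) set" where
  "flat_side \<Omega> f t = {x\<in>\<Omega> t. f t x = 0}"

definition interface :: "(real \<Rightarrow> (real ^ 'n::finite) set) \<Rightarrow> (real \<Rightarrow> real ^ 'n \<Rightarrow> real) \<Rightarrow> real \<Rightarrow> (real ^ 'n) set" where
  "interface \<Omega> f t = frontier (flat_side \<Omega> f t)"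

definition positive_part :: "(real \<Rightarrow> (real ^ 'n::finite) set) \<Rightarrow> (real \<Rightarrow> real ^ 'n \<Rightarrow> real) \<Rightarrow> real \<Rightarrow> (real ^ 'n) set" where
  "positive_part \<Omega> f t = {x\<in>\<Omega> t. f t x > 0}"

definition pressure :: "(real \<Rightarrow> real ^ 'n::finite \<Rightarrow> real) \<Rightarrow> real \<Rightarrow> real ^ 'n \<Rightarrow> real" where
  "pressure f t x = sqrt (2 * f t x)"

text \<open>A part of \<open>frontier K\<close> containing the flat side is the graph of \<open>u\<close> over \<open>D\<close>, with the region
  above it; \<open>D\<close> is the set where the gradient is finite, i.e. the gradient exists in \<open>D\<close> and
  blows up at the boundary of \<open>D\<close>.\<close>

definition flat_side_graph ::
  "((real ^ 'n::finite) \<times> real) set \<Rightarrow> (real ^ 'n) set \<Rightarrow> (real ^ 'n \<Rightarrow> real) \<Rightarrow> bool" where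
  "flat_side_graph K D u \<longleftrightarrow>
     open D \<and> convex_on D u \<and> (\<forall>x\<in>D. u x \<ge> 0) \<and>
     (\<forall>x\<in>D. u differentiable (at x)) \<and>
     (\<forall>z\<in>frontier D. filterlim (\<lambda>x. norm (grad u x)) at_top (at z within D)) \<and>
     (\<forall>x\<in>D. (x, u x) \<in> frontier K \<and> (\<exists>\<nu>. outer_unit_normal K (x, u x) \<nu> \<and> snd \<nu> < 0)) \<and>
     {p\<in>frontier K. snd p = 0} = {(x, 0) |x. x \<in> D \<and> u x = 0}"

text \<open>The graph equation is the form that the velocity law takes on the graph; it is recorded
  off the interface, where \<open>f t\<close> is only \<open>C\<^sup>1\<^sup>,\<^sup>1\<close>. The domain is relatively open in space-time, so that
  the time derivative involves only values of \<open>f\<close> in the domain. \<open>Tc\<close> is the time at which the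
  area of the flat side shrinks to zero.\<close>

definition flat_side_flow ::
  "(real \<Rightarrow> ((real ^ 'n::finite) \<times> real) set) \<Rightarrow> ((real ^ 'n) \<times> real \<Rightarrow> real \<Rightarrow> (real ^ 'n) \<times> real) \<Rightarrow>
   (real \<Rightarrow> (real ^ 'n) set) \<Rightarrow> (real \<Rightarrow> real ^ 'n \<Rightarrow> real) \<Rightarrow> real \<Rightarrow> bool" where
  "flat_side_flow K X \<Omega> f Tc \<longleftrightarrow>
     0 < Tc \<and>
     convex_with_flat_side (K 0) \<and>
     scalar_curvature_flow K (\<lambda>t. interface \<Omega> f t \<times> {0}) X Tc \<and>
     (\<forall>t\<in>{0..<Tc}. flat_side_graph (K t) (\<Omega> t) (f t)) \<and>
     openin (top_of_set (UNIV \<times> {0..<Tc})) {(x, t). t \<in> {0..<Tc} \<and> x \<in> \<Omega> t} \<and>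
     continuous_on {(x, t). t \<in> {0..<Tc} \<and> x \<in> \<Omega> t} (\<lambda>(x, t). f t x) \<and>
     (\<forall>t\<in>{0..<Tc}. \<forall>x\<in>\<Omega> t - interface \<Omega> f t.
        twice_differentiable_at (f t) x \<and>
        ((\<lambda>s. f s x) has_real_derivative graph_speed (f t) x) (at t within {0..<Tc})) \<and>
     smooth_in {(x, t). 0 < t \<and> t < Tc \<and> x \<in> positive_part \<Omega> f t} (\<lambda>(x, t). f t x) \<and>
     (\<forall>t\<in>{0..<Tc}. measure lebesgue (flat_side \<Omega> f t) > 0) \<and>
     ((\<lambda>t. measure lebesgue (flat_side \<Omega> f t)) \<longlongrightarrow> 0) (at_left Tc)"

definition smooth_up_to_interface_short_time ::
  "(real \<Rightarrow> (real ^ 'n::finite) set) \<Rightarrow> (real \<Rightarrow> real ^ 'n \<Rightarrow> real) \<Rightarrow> real \<Rightarrow> bool" where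
  "smooth_up_to_interface_short_time \<Omega> f Tc \<longleftrightarrow>
     (\<exists>\<tau>. 0 < \<tau> \<and> \<tau> \<le> Tc \<and>
        smooth_up_to {(x, t). 0 < t \<and> t < \<tau> \<and> x \<in> positive_part \<Omega> f t}
                     {(x, t). 0 < t \<and> t < \<tau> \<and> x \<in> interface \<Omega> f t}
                     (\<lambda>(x, t). pressure f t x))"

text \<open>Class \<open>C\<^sup>2\<^sup>+\<^sup>\<beta>\<close> in \<open>x\<close> up to the interface, uniformly for \<open>0 \<le> t \<le> T\<close>. The bounds are
  required only on a one-sided neighbourhood \<open>0 < g < \<delta>\<close> of the interface, because the gradient is
  unbounded at the boundary of \<open>\<Omega> t\<close>.\<close>

definition C2_Hoelder_up_to_interface ::
  "real \<Rightarrow> (real \<Rightarrow> (real ^ 'n::finite) set) \<Rightarrow> (real \<Rightarrow> real ^ 'n \<Rightarrow> real) \<Rightarrow> real \<Rightarrow> bool" where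
  "C2_Hoelder_up_to_interface \<beta> \<Omega> f T \<longleftrightarrow>
     (\<exists>\<delta>>0. \<exists>L. \<forall>t\<in>{0..T}.
        (let g = pressure f t; P = {x\<in>\<Omega> t. 0 < g x \<and> g x < \<delta>} in
          (\<forall>x\<in>P. twice_differentiable_at g x \<and> norm (grad g x) \<le> L \<and> norm (hess g x) \<le> L) \<and>
          (\<forall>x\<in>P. \<forall>y\<in>P. norm (hess g x - hess g y) \<le> L * norm (x - y) powr \<beta>) \<and>
          (\<forall>z\<in>interface \<Omega> f t. (\<exists>l. (grad g \<longlongrightarrow> l) (at z within P)) \<and>
                                (\<exists>l. (hess g \<longlongrightarrow> l) (at z within P)))))"

text \<open>Derivatives of the pressure at interface points are limits from \<open>{f > 0}\<close>.\<close>

definition interface_grad ::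
  "(real \<Rightarrow> (real ^ 'n::finite) set) \<Rightarrow> (real \<Rightarrow> real ^ 'n \<Rightarrow> real) \<Rightarrow> real \<Rightarrow> real ^ 'n \<Rightarrow> real ^ 'n" where
  "interface_grad \<Omega> f t z = Lim (at z within positive_part \<Omega> f t) (grad (pressure f t))"

definition interface_hess ::
  "(real \<Rightarrow> (real ^ 'n::finite) set) \<Rightarrow> (real \<Rightarrow> real ^ 'n \<Rightarrow> real) \<Rightarrow> real \<Rightarrow> real ^ 'n \<Rightarrow> real ^ 'n ^ 'n" where
  "interface_hess \<Omega> f t z = Lim (at z within positive_part \<Omega> f t) (hess (pressure f t))"

text \<open>Where \<open>\<nabla>g \<noteq> 0\<close>, it is normal to the interface, so the tangential directions are the unit
  vectors orthogonal to it.\<close>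

definition nondegenerate_at_start ::
  "real \<Rightarrow> (real \<Rightarrow> (real ^ 'n::finite) set) \<Rightarrow> (real \<Rightarrow> real ^ 'n \<Rightarrow> real) \<Rightarrow> bool" where
  "nondegenerate_at_start lam \<Omega> f \<longleftrightarrow>
     (\<forall>z\<in>interface \<Omega> f 0.
        norm (interface_grad \<Omega> f 0 z) \<ge> lam \<and>
        (\<forall>v. norm v = 1 \<and> v \<bullet> interface_grad \<Omega> f 0 z = 0 \<longrightarrow>
             v \<bullet> (interface_hess \<Omega> f 0 z *v v) \<ge> lam))"

text \<open>A convex hypersurface in the open set \<open>U\<close>: the part in \<open>U\<close> of the boundary of a
  convex set with nonempty interior.
  Intersecting with \<open>U\<close> is needed since a level set may leave the domain of the graph.\<close>

definition convex_hypersurface_in :: "'a::euclidean_space set \<Rightarrow> 'a set \<Rightarrow> bool" where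
  "convex_hypersurface_in U S \<longleftrightarrow>
     (\<exists>B. convex B \<and> interior B \<noteq> {} \<and> S = U \<inter> frontier B)"

end

theory Submission
  imports Defs
begin

text \<open>
  The bound rests on a comparison of the flow with its own rescalings. If \<open>M\<^sub>t\<close> is a scalar curvature
  flow, then so is \<open>c M\<^bsub>t/c^3\<^esub>\<close>, which is the graph of \<open>f\<^sub>c(x, t) = c f(x/c, t/c\<^sup>3)\<close>, and its flat
  side lies in the same plane. For \<open>c > 1\<close> convexity gives \<open>f\<^sub>c \<le> f\<close>. The point is a quantitative version:
  near the interface, for constants \<open>a, k > 0\<close>,

    \<open>f\<^sub>c \<le> f - d g\<close> up to \<open>O((c - 1)\<^sup>2)\<close>, where \<open>d(t) = a (c - 1) e\<^bsup>-kt\<^esup>\<close>.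

  Division by \<open>c - 1\<close> as \<open>c \<rightarrow> 1\<close> yields \<open>a e\<^bsup>-kt\<^esup> g \<le> x \<bullet> \<nabla>f + 3 t f\<^sub>t - f\<close> (\<open>derivative_of_comparison\<close>).
  Now \<open>\<nabla>f = g \<nabla>g\<close>, and \<open>f\<^sub>t\<close> also has a factor \<open>g\<close>: the Hessian \<open>g D\<^sup>2g + \<nabla>g \<nabla>g\<^sup>T\<close> of \<open>f\<close> has rank one at the
  interface, so \<open>f\<^sub>t = g \<Psi>(g)\<close> with \<open>\<Psi>(g) \<le> B (g + |\<nabla>g|\<^sup>2)\<close> (\<open>speed_half_square\<close>, \<open>pressure_speed_bound\<close>).
  After cancelling \<open>g\<close>, \<open>|\<nabla>g|\<close> cannot be small where \<open>g\<close> is small. Away from the interface,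
  \<open>x \<bullet> \<nabla>f \<ge> f\<close> is enough.

  The comparison is a maximum principle for \<open>f\<^sub>c\<close> against the barrier \<open>(g - d)\<^sup>2/2 + d(0)\<^sup>2/2\<close>,
  continued by the constant \<open>d(0)\<^sup>2/2\<close> to \<open>{g \<le> d}\<close> (\<open>rescaled_le_barrier\<close>). At an interior contact the gradients agree and the Hessians are ordered, and the
  speed is monotone on positive semidefinite matrices (\<open>speed_mono\<close>); since \<open>\<Psi>\<close> is Lipschitz, the decay
  of \<open>d\<close> excludes the contact (\<open>no_interior_touching\<close>). At the degenerate boundary there is nothing to
  control: where \<open>g \<le> d\<close> the barrier is at least \<open>f\<close>, hence at least \<open>f\<^sub>c\<close>. The order at the initial time comes from the nondegeneracy
  assumption, the order on \<open>{g = \<epsilon>}\<close> from the convexity of \<open>f\<close>.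

  Two facts make this work: the sublevel sets \<open>{g \<le> \<epsilon>}\<close> are compact in space-time, because
  the gradient blows up at the boundary of the domain but is bounded near the interface
  (\<open>closed_sublevel\<close>); and \<open>f\<close> is nondecreasing in time (\<open>persistence\<close>), because the speed of a convex
  graph is nonnegative.
\<close>

section \<open>Second-order expansions\<close>

lemma has_derivative_grad:
  fixes u :: "real ^ 'n::finite \<Rightarrow> real"
  assumes "u differentiable (at x)"
  shows "(u has_derivative (\<lambda>h. grad u x \<bullet> h)) (at x)"
proof -
  let ?D = "frechet_derivative u (at x)"
  have D: "(u has_derivative ?D) (at x)"
    using assms frechet_derivative_works by blast
  then have lin: "linear ?D" by (rule has_derivative_linear)
  have "?D h = grad u x \<bullet> h" for h
  proof -
    have "?D h = ?D (\<Sum>i\<in>UNIV. h $ i *\<^sub>R axis i 1)"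
      using basis_expansion[of h] by (simp add: scalar_mult_eq_scaleR)
    also have "\<dots> = (\<Sum>i\<in>UNIV. h $ i * ?D (axis i 1))"
      by (simp add: linear_sum[OF lin] linear_scale[OF lin])
    also have "\<dots> = grad u x \<bullet> h"
      by (simp add: inner_vec_def grad_def pd_def mult.commute)
    finally show ?thesis .
  qed
  then have "?D = (\<lambda>h. grad u x \<bullet> h)" by (rule ext)
  with D show ?thesis by simp
qed

lemma grad_eqI:
  fixes u :: "real ^ 'n::finite \<Rightarrow> real"
  assumes "(u has_derivative (\<lambda>h. p \<bullet> h)) (at x)"
  shows "grad u x = p"
  using frechet_derivative_at[OF assms, symmetric]
  by (simp add: vec_eq_iff grad_def pd_def inner_axis)

text \<open>The gradient \<open>p\<close> and Hessian \<open>M\<close> as one predicate: unlike \<open>grad\<close> and \<open>hess\<close>, it can be transported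
  through sums, squares and rescalings without evaluating partial derivatives.\<close>

definition second_order_at ::
  "(real ^ 'n::finite \<Rightarrow> real) \<Rightarrow> real ^ 'n \<Rightarrow> real ^ 'n \<Rightarrow> real ^ 'n ^ 'n \<Rightarrow> bool" where
  "second_order_at u x p M \<longleftrightarrow>
     (\<exists>G. (\<forall>\<^sub>F y in nhds x. (u has_derivative (\<lambda>h. G y \<bullet> h)) (at y)) \<and>
          G x = p \<and> (G has_derivative (\<lambda>h. M *v h)) (at x))"

lemma second_order_atD:
  assumes "second_order_at u x p M"
  shows "grad u x = p" "hess u x = M"
    "(u has_derivative (\<lambda>h. p \<bullet> h)) (at x)"
proof -
  obtain G where G: "\<forall>\<^sub>F y in nhds x. (u has_derivative (\<lambda>h. G y \<bullet> h)) (at y)" "G x = p"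
      "(G has_derivative (\<lambda>h. M *v h)) (at x)"
    using assms unfolding second_order_at_def by blast
  have ev: "\<forall>\<^sub>F y in nhds x. grad u y = G y"
    using G(1) by eventually_elim (rule grad_eqI)
  show p: "grad u x = p"
    using eventually_nhds_x_imp_x[OF ev] G(2) by simp
  show "(u has_derivative (\<lambda>h. p \<bullet> h)) (at x)"
    using eventually_nhds_x_imp_x[OF G(1)] G(2) by simp
  have "\<forall>\<^sub>F y in at x. G y = grad u y"
    using ev by (simp add: eventually_at_filter eventually_mono)
  then have dG: "(grad u has_derivative (\<lambda>h. M *v h)) (at x)"
    by (rule has_derivative_transform_eventually[OF G(3)]) (simp_all add: p G(2))
  have "hess u x $ i $ j = M $ i $ j" for i j
  proof -
    have "((\<lambda>y. grad u y $ i) has_derivative (\<lambda>h. (M *v h) $ i)) (at x)"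
      by (rule bounded_linear.has_derivative[OF bounded_linear_vec_nth dG])
    moreover have "pd i u = (\<lambda>y. grad u y $ i)"
      by (simp add: grad_def fun_eq_iff)
    ultimately have "frechet_derivative (pd i u) (at x) = (\<lambda>h. (M *v h) $ i)"
      using frechet_derivative_at by metis
    then show ?thesis
      by (simp add: hess_def pd_def matrix_vector_mult_basis column_def)
  qed
  then show "hess u x = M" by (simp add: vec_eq_iff)
qed

lemma twice_differentiable_at_imp_second_order:
  assumes "twice_differentiable_at u x"
  shows "second_order_at u x (grad u x) (hess u x)"
proof -
  have ev: "\<forall>\<^sub>F y in nhds x. (u has_derivative (\<lambda>h. grad u y \<bullet> h)) (at y)"
    using assms unfolding twice_differentiable_at_def
    by (auto elim!: eventually_mono intro: has_derivative_grad)
  obtain D where D: "(grad u has_derivative D) (at x)"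
    using assms unfolding twice_differentiable_at_def differentiable_def by blast
  have lin: "linear D" using D by (rule has_derivative_linear)
  have "D = (\<lambda>h. matrix D *v h)" using matrix_vector_mul(1)[OF lin[folded linear_matrix_vector_mul_eq]] by simp
  with D have "second_order_at u x (grad u x) (matrix D)"
    using ev unfolding second_order_at_def by auto
  with second_order_atD(2)[OF this] show ?thesis by simp
qed

lemma second_order_at_cong:
  assumes "second_order_at u x p M" "\<forall>\<^sub>F y in nhds x. w y = u y"
  shows "second_order_at w x p M"
proof -
  obtain G where G: "\<forall>\<^sub>F y in nhds x. (u has_derivative (\<lambda>h. G y \<bullet> h)) (at y)" "G x = p"
      "(G has_derivative (\<lambda>h. M *v h)) (at x)"
    using assms unfolding second_order_at_def by blast
  have "\<forall>\<^sub>F y in nhds x. (w has_derivative (\<lambda>h. G y \<bullet> h)) (at y)"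
    using G(1) iffD2[OF eventually_eventually assms(2)]
  proof eventually_elim
    case (elim y)
    have "\<forall>\<^sub>F z in at y. u z = w z"
      using elim(2) by (simp add: eventually_at_filter eventually_mono eq_commute)
    then show ?case
      by (rule has_derivative_transform_eventually[OF elim(1)])
         (simp_all add: eventually_nhds_x_imp_x[OF elim(2)])
  qed
  with G show ?thesis unfolding second_order_at_def by blast
qed

lemma second_order_at_diff:
  assumes "second_order_at u x p M" "second_order_at w x q N"
  shows "second_order_at (\<lambda>y. u y - w y) x (p - q) (M - N)"
proof -
  obtain G where G: "\<forall>\<^sub>F y in nhds x. (u has_derivative (\<lambda>h. G y \<bullet> h)) (at y)" "G x = p"
      "(G has_derivative (\<lambda>h. M *v h)) (at x)"
    using assms(1) unfolding second_order_at_def by blast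
  obtain F where F: "\<forall>\<^sub>F y in nhds x. (w has_derivative (\<lambda>h. F y \<bullet> h)) (at y)" "F x = q"
      "(F has_derivative (\<lambda>h. N *v h)) (at x)"
    using assms(2) unfolding second_order_at_def by blast
  have "\<forall>\<^sub>F y in nhds x. ((\<lambda>y. u y - w y) has_derivative (\<lambda>h. (G y - F y) \<bullet> h)) (at y)"
    using G(1) F(1) by eventually_elim (auto intro!: derivative_eq_intros simp: inner_diff_left)
  moreover have "((\<lambda>y. G y - F y) has_derivative (\<lambda>h. (M - N) *v h)) (at x)"
    using G(3) F(3) by (auto intro!: derivative_eq_intros simp: matrix_vector_mult_diff_rdistrib)
  ultimately show ?thesis using G(2) F(2) unfolding second_order_at_def
    by (intro exI[of _ "\<lambda>y. G y - F y"]) simp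
qed

lemma second_order_at_inner: "second_order_at (\<lambda>y. q \<bullet> y) x q 0"
  unfolding second_order_at_def
  by (rule exI[of _ "\<lambda>_. q"]) (auto intro!: derivative_eq_intros always_eventually)

lemma second_order_at_rescale:
  fixes u :: "real ^ 'n::finite \<Rightarrow> real"
  assumes "second_order_at u ((1 / c) *\<^sub>R x) p M" "c > 0"
  shows "second_order_at (\<lambda>y. c * u ((1 / c) *\<^sub>R y)) x p ((1 / c) *\<^sub>R M)"
proof -
  let ?m = "\<lambda>y. (1 / c) *\<^sub>R y :: real ^ 'n"
  obtain G where G: "\<forall>\<^sub>F y in nhds (?m x). (u has_derivative (\<lambda>h. G y \<bullet> h)) (at y)" "G (?m x) = p"
      "(G has_derivative (\<lambda>h. M *v h)) (at (?m x))"
    using assms(1) unfolding second_order_at_def by blast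
  have m: "(?m has_derivative ?m) (at y)" for y
    by (auto intro!: derivative_eq_intros)
  have "filterlim ?m (nhds (?m x)) (nhds x)"
    by (intro tendsto_intros filterlim_ident)
  from eventually_compose_filterlim[OF G(1) this]
  have "\<forall>\<^sub>F y in nhds x. ((\<lambda>y. c * u (?m y)) has_derivative (\<lambda>h. G (?m y) \<bullet> h)) (at y)"
  proof eventually_elim
    case (elim y)
    from has_derivative_compose[OF m elim] have "((\<lambda>y. u (?m y)) has_derivative (\<lambda>h. G (?m y) \<bullet> ?m h)) (at y)" .
    from has_derivative_mult_right[OF this, of c] show ?case using assms(2) by simp
  qed
  moreover have "((\<lambda>y. G (?m y)) has_derivative (\<lambda>h. ((1 / c) *\<^sub>R M) *v h)) (at x)"
    using has_derivative_compose[OF m G(3)]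
    by (simp add: scaleR_matrix_vector_assoc matrix_vector_mult_scaleR)
  ultimately show ?thesis using G(2) unfolding second_order_at_def
    by (intro exI[of _ "\<lambda>y. G (?m y)"]) simp
qed

definition outer :: "real ^ 'n::finite \<Rightarrow> real ^ 'n ^ 'n" where
  "outer p = (\<chi> i j. p $ i * p $ j)"

lemma outer_mult_vec: "outer p *v h = (p \<bullet> h) *\<^sub>R p"
  by (simp add: outer_def matrix_vector_mult_def vec_eq_iff inner_vec_def sum_distrib_left mult_ac)

lemma second_order_at_half_square:
  assumes "second_order_at g x p M"
  shows "second_order_at (\<lambda>y. (g y - a)\<^sup>2 / 2 + b) x ((g x - a) *\<^sub>R p) ((g x - a) *\<^sub>R M + outer p)"
proof -
  obtain G where G: "\<forall>\<^sub>F y in nhds x. (g has_derivative (\<lambda>h. G y \<bullet> h)) (at y)" "G x = p"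
      "(G has_derivative (\<lambda>h. M *v h)) (at x)"
    using assms unfolding second_order_at_def by blast
  have 1: "\<forall>\<^sub>F y in nhds x. ((\<lambda>y. (g y - a)\<^sup>2 / 2 + b) has_derivative (\<lambda>h. ((g y - a) *\<^sub>R G y) \<bullet> h)) (at y)"
    using G(1) by eventually_elim (auto intro!: derivative_eq_intros simp: fun_eq_iff)
  have 2: "((\<lambda>y. (g y - a) *\<^sub>R G y) has_derivative (\<lambda>h. ((g x - a) *\<^sub>R M + outer p) *v h)) (at x)"
    using eventually_nhds_x_imp_x[OF G(1)] G(2,3)
    by (auto intro!: derivative_eq_intros
        simp: matrix_vector_mult_add_rdistrib outer_mult_vec scaleR_matrix_vector_assoc)
  show ?thesis unfolding second_order_at_def
    by (rule exI[of _ "\<lambda>y. (g y - a) *\<^sub>R G y"]) (use 1 2 G(2) in blast)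
qed

text \<open>The mixed second difference of \<open>u\<close> along \<open>v\<close> and \<open>w\<close> is symmetric in \<open>v\<close> and \<open>w\<close>, and by the
  mean value theorem it approximates the second derivative in either order. Differentiability of
  the gradient at the single point \<open>x\<close> is enough for this.\<close>

lemma second_order_at_symmetric:
  fixes u :: "real ^ 'n::finite \<Rightarrow> real"
  assumes "second_order_at u x p M"
  shows "transpose M = M"
proof -
  obtain G where G: "\<forall>\<^sub>F y in nhds x. (u has_derivative (\<lambda>h. G y \<bullet> h)) (at y)" "G x = p"
      "(G has_derivative (\<lambda>h. M *v h)) (at x)"
    using assms unfolding second_order_at_def by blast
  have sym: "v \<bullet> (M *v w) = w \<bullet> (M *v v)" for v w
  proof (rule ccontr)
    assume ne: "v \<bullet> (M *v w) \<noteq> w \<bullet> (M *v v)"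
    define N where "N = norm v + norm w + 1"
    have N: "N > 0" "norm v \<le> N" "norm w \<le> N" "norm v + norm w \<le> N" by (auto simp: N_def intro: add_nonneg_pos)
    define e where "e = \<bar>v \<bullet> (M *v w) - w \<bullet> (M *v v)\<bar> / (8 * N\<^sup>2)"
    have e: "e > 0" using ne N by (simp add: e_def)
    obtain d1 where d1: "d1 > 0" "\<And>y. dist y x < d1 \<Longrightarrow> (u has_derivative (\<lambda>h. G y \<bullet> h)) (at y)"
      using G(1) unfolding eventually_nhds_metric by blast
    obtain d2 where d2: "d2 > 0" "\<And>y. norm (y - x) < d2 \<Longrightarrow>
         norm (G y - G x - M *v (y - x)) \<le> e * norm (y - x)"
      using G(3) e unfolding has_derivative_at_alt by blast
    define s where "s = min d1 d2 / (2 * N)"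
    have s: "s > 0" using d1 d2 N by (simp add: s_def)
    have sN: "s * N < d1" "s * N < d2" using d1 d2 N by (auto simp: s_def min_def field_simps)
    have key: "\<bar>(u (x + s *\<^sub>R a + s *\<^sub>R b) - u (x + s *\<^sub>R a) - u (x + s *\<^sub>R b) + u x)
            - s\<^sup>2 * (a \<bullet> (M *v b))\<bar> \<le> 2 * e * s\<^sup>2 * N\<^sup>2"
      if ab: "norm a + norm b \<le> N" for a b
    proof -
      have nab: "norm a \<le> N" using ab norm_ge_zero[of b] by linarith
      define \<phi> where "\<phi> = (\<lambda>\<tau>. u (x + \<tau> *\<^sub>R (s *\<^sub>R a) + s *\<^sub>R b) - u (x + \<tau> *\<^sub>R (s *\<^sub>R a)))"
      have near: "norm (\<tau> *\<^sub>R (s *\<^sub>R a) + s *\<^sub>R b) \<le> s * N" "norm (\<tau> *\<^sub>R (s *\<^sub>R a)) \<le> s * N"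
        if "0 \<le> \<tau>" "\<tau> \<le> 1" for \<tau>
      proof -
        have 1: "norm (\<tau> *\<^sub>R (s *\<^sub>R a)) \<le> s * norm a"
          using that s by (simp add: mult_left_le_one_le)
        have "norm (\<tau> *\<^sub>R (s *\<^sub>R a) + s *\<^sub>R b) \<le> s * norm a + s * norm b"
          using norm_triangle_ineq[of "\<tau> *\<^sub>R (s *\<^sub>R a)" "s *\<^sub>R b"] 1 s by simp
        also have "\<dots> \<le> s * N" using ab s by (metis distrib_left less_eq_real_def mult_left_mono)
        finally show "norm (\<tau> *\<^sub>R (s *\<^sub>R a) + s *\<^sub>R b) \<le> s * N" .
        show "norm (\<tau> *\<^sub>R (s *\<^sub>R a)) \<le> s * N" using 1 s nab
          by (meson dual_order.trans less_imp_le mult_left_mono)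
      qed
      have der: "(\<phi> has_derivative (\<lambda>h. h * ((G (x + \<tau> *\<^sub>R (s *\<^sub>R a) + s *\<^sub>R b) - G (x + \<tau> *\<^sub>R (s *\<^sub>R a))) \<bullet> (s *\<^sub>R a)))) (at \<tau>)"
        if t: "0 \<le> \<tau>" "\<tau> \<le> 1" for \<tau>
      proof -
        let ?y = "x + \<tau> *\<^sub>R (s *\<^sub>R a)"
        have A: "(u has_derivative (\<lambda>h. G (?y + s *\<^sub>R b) \<bullet> h)) (at (?y + s *\<^sub>R b))"
          using near(1)[OF t] sN by (intro d1(2)) (simp add: dist_norm add.assoc)
        have B: "(u has_derivative (\<lambda>h. G ?y \<bullet> h)) (at ?y)"
          using near(2)[OF t] sN by (intro d1(2)) (simp add: dist_norm)
        have "((\<lambda>\<tau>. x + \<tau> *\<^sub>R (s *\<^sub>R a) + s *\<^sub>R b) has_derivative (\<lambda>h. h *\<^sub>R (s *\<^sub>R a))) (at \<tau>)"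
          by (auto intro!: derivative_eq_intros)
        note A' = has_derivative_compose[OF this A]
        have "((\<lambda>\<tau>. x + \<tau> *\<^sub>R (s *\<^sub>R a)) has_derivative (\<lambda>h. h *\<^sub>R (s *\<^sub>R a))) (at \<tau>)"
          by (auto intro!: derivative_eq_intros)
        note B' = has_derivative_compose[OF this B]
        show ?thesis unfolding \<phi>_def
          using has_derivative_diff[OF A' B'] by (simp add: inner_diff_left algebra_simps)
      qed
      have "\<exists>\<xi>\<in>{0<..<1}. \<phi> 1 - \<phi> 0 = (1 - 0) * ((G (x + \<xi> *\<^sub>R (s *\<^sub>R a) + s *\<^sub>R b) - G (x + \<xi> *\<^sub>R (s *\<^sub>R a))) \<bullet> (s *\<^sub>R a))"
        using mvt_simple[of 0 1 \<phi> "\<lambda>\<tau> h. h * ((G (x + \<tau> *\<^sub>R (s *\<^sub>R a) + s *\<^sub>R b) - G (x + \<tau> *\<^sub>R (s *\<^sub>R a))) \<bullet> (s *\<^sub>R a))"]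
          der has_derivative_at_withinI by (metis atLeastAtMost_iff zero_less_one)
      then obtain \<xi> where \<xi>: "0 \<le> \<xi>" "\<xi> \<le> 1"
        "\<phi> 1 - \<phi> 0 = (G (x + \<xi> *\<^sub>R (s *\<^sub>R a) + s *\<^sub>R b) - G (x + \<xi> *\<^sub>R (s *\<^sub>R a))) \<bullet> (s *\<^sub>R a)"
        by (metis diff_zero greaterThanLessThan_iff less_imp_le mult_1)
      let ?k1 = "\<xi> *\<^sub>R (s *\<^sub>R a) + s *\<^sub>R b" and ?k2 = "\<xi> *\<^sub>R (s *\<^sub>R a)"
      define r1 where "r1 = G (x + ?k1) - G x - M *v ?k1"
      define r2 where "r2 = G (x + ?k2) - G x - M *v ?k2"
      have r: "norm (G (x + k) - G x - M *v k) \<le> e * (s * N)" if "norm k \<le> s * N" for k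
      proof -
        have "norm (G (x + k) - G x - M *v k) \<le> e * norm k"
          using d2(2)[of "x + k"] that sN by simp
        also have "\<dots> \<le> e * (s * N)" using that e by (intro mult_left_mono) auto
        finally show ?thesis .
      qed
      have r1: "norm r1 \<le> e * (s * N)" unfolding r1_def by (rule r[OF near(1)[OF \<xi>(1,2)]])
      have r2: "norm r2 \<le> e * (s * N)" unfolding r2_def by (rule r[OF near(2)[OF \<xi>(1,2)]])
      have E: "G (x + ?k1) - G (x + ?k2) = M *v (s *\<^sub>R b) + (r1 - r2)"
        by (simp add: r1_def r2_def matrix_vector_right_distrib)
      have "\<phi> 1 - \<phi> 0 - s\<^sup>2 * (a \<bullet> (M *v b)) = (r1 - r2) \<bullet> (s *\<^sub>R a)"
        unfolding \<xi>(3) add.assoc E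
        by (simp add: inner_add_left matrix_vector_mult_scaleR inner_commute[of a] power2_eq_square algebra_simps)
      moreover have "\<bar>(r1 - r2) \<bullet> (s *\<^sub>R a)\<bar> \<le> norm (r1 - r2) * norm (s *\<^sub>R a)"
        by (rule Cauchy_Schwarz_ineq2)
      moreover have "norm (r1 - r2) \<le> 2 * (e * (s * N))"
        using norm_triangle_ineq4[of r1 r2] r1 r2 by linarith
      moreover have "norm (s *\<^sub>R a) \<le> s * N" using nab s by simp
      ultimately have "\<bar>\<phi> 1 - \<phi> 0 - s\<^sup>2 * (a \<bullet> (M *v b))\<bar> \<le> 2 * (e * (s * N)) * (s * N)"
        using mult_mono[of "norm (r1 - r2)" "2 * (e * (s * N))" "norm (s *\<^sub>R a)" "s * N"] e s N
        by (simp del: norm_scaleR inner_scaleR_right)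
      then show ?thesis by (simp add: \<phi>_def power2_eq_square algebra_simps)
    qed
    have 1: "\<bar>(u (x + s *\<^sub>R v + s *\<^sub>R w) - u (x + s *\<^sub>R v) - u (x + s *\<^sub>R w) + u x)
            - s\<^sup>2 * (v \<bullet> (M *v w))\<bar> \<le> 2 * e * s\<^sup>2 * N\<^sup>2" by (rule key) (rule N(4))
    have 2: "\<bar>(u (x + s *\<^sub>R w + s *\<^sub>R v) - u (x + s *\<^sub>R w) - u (x + s *\<^sub>R v) + u x)
            - s\<^sup>2 * (w \<bullet> (M *v v))\<bar> \<le> 2 * e * s\<^sup>2 * N\<^sup>2" by (rule key) (use N(4) in linarith)
    have "x + s *\<^sub>R w + s *\<^sub>R v = x + s *\<^sub>R v + s *\<^sub>R w" by simp
    note 2 = 2[unfolded this]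
    from 1 2 have "\<bar>s\<^sup>2 * (v \<bullet> (M *v w)) - s\<^sup>2 * (w \<bullet> (M *v v))\<bar> \<le> 4 * e * s\<^sup>2 * N\<^sup>2"
      by (simp only: abs_le_iff) linarith
    also have "\<bar>s\<^sup>2 * (v \<bullet> (M *v w)) - s\<^sup>2 * (w \<bullet> (M *v v))\<bar> = s\<^sup>2 * (8 * N\<^sup>2 * e)"
      using N unfolding right_diff_distrib[symmetric] by (simp add: e_def abs_mult)
    finally have "s\<^sup>2 * N\<^sup>2 * e * 4 \<le> 0" by (simp add: algebra_simps)
    moreover have "s\<^sup>2 * N\<^sup>2 * e * 4 > 0" using s N e by simp
    ultimately show False by simp
  qed
  have "M $ j $ i = M $ i $ j" for i j
    using sym[of "axis j 1" "axis i 1"]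
    by (simp add: matrix_vector_mult_basis column_def inner_axis')
  then show ?thesis by (simp add: vec_eq_iff transpose_def)
qed

text \<open>If \<open>v \<bullet> M v\<close> were negative, \<open>u\<close> would decrease strictly along the ray in direction \<open>v\<close>.\<close>

lemma second_order_at_local_min:
  assumes u: "second_order_at u x p M" and min: "\<forall>\<^sub>F y in nhds x. u x \<le> u y"
  shows "p = 0" "v \<bullet> (M *v v) \<ge> 0"
proof -
  obtain G where G: "\<forall>\<^sub>F y in nhds x. (u has_derivative (\<lambda>h. G y \<bullet> h)) (at y)" "G x = p"
      "(G has_derivative (\<lambda>h. M *v h)) (at x)"
    using u unfolding second_order_at_def by blast
  have "(\<lambda>h. p \<bullet> h) = (\<lambda>h. 0)"
    by (rule has_derivative_local_min[OF second_order_atD(3)[OF u]])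
       (use min in \<open>simp add: eventually_at_filter eventually_mono\<close>)
  then show p: "p = 0" by (metis inner_eq_zero_iff)
  show "v \<bullet> (M *v v) \<ge> 0"
  proof (rule ccontr)
    assume "\<not> v \<bullet> (M *v v) \<ge> 0"
    then have neg: "(M *v v) \<bullet> v < 0" by (simp add: inner_commute)
    have line: "((\<lambda>s. x + s *\<^sub>R v) has_derivative (\<lambda>h. h *\<^sub>R v)) (at s)" for s
      by (auto intro!: derivative_eq_intros)
    have "((\<lambda>s. G (x + s *\<^sub>R v)) has_derivative (\<lambda>h. M *v (h *\<^sub>R v))) (at 0)"
      using has_derivative_compose[OF line[of 0], of G "\<lambda>h. M *v h"] G(3) by simp
    then have "((\<lambda>s. G (x + s *\<^sub>R v) \<bullet> v) has_real_derivative (M *v v) \<bullet> v) (at 0)"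
      unfolding has_field_derivative_def
      by (auto intro!: derivative_eq_intros simp: matrix_vector_mult_scaleR fun_eq_iff)
    from DERIV_neg_dec_right[OF this neg] obtain d where d: "d > 0"
      "\<And>h. 0 < h \<Longrightarrow> h < d \<Longrightarrow> G (x + h *\<^sub>R v) \<bullet> v < 0"
      using G(2) p by auto
    have "filterlim (\<lambda>s. x + s *\<^sub>R v) (nhds (x + 0 *\<^sub>R v)) (nhds 0)"
      by (intro tendsto_intros filterlim_ident)
    then have "filterlim (\<lambda>s. x + s *\<^sub>R v) (nhds x) (nhds 0)" by simp
    from eventually_compose_filterlim[OF eventually_conj[OF G(1) min] this]
    obtain d' where d': "d' > 0" "\<And>s. \<bar>s\<bar> < d' \<Longrightarrow>
        (u has_derivative (\<lambda>h. G (x + s *\<^sub>R v) \<bullet> h)) (at (x + s *\<^sub>R v)) \<and> u x \<le> u (x + s *\<^sub>R v)"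
      unfolding eventually_nhds_metric by (auto simp: dist_real_def)
    define b where "b = min d d' / 2"
    have b: "0 < b" "b < d" "b < d'" using d d' by (auto simp: b_def min_def)
    have der: "((\<lambda>s. u (x + s *\<^sub>R v)) has_real_derivative G (x + s *\<^sub>R v) \<bullet> v) (at s)" if "0 \<le> s" "s \<le> b" for s
    proof -
      have "(u has_derivative (\<lambda>h. G (x + s *\<^sub>R v) \<bullet> h)) (at (x + s *\<^sub>R v))"
        using d'(2)[of s] that b by auto
      from has_derivative_compose[OF line this] show ?thesis
        unfolding has_field_derivative_def by (simp add: mult.commute[of _ "_ \<bullet> _"] fun_eq_iff)
    qed
    have "u (x + b *\<^sub>R v) < u (x + 0 *\<^sub>R v)"
    proof (rule DERIV_neg_imp_decreasing_open[OF b(1)])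
      show "\<exists>y. ((\<lambda>s. u (x + s *\<^sub>R v)) has_real_derivative y) (at s) \<and> y < 0" if "0 < s" "s < b" for s
        using der[of s] d(2)[of s] that b by auto
      show "continuous_on {0..b} (\<lambda>s. u (x + s *\<^sub>R v))"
        by (rule DERIV_continuous_on[where D = "\<lambda>s. G (x + s *\<^sub>R v) \<bullet> v"])
           (auto intro: der has_field_derivative_at_within)
    qed
    with d'(2)[of b] b show False by simp
  qed
qed

section \<open>Monotonicity of the speed on positive semidefinite matrices\<close>

definition psd :: "real ^ 'n::finite ^ 'n \<Rightarrow> bool" where
  "psd A \<longleftrightarrow> transpose A = A \<and> (\<forall>v. v \<bullet> (A *v v) \<ge> 0)"

lemma psd_add: "psd A \<Longrightarrow> psd B \<Longrightarrow> psd (A + B)"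
  by (simp add: psd_def vec_eq_iff transpose_def matrix_vector_mult_add_rdistrib inner_add_right)

lemma psd_scaleR: "psd A \<Longrightarrow> c \<ge> 0 \<Longrightarrow> psd (c *\<^sub>R A)"
  by (simp add: psd_def vec_eq_iff transpose_def flip: scaleR_matrix_vector_assoc)

lemma transpose_form:
  fixes A :: "real ^ 'n::finite ^ 'n"
  assumes "transpose A = A"
  shows "v \<bullet> (A *v w) = w \<bullet> (A *v v)"
  by (metis assms dot_lmul_matrix inner_commute transpose_matrix_vector)

lemma psd_Cauchy_Schwarz:
  assumes "psd A"
  shows "(v \<bullet> (A *v w))\<^sup>2 \<le> (v \<bullet> (A *v v)) * (w \<bullet> (A *v w))"
proof -
  define a b c where "a = v \<bullet> (A *v v)" and "b = v \<bullet> (A *v w)" and "c = w \<bullet> (A *v w)"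
  have sym: "w \<bullet> (A *v v) = b"
    using transpose_form[of A v w] assms by (simp add: b_def psd_def)
  have q: "0 \<le> a + 2 * t * b + t\<^sup>2 * c" for t
  proof -
    have "0 \<le> (v + t *\<^sub>R w) \<bullet> (A *v (v + t *\<^sub>R w))" using assms by (simp add: psd_def)
    also have "\<dots> = a + 2 * t * b + t\<^sup>2 * c"
      using sym by (simp add: a_def b_def c_def matrix_vector_right_distrib matrix_vector_mult_scaleR
          inner_add_left inner_add_right power2_eq_square algebra_simps)
    finally show ?thesis .
  qed
  have "c \<ge> 0" using assms by (simp add: c_def psd_def)
  show ?thesis unfolding a_def[symmetric] b_def[symmetric] c_def[symmetric]
  proof (cases "c = 0")
    case True
    have "b = 0"
    proof (rule ccontr)
      assume "b \<noteq> 0"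
      define t where "t = - (a + 1) / (2 * b)"
      have "2 * t * b = - (a + 1)" using \<open>b \<noteq> 0\<close> by (simp add: t_def)
      then show False using q[of t] True by simp
    qed
    then show "b\<^sup>2 \<le> a * c" using True by simp
  next
    case False
    then have "c > 0" using \<open>c \<ge> 0\<close> by simp
    then show "b\<^sup>2 \<le> a * c" using q[of "- b / c"] by (simp add: power2_eq_square field_simps)
  qed
qed

lemma entry_eq_form: "A $ i $ j = axis i 1 \<bullet> (A *v axis j (1::real))"
  by (simp add: matrix_vector_mult_basis column_def inner_axis')

lemma outer_form: "v \<bullet> (outer p *v w) = (p \<bullet> v) * (p \<bullet> w)"
  by (simp add: outer_mult_vec inner_commute)

lemma transpose_outer: "transpose (outer p) = outer p"
  by (simp add: vec_eq_iff transpose_def outer_def mult.commute)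

text \<open>A positive semidefinite matrix is a sum of rank-one matrices \<open>outer d\<close> (Cholesky elimination:
  subtracting \<open>A e\<^sub>i (A e\<^sub>i)\<^sup>T / A\<^sub>i\<^sub>i\<close> keeps the matrix positive semidefinite and clears row \<open>i\<close>), so an
  additive functional is nonnegative on the cone once it is nonnegative on rank-one matrices.\<close>

lemma psd_additive_nonneg:
  fixes \<phi> :: "real ^ 'n::finite ^ 'n \<Rightarrow> real"
  assumes add: "\<And>A B. \<phi> (A + B) = \<phi> A + \<phi> B" and rank1: "\<And>d. \<phi> (outer d) \<ge> 0"
    and "psd A"
  shows "\<phi> A \<ge> 0"
  using \<open>psd A\<close>
proof (induction "card {i. A $ i $ i \<noteq> 0}" arbitrary: A rule: less_induct)
  case less
  have CS: "(A $ j $ i)\<^sup>2 \<le> A $ j $ j * A $ i $ i" for i j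
    using psd_Cauchy_Schwarz[OF less.prems] unfolding entry_eq_form .
  show ?case
  proof (cases "\<exists>i. A $ i $ i \<noteq> 0")
    case False
    then have "A $ j $ i = 0" for i j using CS[of j i] by simp
    then have "A = 0" by (simp add: vec_eq_iff)
    moreover have "\<phi> 0 = 0" using add[of 0 0] by simp
    ultimately show ?thesis by simp
  next
    case True
    then obtain i where i: "A $ i $ i \<noteq> 0" by blast
    define a where "a = A $ i $ i"
    have "A $ i $ i \<ge> 0" using less.prems by (simp add: psd_def entry_eq_form)
    with i have a: "a > 0" by (simp add: a_def)
    define d where "d = (1 / sqrt a) *\<^sub>R (A *v axis i 1)"
    define B where "B = A - outer d"
    have d: "(d \<bullet> v)\<^sup>2 = (v \<bullet> (A *v axis i 1))\<^sup>2 / a" for v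
      using a by (simp add: d_def power_mult_distrib power_divide inner_commute)
    have "psd B"
      unfolding psd_def
    proof (intro conjI allI)
      show "transpose B = B"
        using less.prems transpose_outer[of d] by (simp add: psd_def B_def vec_eq_iff transpose_def)
      show "v \<bullet> (B *v v) \<ge> 0" for v
      proof -
        have "v \<bullet> (B *v v) = v \<bullet> (A *v v) - (v \<bullet> (A *v axis i 1))\<^sup>2 / a"
          by (simp add: B_def matrix_vector_mult_diff_rdistrib inner_diff_right outer_form
              flip: d power2_eq_square)
        moreover have "(v \<bullet> (A *v axis i 1))\<^sup>2 \<le> v \<bullet> (A *v v) * a"
          using psd_Cauchy_Schwarz[OF less.prems, of v "axis i 1"] by (simp add: a_def entry_eq_form)
        ultimately show ?thesis using a by (simp add: pos_divide_le_eq)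
      qed
    qed
    have diag: "B $ j $ j = A $ j $ j - (A $ j $ i)\<^sup>2 / a" for j
    proof -
      have "B $ j $ j = A $ j $ j - (d $ j)\<^sup>2" by (simp add: B_def outer_def power2_eq_square)
      also have "(d $ j)\<^sup>2 = (d \<bullet> axis j 1)\<^sup>2" by (simp add: inner_axis)
      finally show ?thesis unfolding d by (simp add: entry_eq_form)
    qed
    have "{j. B $ j $ j \<noteq> 0} \<subset> {j. A $ j $ j \<noteq> 0}"
    proof
      show "{j. B $ j $ j \<noteq> 0} \<subseteq> {j. A $ j $ j \<noteq> 0}"
      proof clarsimp
        fix j assume "B $ j $ j \<noteq> 0" "A $ j $ j = 0"
        then show False using CS[of j i] diag[of j] by simp
      qed
      show "{j. B $ j $ j \<noteq> 0} \<noteq> {j. A $ j $ j \<noteq> 0}"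
      proof -
        have "B $ i $ i = 0" using diag[of i] a by (simp add: a_def power2_eq_square)
        with i show ?thesis by blast
      qed
    qed
    then have "card {j. B $ j $ j \<noteq> 0} < card {j. A $ j $ j \<noteq> 0}"
      by (intro psubset_card_mono) simp_all
    then have "\<phi> B \<ge> 0" using \<open>psd B\<close> by (rule less.hyps)
    moreover have "\<phi> A = \<phi> B + \<phi> (outer d)" using add[of B "outer d"] by (simp add: B_def)
    ultimately show ?thesis using rank1[of d] by simp
  qed
qed

text \<open>The polarisation of \<open>2 \<sigma>\<^sub>2\<close> in the metric \<open>P\<close>: \<open>tr (P A) tr (P B) - tr (P A P B)\<close>.\<close>

definition mixed :: "real ^ 'n::finite ^ 'n \<Rightarrow> real ^ 'n ^ 'n \<Rightarrow> real ^ 'n ^ 'n \<Rightarrow> real" where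
  "mixed P A B = (\<Sum>i\<in>UNIV. \<Sum>j\<in>UNIV. \<Sum>k\<in>UNIV. \<Sum>l\<in>UNIV.
     P $ i $ k * P $ j $ l * (A $ k $ i * B $ l $ j - A $ k $ j * B $ l $ i))"

lemma mixed_add: "mixed P (A + B) C = mixed P A C + mixed P B C"
  unfolding mixed_def sum.distrib[symmetric] by (simp add: algebra_simps)

lemma mixed_diff: "mixed P (A - B) C = mixed P A C - mixed P B C"
  unfolding mixed_def sum_subtractf[symmetric] by (simp add: algebra_simps)

lemma mixed_scaleR: "mixed P (c *\<^sub>R A) C = c * mixed P A C"
  unfolding mixed_def sum_distrib_left by (simp add: algebra_simps)

lemma mixed_commute: "mixed P A B = mixed P B A"
proof -
  let ?t = "\<lambda>i j k l. P $ i $ k * P $ j $ l * (A $ k $ i * B $ l $ j - A $ k $ j * B $ l $ i)"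
  have "mixed P A B = (\<Sum>j\<in>UNIV. \<Sum>i\<in>UNIV. \<Sum>k\<in>UNIV. \<Sum>l\<in>UNIV. ?t i j k l)"
    unfolding mixed_def by (rule sum.swap)
  also have "\<dots> = (\<Sum>j\<in>UNIV. \<Sum>i\<in>UNIV. \<Sum>l\<in>UNIV. \<Sum>k\<in>UNIV. ?t i j k l)"
    by (intro sum.cong refl sum.swap)
  also have "\<dots> = mixed P B A"
    unfolding mixed_def by (simp add: mult_ac)
  finally show ?thesis .
qed

lemma mixed_add_right: "mixed P C (A + B) = mixed P C A + mixed P C B"
  using mixed_add[of P A B C] by (simp only: mixed_commute[of P C])

lemma mixed_scaleR_right: "mixed P C (c *\<^sub>R A) = c * mixed P C A"
  using mixed_scaleR[of P c A C] by (simp only: mixed_commute[of P C])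

lemma form_eq_sum: "v \<bullet> (A *v w) = (\<Sum>i\<in>UNIV. \<Sum>k\<in>UNIV. A $ i $ k * v $ i * w $ k)"
  by (simp add: inner_vec_def matrix_vector_mult_def sum_distrib_left mult_ac)

lemma mixed_outer:
  assumes "transpose P = P"
  shows "mixed P (outer d) (outer e) = (d \<bullet> (P *v d)) * (e \<bullet> (P *v e)) - (d \<bullet> (P *v e))\<^sup>2"
proof -
  have "mixed P (outer d) (outer e) =
      (\<Sum>i\<in>UNIV. \<Sum>j\<in>UNIV. \<Sum>k\<in>UNIV. \<Sum>l\<in>UNIV. (P $ i $ k * d $ i * d $ k) * (P $ j $ l * e $ j * e $ l))
    - (\<Sum>i\<in>UNIV. \<Sum>j\<in>UNIV. \<Sum>k\<in>UNIV. \<Sum>l\<in>UNIV. (P $ i $ k * e $ i * d $ k) * (P $ j $ l * d $ j * e $ l))"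
    unfolding mixed_def sum_subtractf[symmetric] by (simp add: outer_def algebra_simps)
  also have "(\<Sum>i\<in>UNIV. \<Sum>j\<in>UNIV. \<Sum>k\<in>UNIV. \<Sum>l\<in>UNIV. (P $ i $ k * d $ i * d $ k) * (P $ j $ l * e $ j * e $ l))
      = (d \<bullet> (P *v d)) * (e \<bullet> (P *v e))"
    unfolding form_eq_sum sum_product ..
  also have "(\<Sum>i\<in>UNIV. \<Sum>j\<in>UNIV. \<Sum>k\<in>UNIV. \<Sum>l\<in>UNIV. (P $ i $ k * e $ i * d $ k) * (P $ j $ l * d $ j * e $ l))
      = (e \<bullet> (P *v d)) * (d \<bullet> (P *v e))"
    unfolding form_eq_sum sum_product ..
  finally show ?thesis using transpose_form[OF assms, of e d] by (simp add: power2_eq_square)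
qed

text \<open>On rank-one matrices this is the Cauchy--Schwarz inequality for \<open>P\<close>.\<close>

lemma mixed_nonneg:
  assumes P: "psd P" and "psd A" "psd B"
  shows "mixed P A B \<ge> 0"
proof (rule psd_additive_nonneg[OF _ _ \<open>psd A\<close>])
  show "mixed P (A + A') B = mixed P A B + mixed P A' B" for A A' by (rule mixed_add)
  fix d
  show "mixed P (outer d) B \<ge> 0"
  proof (rule psd_additive_nonneg[OF _ _ \<open>psd B\<close>])
    show "mixed P (outer d) (B + B') = mixed P (outer d) B + mixed P (outer d) B'" for B B'
      by (metis mixed_add mixed_commute)
    show "mixed P (outer d) (outer e) \<ge> 0" for e
      using psd_Cauchy_Schwarz[OF P, of d e] P by (simp add: mixed_outer psd_def)
  qed
qed

definition tangent_metric :: "real ^ 'n::finite \<Rightarrow> real ^ 'n ^ 'n" where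
  "tangent_metric r = mat 1 - (1 / (1 + (norm r)\<^sup>2)) *\<^sub>R outer r"

lemma psd_tangent_metric: "psd (tangent_metric r)"
  unfolding psd_def
proof (intro conjI allI)
  show "transpose (tangent_metric r) = tangent_metric r"
    by (simp add: tangent_metric_def vec_eq_iff transpose_def outer_def mat_def mult.commute)
  fix v
  have "(r \<bullet> v)\<^sup>2 \<le> (norm r)\<^sup>2 * (norm v)\<^sup>2"
    using Cauchy_Schwarz_ineq[of r v] by (simp add: power2_norm_eq_inner)
  also have "\<dots> \<le> (1 + (norm r)\<^sup>2) * (norm v)\<^sup>2" by (simp add: mult_right_mono)
  finally have "(r \<bullet> v)\<^sup>2 / (1 + (norm r)\<^sup>2) \<le> (norm v)\<^sup>2"
    by (simp add: divide_le_eq add_pos_nonneg mult.commute)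
  moreover have "v \<bullet> (tangent_metric r *v v) = (norm v)\<^sup>2 - (r \<bullet> v)\<^sup>2 / (1 + (norm r)\<^sup>2)"
    by (simp add: tangent_metric_def matrix_vector_mult_diff_rdistrib inner_diff_right outer_mult_vec
        dot_square_norm power2_eq_square[of "r \<bullet> v"] inner_commute[of v r]
        flip: scaleR_matrix_vector_assoc)
  ultimately show "v \<bullet> (tangent_metric r *v v) \<ge> 0" by simp
qed

definition speed :: "real ^ 'n::finite \<Rightarrow> real ^ 'n ^ 'n \<Rightarrow> real" where
  "speed r H = mixed (tangent_metric r) H H / (2 * sqrt (1 + (norm r)\<^sup>2))"

lemma graph_speed_eq: "graph_speed u x = speed (grad u x) (hess u x)"
  by (simp add: graph_speed_def speed_def mixed_def tangent_metric_def outer_def mat_def Let_def)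

lemma speed_nonneg: "psd H \<Longrightarrow> speed r H \<ge> 0"
  unfolding speed_def
  by (intro divide_nonneg_nonneg mixed_nonneg psd_tangent_metric) (simp_all add: add_nonneg_nonneg)

lemma speed_scaleR: "speed r (c *\<^sub>R H) = c\<^sup>2 * speed r H"
  by (simp add: speed_def mixed_scaleR mixed_scaleR_right power2_eq_square)

text \<open>Polarised, \<open>2 (\<sigma>\<^sub>2(B) - \<sigma>\<^sub>2(A))\<close> is the mixed form of \<open>B - A\<close> and \<open>B + A\<close>, both in the cone.\<close>

lemma speed_mono:
  assumes "psd A" "psd (B - A)"
  shows "speed r A \<le> speed r B"
proof -
  let ?P = "tangent_metric r"
  have "psd (B + A)" using psd_add[OF assms(2) psd_add[OF assms(1) assms(1)]] by (simp add: add.commute)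
  then have "0 \<le> mixed ?P (B - A) (B + A)"
    using mixed_nonneg[OF psd_tangent_metric assms(2)] by blast
  also have "\<dots> = mixed ?P B B - mixed ?P A A"
    by (simp add: mixed_diff mixed_add_right mixed_commute[of _ A B])
  finally show ?thesis unfolding speed_def by (simp add: divide_right_mono add_nonneg_nonneg)
qed

section \<open>The speed of the pressure\<close>

text \<open>For \<open>u = g\<^sup>2/2\<close>, \<open>\<sigma>\<^sub>2\<close> vanishes on the rank-one part \<open>p p\<^sup>T\<close> of the Hessian, so one
  factor \<open>s = g\<close> splits off the speed; \<open>pressure_speed s p M\<close> is what remains.\<close>

definition pressure_speed :: "real \<Rightarrow> real ^ 'n::finite \<Rightarrow> real ^ 'n ^ 'n \<Rightarrow> real" where
  "pressure_speed s p M =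
     (s * mixed (tangent_metric (s *\<^sub>R p)) M M + 2 * mixed (tangent_metric (s *\<^sub>R p)) M (outer p))
       / (2 * sqrt (1 + (norm (s *\<^sub>R p))\<^sup>2))"

lemma speed_half_square: "speed (s *\<^sub>R p) (s *\<^sub>R M + outer p) = s * pressure_speed s p M"
proof -
  let ?P = "tangent_metric (s *\<^sub>R p)"
  have 0: "mixed ?P (outer p) (outer p) = 0"
    using psd_tangent_metric[of "s *\<^sub>R p"] by (simp add: mixed_outer psd_def power2_eq_square)
  have "mixed ?P (s *\<^sub>R M + outer p) (s *\<^sub>R M + outer p)
      = s * (s * mixed ?P M M + 2 * mixed ?P M (outer p))"
    by (simp add: mixed_add mixed_add_right mixed_scaleR mixed_scaleR_right 0
        mixed_commute[of _ "outer p" M] algebra_simps)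
  then show ?thesis by (simp add: speed_def pressure_speed_def)
qed

text \<open>The Lipschitz constant of \<open>pressure_speed\<close> in \<open>s\<close> must not depend on \<open>p\<close> and \<open>M\<close>, which enter as a parameter
  \<open>\<theta>\<close>. Boundedness is part of the notion so that it is closed under products; no derivative of the
  speed has to be computed.\<close>

definition uniformly_lipschitz :: "'b set \<Rightarrow> ('b \<Rightarrow> real \<Rightarrow> real) \<Rightarrow> bool" where
  "uniformly_lipschitz \<Theta> F \<longleftrightarrow> (\<exists>C. \<forall>\<theta>\<in>\<Theta>. \<forall>s\<in>{0..1}. \<forall>s'\<in>{0..1}.
     \<bar>F \<theta> s\<bar> \<le> C \<and> \<bar>F \<theta> s - F \<theta> s'\<bar> \<le> C * \<bar>s - s'\<bar>)"

lemma uniformly_lipschitz_add: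
  assumes "uniformly_lipschitz \<Theta> F" "uniformly_lipschitz \<Theta> H"
  shows "uniformly_lipschitz \<Theta> (\<lambda>\<theta> s. F \<theta> s + H \<theta> s)"
proof -
  obtain C D where "\<forall>\<theta>\<in>\<Theta>. \<forall>s\<in>{0..1}. \<forall>s'\<in>{0..1}. \<bar>F \<theta> s\<bar> \<le> C \<and> \<bar>F \<theta> s - F \<theta> s'\<bar> \<le> C * \<bar>s - s'\<bar>"
    "\<forall>\<theta>\<in>\<Theta>. \<forall>s\<in>{0..1}. \<forall>s'\<in>{0..1}. \<bar>H \<theta> s\<bar> \<le> D \<and> \<bar>H \<theta> s - H \<theta> s'\<bar> \<le> D * \<bar>s - s'\<bar>"
    using assms unfolding uniformly_lipschitz_def by blast
  then have "\<forall>\<theta>\<in>\<Theta>. \<forall>s\<in>{0..1}. \<forall>s'\<in>{0..1}. \<bar>F \<theta> s + H \<theta> s\<bar> \<le> C + D \<and>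
      \<bar>(F \<theta> s + H \<theta> s) - (F \<theta> s' + H \<theta> s')\<bar> \<le> (C + D) * \<bar>s - s'\<bar>"
    unfolding distrib_right by (smt (verit, best))
  then show ?thesis unfolding uniformly_lipschitz_def by blast
qed

lemma uniformly_lipschitz_mult:
  assumes "uniformly_lipschitz \<Theta> F" "uniformly_lipschitz \<Theta> H"
  shows "uniformly_lipschitz \<Theta> (\<lambda>\<theta> s. F \<theta> s * H \<theta> s)"
proof -
  obtain C D where C: "\<And>\<theta> s s'. \<theta>\<in>\<Theta> \<Longrightarrow> s\<in>{0..1} \<Longrightarrow> s'\<in>{0..1} \<Longrightarrow> \<bar>F \<theta> s\<bar> \<le> C \<and> \<bar>F \<theta> s - F \<theta> s'\<bar> \<le> C * \<bar>s - s'\<bar>"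
    and D: "\<And>\<theta> s s'. \<theta>\<in>\<Theta> \<Longrightarrow> s\<in>{0..1} \<Longrightarrow> s'\<in>{0..1} \<Longrightarrow> \<bar>H \<theta> s\<bar> \<le> D \<and> \<bar>H \<theta> s - H \<theta> s'\<bar> \<le> D * \<bar>s - s'\<bar>"
    using assms unfolding uniformly_lipschitz_def by blast
  let ?E = "2 * \<bar>C\<bar> * \<bar>D\<bar>"
  have "\<bar>F \<theta> s * H \<theta> s\<bar> \<le> ?E \<and> \<bar>F \<theta> s * H \<theta> s - F \<theta> s' * H \<theta> s'\<bar> \<le> ?E * \<bar>s - s'\<bar>"
    if t: "\<theta>\<in>\<Theta>" "s\<in>{0..1}" "s'\<in>{0..1}" for \<theta> s s'
  proof -
    have F: "\<bar>F \<theta> s\<bar> \<le> \<bar>C\<bar>" "\<bar>F \<theta> s - F \<theta> s'\<bar> \<le> \<bar>C\<bar> * \<bar>s - s'\<bar>"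
      using C[OF t] abs_ge_self[of C] by (auto intro: order_trans mult_right_mono)
    have H: "\<bar>H \<theta> s\<bar> \<le> \<bar>D\<bar>" "\<bar>H \<theta> s'\<bar> \<le> \<bar>D\<bar>" "\<bar>H \<theta> s - H \<theta> s'\<bar> \<le> \<bar>D\<bar> * \<bar>s - s'\<bar>"
      using D[OF t] D[OF t(1,3,2)] abs_ge_self[of D] by (auto intro: order_trans mult_right_mono)
    have 1: "\<bar>F \<theta> s * H \<theta> s\<bar> \<le> \<bar>C\<bar> * \<bar>D\<bar>"
      unfolding abs_mult using F(1) H(1) by (intro mult_mono) auto
    have "F \<theta> s * H \<theta> s - F \<theta> s' * H \<theta> s' = F \<theta> s * (H \<theta> s - H \<theta> s') + (F \<theta> s - F \<theta> s') * H \<theta> s'"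
      by (simp add: algebra_simps)
    then have "\<bar>F \<theta> s * H \<theta> s - F \<theta> s' * H \<theta> s'\<bar>
        \<le> \<bar>F \<theta> s\<bar> * \<bar>H \<theta> s - H \<theta> s'\<bar> + \<bar>F \<theta> s - F \<theta> s'\<bar> * \<bar>H \<theta> s'\<bar>"
      by (metis abs_mult abs_triangle_ineq)
    also have "\<dots> \<le> \<bar>C\<bar> * (\<bar>D\<bar> * \<bar>s - s'\<bar>) + (\<bar>C\<bar> * \<bar>s - s'\<bar>) * \<bar>D\<bar>"
      using F H by (intro add_mono mult_mono) auto
    finally have 2: "\<bar>F \<theta> s * H \<theta> s - F \<theta> s' * H \<theta> s'\<bar> \<le> ?E * \<bar>s - s'\<bar>" by (simp add: algebra_simps)
    have "\<bar>C\<bar> * \<bar>D\<bar> \<ge> 0" by simp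
    with 1 have "\<bar>F \<theta> s * H \<theta> s\<bar> \<le> ?E" by linarith
    with 2 show ?thesis by blast
  qed
  then show ?thesis unfolding uniformly_lipschitz_def by blast
qed

lemma uniformly_lipschitz_const:
  assumes "\<And>\<theta>. \<theta> \<in> \<Theta> \<Longrightarrow> \<bar>c \<theta>\<bar> \<le> B"
  shows "uniformly_lipschitz \<Theta> (\<lambda>\<theta> s. c \<theta>)"
  unfolding uniformly_lipschitz_def
  by (rule exI[of _ "\<bar>B\<bar>"]) (use assms order_trans[OF _ abs_ge_self] in force)

lemma uniformly_lipschitz_minus:
  assumes "uniformly_lipschitz \<Theta> F" "uniformly_lipschitz \<Theta> H"
  shows "uniformly_lipschitz \<Theta> (\<lambda>\<theta> s. F \<theta> s - H \<theta> s)"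
  using uniformly_lipschitz_add[OF assms(1) uniformly_lipschitz_mult[OF
        uniformly_lipschitz_const[of \<Theta> "\<lambda>_. -1" 1] assms(2)]] by simp

lemma uniformly_lipschitz_ident: "uniformly_lipschitz \<Theta> (\<lambda>\<theta> s. s)"
  unfolding uniformly_lipschitz_def by (rule exI[of _ 1]) auto

lemma uniformly_lipschitz_sum:
  assumes "finite I" "\<And>i. i \<in> I \<Longrightarrow> uniformly_lipschitz \<Theta> (F i)"
  shows "uniformly_lipschitz \<Theta> (\<lambda>\<theta> s. \<Sum>i\<in>I. F i \<theta> s)"
  using assms
proof (induction rule: finite_induct)
  case empty
  show ?case using uniformly_lipschitz_const[of \<Theta> "\<lambda>_. 0" 0] by simp
next
  case (insert i I)
  then show ?case using uniformly_lipschitz_add[of \<Theta> "F i" "\<lambda>\<theta> s. \<Sum>i\<in>I. F i \<theta> s"] by simp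
qed

text \<open>\<open>sqrt (1 + a\<^sup>2)\<close> is the norm of \<open>(1, a)\<close>, hence \<open>1\<close>-Lipschitz in \<open>a\<close>, and it is at least \<open>1\<close>.\<close>

lemma uniformly_lipschitz_inverse_sqrt:
  assumes "\<And>\<theta>. \<theta> \<in> \<Theta> \<Longrightarrow> norm (v \<theta>) \<le> L"
  shows "uniformly_lipschitz \<Theta> (\<lambda>\<theta> s. 1 / sqrt (1 + (norm (s *\<^sub>R v \<theta>))\<^sup>2))"
proof -
  define w where "w = (\<lambda>a. sqrt (1 + a\<^sup>2 :: real))"
  have w1: "1 \<le> w a" for a by (simp add: w_def)
  have w0: "0 < w a" for a by (rule less_le_trans[OF zero_less_one w1])
  have lip: "\<bar>w a - w b\<bar> \<le> \<bar>a - b\<bar>" for a b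
  proof -
    have "\<bar>w a - w b\<bar> = \<bar>norm (1::real, a) - norm (1::real, b)\<bar>" by (simp add: norm_prod_def w_def)
    also have "\<dots> \<le> norm ((1::real, a) - (1, b))" by (rule norm_triangle_ineq3)
    finally show ?thesis by (simp add: norm_prod_def)
  qed
  have "\<bar>1 / w (norm (s *\<^sub>R v \<theta>))\<bar> \<le> max 1 L \<and>
        \<bar>1 / w (norm (s *\<^sub>R v \<theta>)) - 1 / w (norm (s' *\<^sub>R v \<theta>))\<bar> \<le> max 1 L * \<bar>s - s'\<bar>"
    if t: "\<theta> \<in> \<Theta>" "s \<in> {0..1}" "s' \<in> {0..1}" for \<theta> s s'
  proof
    let ?a = "norm (s *\<^sub>R v \<theta>)" and ?b = "norm (s' *\<^sub>R v \<theta>)"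
    have "1 / w ?a \<le> 1" using w0[of ?a] w1[of ?a] by (simp add: divide_le_eq_1_pos)
    moreover have "\<bar>1 / w ?a\<bar> = 1 / w ?a" using w0[of ?a] by (intro abs_of_pos) simp
    ultimately show "\<bar>1 / w ?a\<bar> \<le> max 1 L" by linarith
    have ww: "1 \<le> w ?a * w ?b" using mult_mono[OF w1[of ?a] w1[of ?b]] w0[of ?a] by simp
    have "1 / w ?a - 1 / w ?b = (w ?b - w ?a) / (w ?a * w ?b)"
      using w0[of ?a] w0[of ?b] by (simp add: field_simps)
    then have "\<bar>1 / w ?a - 1 / w ?b\<bar> = \<bar>w ?b - w ?a\<bar> / (w ?a * w ?b)"
      using ww by (simp add: abs_divide)
    also have "\<dots> \<le> \<bar>w ?b - w ?a\<bar> / 1" using ww by (intro divide_left_mono) auto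
    also have "\<dots> \<le> \<bar>?b - ?a\<bar>" using lip[of ?b ?a] by simp
    also have "?b - ?a = (s' - s) * norm (v \<theta>)" using t by (simp add: algebra_simps)
    also have "\<bar>(s' - s) * norm (v \<theta>)\<bar> = norm (v \<theta>) * \<bar>s - s'\<bar>" by (simp add: abs_mult abs_minus_commute)
    also have "\<dots> \<le> max 1 L * \<bar>s - s'\<bar>"
      using assms[OF t(1)] by (intro mult_right_mono) auto
    finally show "\<bar>1 / w ?a - 1 / w ?b\<bar> \<le> max 1 L * \<bar>s - s'\<bar>" .
  qed
  then show ?thesis unfolding uniformly_lipschitz_def w_def by blast
qed

lemmas uniformly_lipschitz_intros = uniformly_lipschitz_add uniformly_lipschitz_minus
  uniformly_lipschitz_mult uniformly_lipschitz_ident uniformly_lipschitz_sum finite_class.finite_UNIV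

lemma component_le: "norm (p::real^'n::finite) \<le> L \<Longrightarrow> \<bar>p $ i\<bar> \<le> L"
  using component_le_norm_cart[of p i] by linarith

lemma entry_le: "norm (M::real^'n::finite^'n) \<le> L \<Longrightarrow> \<bar>M $ i $ j\<bar> \<le> L"
  by (metis Finite_Cartesian_Product.norm_nth_le component_le order_trans)

lemma pressure_speed_lipschitz:
  obtains C where "C > 0"
    "\<And>(p::real^'n::finite) M s s'. norm p \<le> L \<Longrightarrow> norm M \<le> L \<Longrightarrow> s \<in> {0..1} \<Longrightarrow> s' \<in> {0..1} \<Longrightarrow>
       \<bar>pressure_speed s p M - pressure_speed s' p M\<bar> \<le> C * \<bar>s - s'\<bar>"
proof -
  define \<Theta> where "\<Theta> = {(p::real^'n, M::real^'n^'n). norm p \<le> L \<and> norm M \<le> L}"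
  have p: "uniformly_lipschitz \<Theta> (\<lambda>\<theta> s. fst \<theta> $ i)" for i
    by (rule uniformly_lipschitz_const[where B = L]) (auto simp: \<Theta>_def intro: component_le)
  have M: "uniformly_lipschitz \<Theta> (\<lambda>\<theta> s. snd \<theta> $ i $ j)" for i j
    by (rule uniformly_lipschitz_const[where B = L]) (auto simp: \<Theta>_def intro: entry_le)
  have c: "uniformly_lipschitz \<Theta> (\<lambda>\<theta> s. c)" for c
    by (rule uniformly_lipschitz_const[where B = "\<bar>c\<bar>"]) auto
  define w where "w = (\<lambda>(\<theta>::(real^'n)\<times>(real^'n^'n)) s::real. 1 / sqrt (1 + (norm (s *\<^sub>R fst \<theta>))\<^sup>2))"
  have w: "uniformly_lipschitz \<Theta> w"
    unfolding w_def by (rule uniformly_lipschitz_inverse_sqrt[where L = L]) (auto simp: \<Theta>_def)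
  define P where "P = (\<lambda>i k (\<theta>::(real^'n)\<times>(real^'n^'n)) s.
      (if i = k then 1 else 0) - (s * fst \<theta> $ i) * (s * fst \<theta> $ k) * (w \<theta> s * w \<theta> s))"
  have P: "uniformly_lipschitz \<Theta> (P i k)" for i k
    unfolding P_def by (intro uniformly_lipschitz_intros p w c)
  have Peq: "tangent_metric (s *\<^sub>R p) $ i $ k = P i k (p, M) s" for s p M i k
  proof -
    have "w (p, M) s * w (p, M) s = 1 / (1 + (norm (s *\<^sub>R p))\<^sup>2)"
      by (simp add: w_def add_nonneg_nonneg del: norm_scaleR)
    then show ?thesis
      by (simp add: P_def tangent_metric_def mat_def outer_def del: norm_scaleR)
  qed
  define F where "F = (\<lambda>\<theta> s.
     (s * (\<Sum>i\<in>UNIV. \<Sum>j\<in>UNIV. \<Sum>k\<in>UNIV. \<Sum>l\<in>UNIV. P i k \<theta> s * P j l \<theta> s *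
            (snd \<theta> $ k $ i * snd \<theta> $ l $ j - snd \<theta> $ k $ j * snd \<theta> $ l $ i))
     + 2 * (\<Sum>i\<in>UNIV. \<Sum>j\<in>UNIV. \<Sum>k\<in>UNIV. \<Sum>l\<in>UNIV. P i k \<theta> s * P j l \<theta> s *
            (snd \<theta> $ k $ i * (fst \<theta> $ l * fst \<theta> $ j) - snd \<theta> $ k $ j * (fst \<theta> $ l * fst \<theta> $ i))))
     * (1 / 2 * w \<theta> s))"
  have "uniformly_lipschitz \<Theta> F"
    unfolding F_def by (intro uniformly_lipschitz_intros p M w P c)
  then obtain C where C: "\<And>\<theta> s s'. \<theta> \<in> \<Theta> \<Longrightarrow> s \<in> {0..1} \<Longrightarrow> s' \<in> {0..1} \<Longrightarrow> \<bar>F \<theta> s - F \<theta> s'\<bar> \<le> C * \<bar>s - s'\<bar>"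
    unfolding uniformly_lipschitz_def by blast
  have Feq: "pressure_speed s p M = F (p, M) s" for s p M
    unfolding pressure_speed_def F_def mixed_def Peq[of s p _ _ M]
    by (simp add: outer_def w_def)
  show thesis
  proof (rule that[of "max C 1"])
    fix p :: "real^'n" and M :: "real^'n^'n" and s s' :: real
    assume "norm p \<le> L" "norm M \<le> L" and s: "s \<in> {0..1}" "s' \<in> {0..1}"
    then have "(p, M) \<in> \<Theta>" by (simp add: \<Theta>_def)
    from C[OF this s] show "\<bar>pressure_speed s p M - pressure_speed s' p M\<bar> \<le> max C 1 * \<bar>s - s'\<bar>"
      unfolding Feq[of _ p M] by (rule order_trans) (simp add: mult_right_mono)
  qed simp
qed

text \<open>At \<open>s = 0\<close> only the term with \<open>p p\<^sup>T\<close> is left, and it is quadratic in \<open>p\<close>; the Lipschitz bound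
  takes care of the other \<open>s\<close>.\<close>

lemma pressure_speed_bound:
  obtains C where "C > 0"
    "\<And>(p::real^'n::finite) M s. norm p \<le> L \<Longrightarrow> norm M \<le> L \<Longrightarrow> s \<in> {0..1} \<Longrightarrow>
       pressure_speed s p M \<le> C * (s + (norm p)\<^sup>2)"
proof -
  obtain C where C: "C > 0" "\<And>(p::real^'n) M s s'. norm p \<le> L \<Longrightarrow> norm M \<le> L \<Longrightarrow> s \<in> {0..1} \<Longrightarrow> s' \<in> {0..1} \<Longrightarrow>
       \<bar>pressure_speed s p M - pressure_speed s' p M\<bar> \<le> C * \<bar>s - s'\<bar>"
    by (rule pressure_speed_lipschitz) blast
  define N where "N = real CARD('n)"
  define D where "D = N * (N * (N * (N * (2 * \<bar>L\<bar>))))"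
  have "pressure_speed s p M \<le> (C + D) * (s + (norm p)\<^sup>2)"
    if pM: "norm p \<le> L" "norm M \<le> L" "s \<in> {0..1}" for p :: "real^'n" and M s
  proof -
    let ?P = "tangent_metric (0 :: real^'n)"
    have term_le: "?P $ i $ k * ?P $ j $ l * (M $ k $ i * outer p $ l $ j - M $ k $ j * outer p $ l $ i)
        \<le> 2 * \<bar>L\<bar> * (norm p)\<^sup>2" for i j k l
    proof -
      have o: "\<bar>outer p $ a $ b\<bar> \<le> (norm p)\<^sup>2" for a b
        unfolding outer_def by (simp add: abs_mult power2_eq_square mult_mono component_le_norm_cart)
      have m: "\<bar>M $ a $ b * outer p $ c $ d\<bar> \<le> \<bar>L\<bar> * (norm p)\<^sup>2" for a b c d
        unfolding abs_mult using o entry_le[OF pM(2), of a b] by (intro mult_mono) auto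
      have P: "?P $ a $ b \<in> {0, 1}" for a b by (simp add: tangent_metric_def mat_def outer_def)
      let ?m = "M $ k $ i * outer p $ l $ j - M $ k $ j * outer p $ l $ i"
      have "\<bar>?m\<bar> \<le> 2 * \<bar>L\<bar> * (norm p)\<^sup>2" using m[of k i l j] m[of k j l i] by linarith
      then show ?thesis using P[of i k] P[of j l] by auto
    qed
    have "mixed ?P M (outer p) \<le> (\<Sum>i\<in>(UNIV::'n set). \<Sum>j\<in>(UNIV::'n set). \<Sum>k\<in>(UNIV::'n set). \<Sum>l\<in>(UNIV::'n set). 2 * \<bar>L\<bar> * (norm p)\<^sup>2)"
      unfolding mixed_def by (intro sum_mono term_le)
    also have "\<dots> = D * (norm p)\<^sup>2" by (simp add: D_def N_def)
    finally have "pressure_speed 0 p M \<le> D * (norm p)\<^sup>2" by (simp add: pressure_speed_def)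
    moreover have "pressure_speed s p M \<le> pressure_speed 0 p M + C * s"
      using C(2)[OF pM, of 0] pM(3) by auto
    moreover have "D * s \<ge> 0" "C * (norm p)\<^sup>2 \<ge> 0" using pM(3) C(1) by (auto simp: D_def N_def)
    ultimately show ?thesis by (simp add: algebra_simps)
  qed
  moreover have "C + D > 0" using C(1) by (simp add: D_def N_def add_pos_nonneg)
  ultimately show thesis using that by blast
qed

section \<open>A flow with a flat side\<close>

lemma pressure_pos_iff: "0 < pressure f t x \<longleftrightarrow> 0 < f t x"
  by (simp add: pressure_def)

lemma half_pressure_sq: "0 \<le> f t x \<Longrightarrow> (pressure f t x)\<^sup>2 / 2 = f t x"
  by (simp add: pressure_def)

lemma pressure_nonneg: "0 \<le> f t x \<Longrightarrow> 0 \<le> pressure f t x"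
  by (simp add: pressure_def)

lemma pressure_le_iff: "0 \<le> f t x \<Longrightarrow> 0 \<le> a \<Longrightarrow> pressure f t x \<le> a \<longleftrightarrow> f t x \<le> a\<^sup>2 / 2"
  using real_sqrt_le_iff[of "2 * f t x" "a\<^sup>2"] by (auto simp: pressure_def)

lemma pressure_less_iff: "0 \<le> f t x \<Longrightarrow> 0 \<le> a \<Longrightarrow> pressure f t x < a \<longleftrightarrow> f t x < a\<^sup>2 / 2"
  using real_sqrt_less_iff[of "2 * f t x" "a\<^sup>2"] by (auto simp: pressure_def)

text \<open>The properties of the graph functions that carry the argument. The last one is the \<open>C\<^sup>2\<close> part of the
  regularity of the pressure up to the interface; \<open>L \<ge> 1\<close> is a normalisation.\<close>

locale flat_side_solution =
  fixes \<Omega> :: "real \<Rightarrow> (real ^ 'n::finite) set" and f :: "real \<Rightarrow> real ^ 'n \<Rightarrow> real"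
    and Tc T \<rho> R \<delta> L :: real
  assumes T: "0 < T" "T < Tc"
    and open_domain: "openin (top_of_set (UNIV \<times> {0..<Tc})) {(x, t). t \<in> {0..<Tc} \<and> x \<in> \<Omega> t}"
    and continuous: "continuous_on {(x, t). t \<in> {0..<Tc} \<and> x \<in> \<Omega> t} (\<lambda>(x, t). f t x)"
    and open_slice: "t \<in> {0..T} \<Longrightarrow> open (\<Omega> t)"
    and convex: "t \<in> {0..T} \<Longrightarrow> convex_on (\<Omega> t) (f t)"
    and nonneg: "t \<in> {0..T} \<Longrightarrow> x \<in> \<Omega> t \<Longrightarrow> 0 \<le> f t x"
    and differentiable: "t \<in> {0..T} \<Longrightarrow> x \<in> \<Omega> t \<Longrightarrow> f t differentiable (at x)"
    and blowup: "t \<in> {0..T} \<Longrightarrow> z \<in> frontier (\<Omega> t) \<Longrightarrow>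
      filterlim (\<lambda>x. norm (grad (f t) x)) at_top (at z within \<Omega> t)"
    and twice_differentiable: "t \<in> {0..T} \<Longrightarrow> x \<in> \<Omega> t \<Longrightarrow> 0 < f t x \<Longrightarrow> twice_differentiable_at (f t) x"
    and evolution: "t \<in> {0..T} \<Longrightarrow> x \<in> \<Omega> t \<Longrightarrow> 0 < f t x \<Longrightarrow>
      ((\<lambda>s. f s x) has_real_derivative graph_speed (f t) x) (at t within {0..<Tc})"
    and joint: "0 < t \<Longrightarrow> t \<le> T \<Longrightarrow> x \<in> \<Omega> t \<Longrightarrow> 0 < f t x \<Longrightarrow>
      (\<lambda>(x, t). f t x) differentiable (at (x, t))"
    and \<rho>: "0 < \<rho>"
    and disc: "t \<in> {0..T} \<Longrightarrow> x \<in> cball 0 \<rho> \<Longrightarrow> x \<in> \<Omega> t \<and> f t x = 0"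
    and R: "0 < R"
    and bounded: "t \<in> {0..T} \<Longrightarrow> \<Omega> t \<subseteq> ball 0 R"
    and \<delta>: "0 < \<delta>" and L: "1 \<le> L"
    and pressure_bounds: "t \<in> {0..T} \<Longrightarrow> x \<in> \<Omega> t \<Longrightarrow> 0 < pressure f t x \<Longrightarrow> pressure f t x < \<delta> \<Longrightarrow>
      twice_differentiable_at (pressure f t) x \<and>
      norm (grad (pressure f t) x) \<le> L \<and> norm (hess (pressure f t) x) \<le> L"
begin

lemma has_derivative_slice:
  "t \<in> {0..T} \<Longrightarrow> x \<in> \<Omega> t \<Longrightarrow> (f t has_derivative (\<lambda>h. grad (f t) x \<bullet> h)) (at x)"
  by (rule has_derivative_grad[OF differentiable])

lemma origin: "t \<in> {0..T} \<Longrightarrow> 0 \<in> \<Omega> t" "t \<in> {0..T} \<Longrightarrow> f t 0 = 0"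
  using disc[of t 0] \<rho> by auto

lemma convex_slice: "t \<in> {0..T} \<Longrightarrow> convex (\<Omega> t)"
  using convex unfolding convex_on_def by blast

lemma scale_in_slice:
  assumes "t \<in> {0..T}" "x \<in> \<Omega> t" "0 \<le> c" "c \<le> 1"
  shows "c *\<^sub>R x \<in> \<Omega> t" "f t (c *\<^sub>R x) \<le> c * f t x"
proof -
  show "c *\<^sub>R x \<in> \<Omega> t"
    using convexD[OF convex_slice[OF assms(1)] assms(2) origin(1)[OF assms(1)], of c "1 - c"] assms(3,4) by simp
  have "f t (c *\<^sub>R x + (1 - c) *\<^sub>R 0) \<le> c * f t x + (1 - c) * f t 0"
    using convex[OF assms(1)] assms(2-4) origin(1)[OF assms(1)] unfolding convex_on_def by fastforce
  then show "f t (c *\<^sub>R x) \<le> c * f t x" using origin(2)[OF assms(1)] by simp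
qed

lemma above_tangent:
  assumes t: "t \<in> {0..T}" and xy: "x \<in> \<Omega> t" "y \<in> \<Omega> t"
  shows "f t x + grad (f t) x \<bullet> (y - x) \<le> f t y"
proof -
  have line: "((\<lambda>s. x + s *\<^sub>R (y - x)) has_derivative (\<lambda>h. h *\<^sub>R (y - x))) (at 0)"
    by (auto intro!: derivative_eq_intros)
  have "((\<lambda>s. f t (x + s *\<^sub>R (y - x))) has_derivative (\<lambda>h. grad (f t) x \<bullet> (h *\<^sub>R (y - x)))) (at 0)"
    using has_derivative_compose[OF line, of "f t" "\<lambda>h. grad (f t) x \<bullet> h"] has_derivative_slice[OF t xy(1)] by simp
  then have "((\<lambda>s. f t (x + s *\<^sub>R (y - x))) has_real_derivative grad (f t) x \<bullet> (y - x)) (at 0)"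
    unfolding has_field_derivative_def by (simp add: mult_commute_abs)
  then have "((\<lambda>s. (f t (x + s *\<^sub>R (y - x)) - f t x) / s) \<longlongrightarrow> grad (f t) x \<bullet> (y - x)) (at_right 0)"
    by (auto simp: DERIV_def intro: tendsto_mono[OF at_le])
  moreover have "\<forall>\<^sub>F s in at_right 0. (f t (x + s *\<^sub>R (y - x)) - f t x) / s \<le> f t y - f t x"
  proof (rule eventually_at_rightI[of 0 1])
    fix s :: real assume s: "s \<in> {0<..<1}"
    have "f t ((1 - s) *\<^sub>R x + s *\<^sub>R y) \<le> (1 - s) * f t x + s * f t y"
      using convex[OF t] xy s unfolding convex_on_def by fastforce
    moreover have "(1 - s) *\<^sub>R x + s *\<^sub>R y = x + s *\<^sub>R (y - x)" by (simp add: algebra_simps)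
    ultimately have "f t (x + s *\<^sub>R (y - x)) - f t x \<le> s * (f t y - f t x)" by (simp add: algebra_simps)
    then show "(f t (x + s *\<^sub>R (y - x)) - f t x) / s \<le> f t y - f t x"
      using s by (simp add: divide_le_eq mult.commute)
  qed simp
  ultimately have "grad (f t) x \<bullet> (y - x) \<le> f t y - f t x"
    by (rule tendsto_upperbound) simp
  then show ?thesis by simp
qed

text \<open>The tangent plane at \<open>x\<close> lies below the flat disc, in particular at the boundary point of the
  disc in the direction of the gradient.\<close>

lemma radial_derivative_bound:
  assumes t: "t \<in> {0..T}" and x: "x \<in> \<Omega> t"
  shows "f t x + \<rho> * norm (grad (f t) x) \<le> grad (f t) x \<bullet> x"
proof -
  let ?p = "grad (f t) x"
  have "\<rho> *\<^sub>R sgn ?p \<in> cball 0 \<rho>" using \<rho> by (simp add: norm_sgn)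
  from disc[OF t this] have y: "\<rho> *\<^sub>R sgn ?p \<in> \<Omega> t" "f t (\<rho> *\<^sub>R sgn ?p) = 0" by auto
  have "?p \<bullet> sgn ?p = norm ?p"
    by (cases "?p = 0") (simp_all add: sgn_div_norm power2_norm_eq_inner[symmetric] power2_eq_square)
  then show ?thesis using above_tangent[OF t x y(1)] y(2) by (simp add: inner_diff_right)
qed

lemma value_le_gradient:
  assumes t: "t \<in> {0..T}" and x: "x \<in> \<Omega> t"
  shows "f t x \<le> R * norm (grad (f t) x)"
proof -
  have "f t x \<le> grad (f t) x \<bullet> x"
    using radial_derivative_bound[OF assms] mult_nonneg_nonneg[of \<rho> "norm (grad (f t) x)"] \<rho>
    by (smt (verit) norm_ge_zero)
  also have "\<dots> \<le> norm (grad (f t) x) * norm x" by (rule norm_cauchy_schwarz)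
  also have "\<dots> \<le> norm (grad (f t) x) * R"
    using bounded[OF t] x by (intro mult_left_mono) auto
  finally show ?thesis by (simp add: mult.commute)
qed

lemma grad_pressure:
  assumes t: "t \<in> {0..T}" and x: "x \<in> \<Omega> t" and pos: "0 < f t x"
  shows "grad (f t) x = pressure f t x *\<^sub>R grad (pressure f t) x"
proof -
  let ?g = "pressure f t x"
  have g: "?g > 0" using pos by (simp add: pressure_pos_iff)
  have "((\<lambda>y. sqrt (2 * f t y)) has_derivative (\<lambda>h. inverse (sqrt (2 * f t x)) / 2 * (2 * (grad (f t) x \<bullet> h)))) (at x)"
    using has_derivative_slice[OF t x] pos by (auto intro!: derivative_eq_intros simp: field_simps)
  then have "(pressure f t has_derivative (\<lambda>h. ((1 / ?g) *\<^sub>R grad (f t) x) \<bullet> h)) (at x)"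
    unfolding pressure_def[abs_def] by (simp add: field_simps)
  from grad_eqI[OF this] g show ?thesis by simp
qed

text \<open>Convexity alone gives a gradient bound that is linear in \<open>g\<close>; it is enough away from the interface.\<close>

lemma pressure_le_gradient:
  assumes t: "t \<in> {0..T}" and x: "x \<in> \<Omega> t" and pos: "0 < f t x"
  shows "pressure f t x \<le> 2 * R * norm (grad (pressure f t) x)"
proof -
  let ?g = "pressure f t x"
  have g: "?g > 0" using pos by (simp add: pressure_pos_iff)
  have "?g * (?g / 2) = f t x"
    using half_pressure_sq[of f t x] pos by (simp add: power2_eq_square)
  also have "\<dots> \<le> ?g * (R * norm (grad (pressure f t) x))"
    using value_le_gradient[OF t x] g by (simp add: grad_pressure[OF assms] mult_ac)
  finally show ?thesis using g by simp
qed

lemma eventually_slice: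
  "t \<in> {0..T} \<Longrightarrow> x \<in> \<Omega> t \<Longrightarrow> \<forall>\<^sub>F y in nhds x. y \<in> \<Omega> t"
  using open_slice eventually_nhds_in_open by blast

lemma second_order_slice:
  assumes t: "t \<in> {0..T}" and x: "x \<in> \<Omega> t" and g: "0 < pressure f t x" "pressure f t x < \<delta>"
  shows "second_order_at (f t) x (pressure f t x *\<^sub>R grad (pressure f t) x)
    (pressure f t x *\<^sub>R hess (pressure f t) x + outer (grad (pressure f t) x))"
proof -
  have "second_order_at (pressure f t) x (grad (pressure f t) x) (hess (pressure f t) x)"
    using pressure_bounds[OF assms] twice_differentiable_at_imp_second_order by blast
  from second_order_at_half_square[OF this, of 0 0]
  have "second_order_at (\<lambda>y. (pressure f t y)\<^sup>2 / 2) x (pressure f t x *\<^sub>R grad (pressure f t) x)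
    (pressure f t x *\<^sub>R hess (pressure f t) x + outer (grad (pressure f t) x))" by simp
  then show ?thesis
  proof (rule second_order_at_cong)
    show "\<forall>\<^sub>F y in nhds x. f t y = (pressure f t y)\<^sup>2 / 2"
      using eventually_slice[OF t x] by eventually_elim (simp add: half_pressure_sq nonneg[OF t])
  qed
qed

lemma graph_speed_eq_pressure_speed:
  assumes "t \<in> {0..T}" "x \<in> \<Omega> t" "0 < pressure f t x" "pressure f t x < \<delta>"
  shows "graph_speed (f t) x = pressure f t x *
    pressure_speed (pressure f t x) (grad (pressure f t) x) (hess (pressure f t) x)"
  using second_order_atD(1,2)[OF second_order_slice[OF assms]]
  by (simp add: graph_speed_eq speed_half_square)

lemma psd_hess:
  assumes t: "t \<in> {0..T}" and x: "x \<in> \<Omega> t" and pos: "0 < f t x"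
  shows "psd (hess (f t) x)"
proof -
  let ?p = "grad (f t) x"
  have so: "second_order_at (f t) x ?p (hess (f t) x)"
    by (rule twice_differentiable_at_imp_second_order[OF twice_differentiable[OF assms]])
  have "\<forall>\<^sub>F y in nhds x. f t x - ?p \<bullet> x \<le> f t y - ?p \<bullet> y"
    using eventually_slice[OF t x]
  proof eventually_elim
    case (elim y)
    from above_tangent[OF t x elim] show ?case by (simp add: inner_diff_right)
  qed
  from second_order_at_local_min(2)[OF second_order_at_diff[OF so second_order_at_inner] this]
  have "v \<bullet> (hess (f t) x *v v) \<ge> 0" for v by simp
  with second_order_at_symmetric[OF so] show ?thesis by (simp add: psd_def)
qed

lemma grad_zero:
  assumes t: "t \<in> {0..T}" and x: "x \<in> \<Omega> t" and zero: "f t x = 0"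
  shows "grad (f t) x = 0"
proof -
  have "\<forall>\<^sub>F y in nhds x. f t x \<le> f t y"
    using eventually_slice[OF t x] by eventually_elim (simp add: zero nonneg[OF t])
  then have "\<forall>\<^sub>F y in at x. f t x \<le> f t y" by (simp add: eventually_at_filter eventually_mono)
  from has_derivative_local_min[OF has_derivative_slice[OF t x] this]
  show ?thesis by (metis inner_eq_zero_iff)
qed

lemma gradient_bound:
  assumes t: "t \<in> {0..T}" and x: "x \<in> \<Omega> t" and small: "f t x < \<delta>\<^sup>2 / 2"
  shows "norm (grad (f t) x) \<le> \<delta> * L"
proof (cases "f t x = 0")
  case True
  then show ?thesis using grad_zero[OF t x] \<delta> L by simp
next
  case False
  with nonneg[OF t x] have pos: "0 < f t x" by simp
  have g: "0 < pressure f t x" "pressure f t x < \<delta>"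
    using pos small \<delta> by (auto simp: pressure_pos_iff pressure_less_iff)
  have "norm (grad (f t) x) = pressure f t x * norm (grad (pressure f t) x)"
    using g by (simp add: grad_pressure[OF t x pos])
  also have "\<dots> \<le> \<delta> * L"
    using g pressure_bounds[OF t x g] by (intro mult_mono) auto
  finally show ?thesis .
qed

lemma gradient_unbounded_near_frontier:
  assumes t: "t \<in> {0..T}" and z: "z \<in> frontier (\<Omega> t)"
    and V: "V \<subseteq> \<Omega> t" "z \<in> closure V" "\<And>x. x \<in> V \<Longrightarrow> norm (grad (f t) x) \<le> B"
  shows False
proof -
  have "z \<notin> \<Omega> t" using z open_slice[OF t] by (simp add: frontier_def interior_open)
  then have "z islimpt V" using V(1,2) by (auto simp: closure_def)
  then have nb: "at z within V \<noteq> bot" by (simp add: trivial_limit_within)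
  have "\<forall>\<^sub>F x in at z within \<Omega> t. B + 1 \<le> norm (grad (f t) x)"
    using blowup[OF t z] by (simp add: filterlim_at_top)
  then have "\<forall>\<^sub>F x in at z within V. B + 1 \<le> norm (grad (f t) x)"
    using at_le[OF V(1)] filter_leD by blast
  moreover have "\<forall>\<^sub>F x in at z within V. norm (grad (f t) x) \<le> B"
    using V(3) by (auto simp: eventually_at_filter)
  ultimately have "\<forall>\<^sub>F x in at z within V. False" by eventually_elim linarith
  with nb show False by simp
qed

lemma lipschitz_sublevel:
  assumes t: "t \<in> {0..T}" and x: "x \<in> \<Omega> t" "f t x < \<delta>\<^sup>2 / 2" and y: "y \<in> \<Omega> t" "f t y < \<delta>\<^sup>2 / 2"
  shows "\<bar>f t x - f t y\<bar> \<le> \<delta> * L * norm (x - y)"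
proof -
  let ?U = "{y \<in> \<Omega> t. f t y < \<delta>\<^sup>2 / 2}"
  have "convex ?U"
  proof (rule convexI)
    fix a b and u v :: real
    assume ab: "a \<in> ?U" "b \<in> ?U" and uv: "0 \<le> u" "0 \<le> v" "u + v = 1"
    have 1: "f t (u *\<^sub>R a + v *\<^sub>R b) \<le> u * f t a + v * f t b"
      using convex[OF t] ab uv unfolding convex_on_def by blast
    have "u * f t a + v * f t b < \<delta>\<^sup>2 / 2"
      using convex_bound_lt[of "f t a" "\<delta>\<^sup>2/2" "f t b" u v] ab uv by simp
    with 1 show "u *\<^sub>R a + v *\<^sub>R b \<in> ?U"
      using convexD[OF convex_slice[OF t], of a b u v] ab uv by simp
  qed
  then have "norm (f t x - f t y) \<le> \<delta> * L * norm (x - y)"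
  proof (rule differentiable_bound)
    fix a assume a: "a \<in> ?U"
    then show "(f t has_derivative (\<lambda>h. grad (f t) a \<bullet> h)) (at a within ?U)"
      using has_derivative_slice[OF t] has_derivative_at_withinI by blast
    show "onorm (\<lambda>h. grad (f t) a \<bullet> h) \<le> \<delta> * L"
    proof (rule onorm_bound)
      show "0 \<le> \<delta> * L" using \<delta> L by simp
      show "norm (grad (f t) a \<bullet> h) \<le> \<delta> * L * norm h" for h
      proof -
        have "norm (grad (f t) a) * norm h \<le> \<delta> * L * norm h"
          using gradient_bound[OF t, of a] a by (intro mult_right_mono) auto
        then show ?thesis using Cauchy_Schwarz_ineq2[of "grad (f t) a" h] by simp
      qed
    qed
  qed (use x y in auto)
  then show ?thesis by simp
qed

end

section \<open>Compact sublevel sets and monotonicity in time\<close>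

context flat_side_solution
begin

text \<open>The gradient blows up at the boundary of the domain but is bounded where the pressure is below
  \<open>\<delta>\<close>. So the domain contains a ball of fixed radius around each point of lower pressure: \<open>f\<close> is
  Lipschitz with constant \<open>\<delta> L\<close> there, and on the ball it climbs at most half of the gap between
  \<open>\<epsilon>\<^sup>2/2\<close> and \<open>\<delta>\<^sup>2/2\<close>.\<close>

lemma uniform_ball:
  assumes t: "t \<in> {0..T}" and x: "x \<in> \<Omega> t" "f t x \<le> \<epsilon>\<^sup>2 / 2" and \<epsilon>: "0 < \<epsilon>" "\<epsilon> < \<delta>"
    and y: "norm (y - x) < (\<delta>\<^sup>2 - \<epsilon>\<^sup>2) / (4 * \<delta> * L)"
  shows "y \<in> \<Omega> t \<and> f t y < \<delta>\<^sup>2 / 2"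
proof (rule ccontr)
  define U where "U = {y \<in> \<Omega> t. f t y < \<delta>\<^sup>2 / 2}"
  assume "\<not> ?thesis"
  then have yU: "y \<notin> U" by (simp add: U_def)
  have dL: "0 < \<delta> * L" using \<delta> L by simp
  have e\<delta>: "\<epsilon>\<^sup>2 < \<delta>\<^sup>2" using \<epsilon> by (intro power_strict_mono) auto
  have xU: "x \<in> U" using x e\<delta> by (simp add: U_def)
  have cont: "continuous_on (\<Omega> t) (f t)"
    using has_derivative_slice[OF t] has_derivative_continuous continuous_at_imp_continuous_on by blast
  have "U = \<Omega> t \<inter> f t -` {..<\<delta>\<^sup>2 / 2}" by (auto simp: U_def)
  with continuous_open_preimage[OF cont open_slice[OF t]] have "open U" by simp
  have "closed_segment x y \<inter> frontier U \<noteq> {}"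
    by (rule connected_Int_frontier) (use xU yU in auto)
  then obtain z where z: "z \<in> closed_segment x y" "z \<in> closure U" "z \<notin> U"
    using \<open>open U\<close> by (auto simp: frontier_def interior_open)
  have zx: "norm (z - x) \<le> norm (y - x)" using segment_bound1[OF z(1)] by simp
  show False
  proof (cases "z \<in> \<Omega> t")
    case True
    obtain w where w: "\<And>n. w n \<in> U" "w \<longlonglongrightarrow> z"
      using z(2) closure_sequential by blast
    have "f t (w n) \<le> f t x + \<delta> * L * norm (w n - x)" for n
      using lipschitz_sublevel[OF t, of "w n" x] w(1)[of n] xU by (simp add: U_def abs_le_iff)
    moreover have "(\<lambda>n. f t (w n)) \<longlonglongrightarrow> f t z"
      using has_derivative_continuous[OF has_derivative_slice[OF t True]] w(2)
      by (simp add: continuous_at_sequentially comp_def)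
    moreover have "(\<lambda>n. f t x + \<delta> * L * norm (w n - x)) \<longlonglongrightarrow> f t x + \<delta> * L * norm (z - x)"
      by (intro tendsto_intros w)
    ultimately have "f t z \<le> f t x + \<delta> * L * norm (z - x)"
      by (meson LIMSEQ_le)
    also have "\<dots> \<le> \<epsilon>\<^sup>2 / 2 + \<delta> * L * ((\<delta>\<^sup>2 - \<epsilon>\<^sup>2) / (4 * \<delta> * L))"
      using x zx y dL by (intro add_mono mult_left_mono) auto
    also have "\<dots> = \<epsilon>\<^sup>2 / 2 + (\<delta>\<^sup>2 - \<epsilon>\<^sup>2) / 4" using \<delta> L by simp
    also have "\<dots> < \<delta>\<^sup>2 / 2" using e\<delta> by (simp add: field_simps)
    finally show False using z(3) True by (simp add: U_def)
  next
    case False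
    have "U \<subseteq> \<Omega> t" by (auto simp: U_def)
    then have "z \<in> frontier (\<Omega> t)"
      using z(2) False closure_mono open_slice[OF t] by (auto simp: frontier_def interior_open)
    then show False
      using z(2) \<open>U \<subseteq> \<Omega> t\<close> gradient_bound[OF t]
      by (intro gradient_unbounded_near_frontier[OF t, of z U "\<delta> * L"]) (auto simp: U_def)
  qed
qed

text \<open>The sublevel sets do not escape through a lateral boundary in the limit of times \<open>s\<^sub>n \<rightarrow> t\<close>: along the whole
  segment from the origin to the limit point, the \<open>f s\<^sub>n\<close> are uniformly Lipschitz near the segment,
  hence so is \<open>f t\<close>, which contradicts the blow-up of the gradient at an exit point from \<open>\<Omega> t\<close>.\<close>

lemma closed_sublevel:
  assumes \<epsilon>: "0 < \<epsilon>" "\<epsilon> < \<delta>"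
  shows "closed {(x, t). t \<in> {0..T} \<and> x \<in> \<Omega> t \<and> f t x \<le> \<epsilon>\<^sup>2 / 2}"
  unfolding closed_sequential_limits
proof (intro allI impI, elim conjE)
  fix q and l :: "(real^'n) \<times> real"
  assume q: "\<forall>n. q n \<in> {(x, t). t \<in> {0..T} \<and> x \<in> \<Omega> t \<and> f t x \<le> \<epsilon>\<^sup>2 / 2}" and lim: "q \<longlonglongrightarrow> l"
  define x where "x = (\<lambda>n. fst (q n))"
  define s where "s = (\<lambda>n. snd (q n))"
  obtain z t where l: "l = (z, t)" by (cases l)
  have s: "s n \<in> {0..T}" and x: "x n \<in> \<Omega> (s n)" "f (s n) (x n) \<le> \<epsilon>\<^sup>2 / 2" for n
    using q[rule_format, of n] by (auto simp: x_def s_def)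
  have xl: "x \<longlonglongrightarrow> z" and sl: "s \<longlonglongrightarrow> t"
    using tendsto_fst[OF lim] tendsto_snd[OF lim] by (simp_all add: x_def s_def l)
  have t: "t \<in> {0..T}" using closed_sequentially[OF _ s sl] by simp
  have slice_lim: "(\<lambda>n. f (s n) (y n)) \<longlonglongrightarrow> f t b"
    if "b \<in> \<Omega> t" "y \<longlonglongrightarrow> b" "\<forall>\<^sub>F n in sequentially. y n \<in> \<Omega> (s n)" for b y
  proof -
    have "((\<lambda>n. (\<lambda>(x, t). f t x) (y n, s n)) \<longlongrightarrow> (\<lambda>(x, t). f t x) (b, t)) sequentially"
    proof (rule continuous_on_tendsto_compose[OF continuous])
      show "(\<lambda>n. (y n, s n)) \<longlonglongrightarrow> (b, t)" using that sl by (intro tendsto_intros)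
      show "(b, t) \<in> {(x, t). t \<in> {0..<Tc} \<and> x \<in> \<Omega> t}" using that t T by auto
      show "\<forall>\<^sub>F n in sequentially. (y n, s n) \<in> {(x, t). t \<in> {0..<Tc} \<and> x \<in> \<Omega> t}"
        using that(3)
      proof eventually_elim
        case (elim n)
        then show ?case using s[of n] T by auto
      qed
    qed
    then show ?thesis by simp
  qed
  have "z \<in> \<Omega> t"
  proof (rule ccontr)
    assume "z \<notin> \<Omega> t"
    define r where "r = (\<delta>\<^sup>2 - \<epsilon>\<^sup>2) / (4 * \<delta> * L)"
    have r: "r > 0" using \<epsilon> L unfolding r_def by (intro divide_pos_pos) (auto intro: power_strict_mono)
    have "closed_segment 0 z \<inter> frontier (\<Omega> t) \<noteq> {}"
      by (rule connected_Int_frontier) (use origin(1)[OF t] \<open>z \<notin> \<Omega> t\<close> in auto)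
    then obtain w c where w: "w \<in> frontier (\<Omega> t)" "w = c *\<^sub>R z" "0 \<le> c" "c \<le> 1"
      by (auto simp: closed_segment_def)
    define V where "V = ball w (r / 2) \<inter> \<Omega> t"
    have "\<forall>\<^sub>F n in sequentially. norm (x n - z) < r / 2"
      using tendstoD[OF xl, of "r / 2"] r by (simp add: dist_norm)
    then have in_slice: "\<forall>\<^sub>F n in sequentially. \<forall>y\<in>ball w (r / 2). y \<in> \<Omega> (s n) \<and> f (s n) y < \<delta>\<^sup>2 / 2"
    proof eventually_elim
      case (elim n)
      show ?case
      proof
        fix y assume y: "y \<in> ball w (r / 2)"
        have cx: "c *\<^sub>R x n \<in> \<Omega> (s n)" by (rule scale_in_slice(1)[OF s x(1) w(3,4)])
        have "f (s n) (c *\<^sub>R x n) \<le> c * f (s n) (x n)" by (rule scale_in_slice(2)[OF s x(1) w(3,4)])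
        also have "\<dots> \<le> f (s n) (x n)" by (rule mult_left_le_one_le[OF nonneg[OF s x(1)] w(3,4)])
        also have "\<dots> \<le> \<epsilon>\<^sup>2 / 2" by (rule x(2))
        finally have fcx: "f (s n) (c *\<^sub>R x n) \<le> \<epsilon>\<^sup>2 / 2" .
        have "norm (w - c *\<^sub>R x n) = c * norm (x n - z)"
          using w(2,3) by (simp add: norm_minus_commute flip: scaleR_diff_right)
        also have "\<dots> \<le> norm (x n - z)" using w(3,4) by (simp add: mult_left_le_one_le)
        finally have "norm (y - c *\<^sub>R x n) < r"
          using elim y norm_triangle_ineq[of "y - w" "w - c *\<^sub>R x n"] by (simp add: dist_norm norm_minus_commute)
        then show "y \<in> \<Omega> (s n) \<and> f (s n) y < \<delta>\<^sup>2 / 2"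
          using uniform_ball[OF s cx fcx \<epsilon>] by (simp add: r_def)
      qed
    qed
    have lip: "\<bar>f t a - f t b\<bar> \<le> \<delta> * L * norm (a - b)" if ab: "a \<in> V" "b \<in> V" for a b
    proof -
      have "(\<lambda>n. f (s n) a) \<longlonglongrightarrow> f t a" "(\<lambda>n. f (s n) b) \<longlonglongrightarrow> f t b"
        using ab in_slice by (auto simp: V_def intro!: slice_lim elim: eventually_mono)
      then have "(\<lambda>n. \<bar>f (s n) a - f (s n) b\<bar>) \<longlonglongrightarrow> \<bar>f t a - f t b\<bar>" by (intro tendsto_intros)
      moreover have "\<forall>\<^sub>F n in sequentially. \<bar>f (s n) a - f (s n) b\<bar> \<le> \<delta> * L * norm (a - b)"
        using in_slice by eventually_elim (use ab lipschitz_sublevel[OF s] in \<open>auto simp: V_def\<close>)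
      ultimately show ?thesis by (rule tendsto_upperbound) simp
    qed
    have "open V" using open_slice[OF t] by (simp add: V_def open_Int)
    have "norm (grad (f t) a) \<le> \<delta> * L" if a: "a \<in> V" for a
    proof (rule ccontr)
      let ?p = "grad (f t) a"
      assume gt: "\<not> norm ?p \<le> \<delta> * L"
      then have p: "norm ?p > 0" using \<delta> L by (smt (verit) mult_nonneg_nonneg)
      obtain h where h: "h > 0" "cball a h \<subseteq> V" using \<open>open V\<close> a open_contains_cball by blast
      let ?b = "a + (h / norm ?p) *\<^sub>R ?p"
      have b: "?b \<in> V" "norm (?b - a) = h" using h p by (auto simp: subset_iff dist_norm)
      have "?p \<bullet> (?b - a) = h * norm ?p"
        using p by (simp add: power2_norm_eq_inner[symmetric] power2_eq_square)
      moreover have "f t a + ?p \<bullet> (?b - a) \<le> f t ?b"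
        by (rule above_tangent[OF t]) (use a b(1) in \<open>simp_all add: V_def\<close>)
      ultimately have "h * norm ?p \<le> h * (\<delta> * L)"
        using lip[OF b(1) a] b(2) by (simp add: mult_ac)
      with h(1) gt show False by simp
    qed
    moreover have "w \<in> closure V"
    proof -
      have "w \<in> ball w (r / 2) \<inter> closure (\<Omega> t)" using w(1) r by (simp add: frontier_def)
      then show ?thesis unfolding V_def using open_Int_closure_subset[OF open_ball] by blast
    qed
    moreover have "V \<subseteq> \<Omega> t" by (auto simp: V_def)
    ultimately show False using gradient_unbounded_near_frontier[OF t w(1)] by blast
  qed
  moreover have "f t z \<le> \<epsilon>\<^sup>2 / 2"
    by (rule LIMSEQ_le_const2[OF slice_lim[OF \<open>z \<in> \<Omega> t\<close> xl]]) (use x in auto)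
  ultimately show "l \<in> {(x, t). t \<in> {0..T} \<and> x \<in> \<Omega> t \<and> f t x \<le> \<epsilon>\<^sup>2 / 2}" using t l by simp
qed

lemma compact_sublevel:
  assumes \<epsilon>: "0 < \<epsilon>" "\<epsilon> < \<delta>"
  shows "compact {(x, t). t \<in> {0..T} \<and> x \<in> \<Omega> t \<and> f t x \<le> \<epsilon>\<^sup>2 / 2}" (is "compact ?C")
proof -
  have "?C \<subseteq> cball 0 R \<times> {0..T}" using bounded by force
  moreover have "compact (cball (0::real^'n) R \<times> {0..T})" by (intro compact_Times) auto
  ultimately show ?thesis
    using closed_sublevel[OF \<epsilon>] compact_Int_closed[of "cball 0 R \<times> {0..T}" ?C] by (simp add: Int_absorb1)
qed

lemma continuous_in_time:
  assumes "0 \<le> a" "b \<le> T" "\<And>s. s \<in> {a..b} \<Longrightarrow> x \<in> \<Omega> s"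
  shows "continuous_on {a..b} (\<lambda>s. f s x)"
proof -
  have "continuous_on {a..b} (\<lambda>s. (\<lambda>(x, t). f t x) (x, s))"
    by (rule continuous_on_compose2[OF continuous]) (use assms T in \<open>auto intro!: continuous_intros\<close>)
  then show ?thesis by simp
qed

lemma evolution_interior:
  assumes "0 < t" "t \<le> T" "x \<in> \<Omega> t" "0 < f t x"
  shows "((\<lambda>s. f s x) has_real_derivative graph_speed (f t) x) (at t)"
proof -
  have "((\<lambda>s. f s x) has_real_derivative graph_speed (f t) x) (at t within {0<..<Tc})"
    by (rule DERIV_subset[OF evolution]) (use assms in auto)
  then show ?thesis using assms T by (simp add: at_within_open[of t "{0<..<Tc}"])
qed

text \<open>Convexity makes the speed nonnegative wherever \<open>f\<close> is positive. The interface, where no equation is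
  available, is avoided by stopping at a positive level \<open>c\<close>.\<close>

lemma nondecreasing_in_time:
  assumes ab: "0 \<le> a" "a \<le> b" "b \<le> T" and x: "\<And>s. s \<in> {a..b} \<Longrightarrow> x \<in> \<Omega> s"
  shows "f a x \<le> f b x"
proof (rule ccontr)
  assume less: "\<not> f a x \<le> f b x"
  then obtain c where c: "f b x < c" "c < f a x" using dense not_le by metis
  have "0 \<le> f b x" using ab x by (intro nonneg) auto
  with c have "0 < c" by linarith
  note cont = continuous_in_time[OF ab(1,3) x]
  define S where "S = {a..b} \<inter> (\<lambda>s. f s x) -` {..c}"
  have "compact S"
    unfolding S_def compact_eq_bounded_closed
    by (intro conjI continuous_closed_preimage[OF cont] bounded_Int) auto
  moreover have "b \<in> S" using ab c by (simp add: S_def)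
  ultimately obtain r where r: "r \<in> S" "\<And>s. s \<in> S \<Longrightarrow> r \<le> s"
    using compact_attains_inf[of S] by blast
  then have "a < r" using c by (cases "r = a") (auto simp: S_def)
  have big: "c < f s x" if "a \<le> s" "s < r" for s
    using r that by (force simp: S_def)
  have "f a x \<le> f r x"
  proof (rule DERIV_nonneg_imp_increasing_open[OF \<open>a < r\<close>[THEN less_imp_le]])
    fix s assume s: "a < s" "s < r"
    then have sT: "0 < s" "s \<le> T" "x \<in> \<Omega> s" using ab r(1) x by (auto simp: S_def)
    have pos: "0 < f s x" using big[of s] s \<open>0 < c\<close> by simp
    have "0 \<le> graph_speed (f s) x"
      unfolding graph_speed_eq using sT pos by (intro speed_nonneg psd_hess) auto
    with evolution_interior[OF sT pos]
    show "\<exists>y. ((\<lambda>s. f s x) has_real_derivative y) (at s) \<and> 0 \<le> y" by blast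
  next
    show "continuous_on {a..r} (\<lambda>s. f s x)"
      using r(1) by (intro continuous_on_subset[OF cont]) (auto simp: S_def)
  qed
  moreover have "f r x \<le> c" using r(1) by (simp add: S_def)
  ultimately show False using c by simp
qed

text \<open>Going back in time, \<open>f\<close> decreases, so the point stays in a closed sublevel set and cannot leave the
  domain.\<close>

lemma persistence:
  assumes \<epsilon>: "0 < \<epsilon>" "\<epsilon> < \<delta>" and t: "t \<in> {0..T}" and x: "x \<in> \<Omega> t" "f t x \<le> \<epsilon>\<^sup>2 / 2"
    and s: "0 \<le> s" "s \<le> t"
  shows "x \<in> \<Omega> s \<and> f s x \<le> f t x"
proof -
  obtain W where W: "open W" "{(x, t). t \<in> {0..<Tc} \<and> x \<in> \<Omega> t} = (UNIV \<times> {0..<Tc}) \<inter> W"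
    using open_domain unfolding openin_open by blast
  then have Wiff: "x \<in> \<Omega> r \<longleftrightarrow> (x, r) \<in> W" if "r \<in> {0..t}" for r
  proof -
    have "(x, r) \<in> {(x, t). t \<in> {0..<Tc} \<and> x \<in> \<Omega> t} \<longleftrightarrow> (x, r) \<in> (UNIV \<times> {0..<Tc}) \<inter> W"
      by (simp only: W(2))
    then show ?thesis using that t T by auto
  qed
  define B where "B = {0..t} - {r. x \<in> \<Omega> r}"
  have "open ((\<lambda>r. (x, r)) -` W)" by (intro open_vimage W continuous_intros)
  moreover have "B = {0..t} - (\<lambda>r. (x, r)) -` W" using Wiff by (auto simp: B_def)
  ultimately have "compact B" by (simp add: compact_diff)
  have in_slice: "x \<in> \<Omega> r" if "r \<in> {0..t}" for r
  proof (rule ccontr)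
    assume "x \<notin> \<Omega> r"
    with that have "B \<noteq> {}" by (auto simp: B_def)
    then obtain b where b: "b \<in> B" "\<And>r. r \<in> B \<Longrightarrow> r \<le> b"
      using compact_attains_sup[OF \<open>compact B\<close>] by blast
    have "b < t" using b(1) x(1) by (cases "b = t") (auto simp: B_def)
    have after: "x \<in> \<Omega> r" if "b < r" "r \<le> t" for r
    proof (rule ccontr)
      assume "x \<notin> \<Omega> r"
      then have "r \<in> B" using b(1) that by (auto simp: B_def)
      from b(2)[OF this] that show False by simp
    qed
    define u where "u = (\<lambda>n. b + (t - b) / real (Suc n))"
    have u: "b < u n" "u n \<le> t" for n
    proof -
      have "(t - b) / real (Suc n) \<le> t - b"
        using divide_left_mono[of 1 "real (Suc n)" "t - b"] \<open>b < t\<close> by simp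
      moreover have "0 < (t - b) / real (Suc n)" using \<open>b < t\<close> by simp
      ultimately show "b < u n" "u n \<le> t" unfolding u_def by linarith+
    qed
    have "(x, u n) \<in> {(x, t). t \<in> {0..T} \<and> x \<in> \<Omega> t \<and> f t x \<le> \<epsilon>\<^sup>2 / 2}" for n
    proof -
      have "0 \<le> u n" using b(1) u(1)[of n] by (auto simp: B_def)
      moreover have "f (u n) x \<le> f t x"
        by (rule nondecreasing_in_time) (use u[of n] t \<open>0 \<le> u n\<close> after in auto)
      ultimately show ?thesis using u[of n] t after x(2) by auto
    qed
    moreover have "u \<longlonglongrightarrow> b"
    proof -
      have "(\<lambda>n. b + (t - b) * inverse (real (Suc n))) \<longlonglongrightarrow> b + (t - b) * 0"
        by (intro tendsto_intros LIMSEQ_inverse_real_of_nat)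
      then show ?thesis by (simp add: u_def field_simps)
    qed
    then have "(\<lambda>n. (x, u n)) \<longlonglongrightarrow> (x, b)" by (intro tendsto_intros)
    ultimately have "(x, b) \<in> {(x, t). t \<in> {0..T} \<and> x \<in> \<Omega> t \<and> f t x \<le> \<epsilon>\<^sup>2 / 2}"
      by (rule closed_sequentially[OF closed_sublevel[OF \<epsilon>]])
    with b(1) show False by (simp add: B_def)
  qed
  moreover have "f s x \<le> f t x"
    by (rule nondecreasing_in_time) (use s t in_slice in auto)
  ultimately show ?thesis using s by simp
qed

end

section \<open>Comparison with the rescaled flow\<close>

context flat_side_solution
begin

text \<open>If the hypersurfaces \<open>M\<^sub>t\<close> move by \<open>\<sigma>\<^sub>2\<close>, then so do the \<open>c M\<^bsub>t/c^3\<^esub>\<close>, because \<open>\<sigma>\<^sub>2\<close> has degree \<open>-2\<close>.\<close>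

definition rescaled :: "real \<Rightarrow> real \<Rightarrow> real ^ 'n \<Rightarrow> real" where
  "rescaled c t x = c * f (t / c ^ 3) ((1 / c) *\<^sub>R x)"

text \<open>Where \<open>g \<ge> a\<close>, this is \<open>f - a g\<close> up to terms quadratic in \<open>a\<close> and \<open>b\<close>. Lowering \<open>g\<close>, rather than raising
  the other function, keeps the Hessian \<open>(g - a) D\<^sup>2g + \<nabla>g \<nabla>g\<^sup>T\<close> a convex combination of positive
  semidefinite matrices. The constant \<open>b\<^sup>2/2\<close> makes the barrier trivial where \<open>g \<le> a \<le> b\<close>.\<close>

definition barrier :: "real \<Rightarrow> real \<Rightarrow> real \<Rightarrow> real ^ 'n \<Rightarrow> real" where
  "barrier a b t x = (max (pressure f t x) a - a)\<^sup>2 / 2 + b\<^sup>2 / 2"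

lemma rescaled_time:
  assumes "t \<in> {0..T}" "1 \<le> c"
  shows "t / c ^ 3 \<in> {0..T}" "t / c ^ 3 \<le> t"
proof -
  have "1 \<le> c ^ 3" using assms(2) by (rule one_le_power)
  then have "t / c ^ 3 \<le> t / 1" using assms by (intro divide_left_mono) auto
  then show "t / c ^ 3 \<le> t" by simp
  with assms show "t / c ^ 3 \<in> {0..T}" by auto
qed

text \<open>Rescaling only lowers \<open>f\<close>: going back in time does, and so does moving along a ray towards the
  disc. The second step gains a multiple of the gradient.\<close>

lemma rescaled_point:
  assumes \<epsilon>: "0 < \<epsilon>" "\<epsilon> < \<delta>" and t: "t \<in> {0..T}" and x: "x \<in> \<Omega> t" "f t x \<le> \<epsilon>\<^sup>2 / 2" and c: "1 \<le> c"
  shows "(1 / c) *\<^sub>R x \<in> \<Omega> (t / c ^ 3)" "f (t / c ^ 3) ((1 / c) *\<^sub>R x) \<le> f t x"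
    "rescaled c t x + (c - 1) * (\<rho> * norm (grad (f (t / c ^ 3)) ((1 / c) *\<^sub>R x))) \<le> f t x"
proof -
  define s y where "s = t / c ^ 3" and "y = (1 / c) *\<^sub>R x"
  have s: "s \<in> {0..T}" "0 \<le> s" "s \<le> t" using rescaled_time[OF t c] by (auto simp: s_def)
  have xs: "x \<in> \<Omega> s" "f s x \<le> f t x" using persistence[OF \<epsilon> t x s(2,3)] by auto
  have y: "y \<in> \<Omega> s" "f s y \<le> (1 / c) * f s x"
    using scale_in_slice[OF s(1) xs(1), of "1 / c"] c by (simp_all add: y_def)
  then show "(1 / c) *\<^sub>R x \<in> \<Omega> (t / c ^ 3)" by (simp add: y_def s_def)
  have "(1 / c) * f s x \<le> f s x"
    using c nonneg[OF s(1) xs(1)] by (intro mult_left_le_one_le) auto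
  with y(2) xs(2) show "f (t / c ^ 3) ((1 / c) *\<^sub>R x) \<le> f t x" by (simp add: y_def s_def)
  have "x - y = (c - 1) *\<^sub>R y" 
  proof -
    have "x - y = (1 - 1 / c) *\<^sub>R x" by (simp add: y_def scaleR_diff_left)
    also have "1 - 1 / c = (c - 1) * (1 / c)" using c by (simp add: field_simps)
    finally show ?thesis by (simp add: y_def)
  qed
  with above_tangent[OF s(1) y(1) xs(1)]
  have "f s y + (c - 1) * (grad (f s) y \<bullet> y) \<le> f s x" by simp
  moreover have "(c - 1) * (f s y + \<rho> * norm (grad (f s) y)) \<le> (c - 1) * (grad (f s) y \<bullet> y)"
    using radial_derivative_bound[OF s(1) y(1)] c by (intro mult_left_mono) auto
  ultimately have "c * f s y + (c - 1) * (\<rho> * norm (grad (f s) y)) \<le> f s x"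
    by (simp add: algebra_simps)
  with xs(2) show "rescaled c t x + (c - 1) * (\<rho> * norm (grad (f (t / c ^ 3)) ((1 / c) *\<^sub>R x))) \<le> f t x"
    by (simp add: rescaled_def s_def y_def)
qed

lemma rescaled_le:
  assumes "0 < \<epsilon>" "\<epsilon> < \<delta>" "t \<in> {0..T}" "x \<in> \<Omega> t" "f t x \<le> \<epsilon>\<^sup>2 / 2" "1 \<le> c"
  shows "rescaled c t x \<le> f t x"
proof -
  have "0 \<le> (c - 1) * (\<rho> * norm (grad (f (t / c ^ 3)) ((1 / c) *\<^sub>R x)))"
    using assms(6) \<rho> by simp
  with rescaled_point(3)[OF assms] show ?thesis by linarith
qed

lemma half_square_diff: "(g - d)\<^sup>2 / 2 + b\<^sup>2 / 2 = g\<^sup>2 / 2 - d * g + d\<^sup>2 / 2 + b\<^sup>2 / (2::real)"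
  by (simp add: power2_eq_square field_simps)

lemma rescaled_le_barrier_flat:
  assumes "0 < \<epsilon>" "\<epsilon> < \<delta>" and t: "t \<in> {0..T}" and x: "x \<in> \<Omega> t" "f t x \<le> \<epsilon>\<^sup>2 / 2" and "1 \<le> c"
    and d: "0 \<le> d" "d \<le> d0" and g: "pressure f t x \<le> d"
  shows "rescaled c t x \<le> barrier d d0 t x"
proof -
  have "rescaled c t x \<le> f t x" by (rule rescaled_le) fact+
  also have "\<dots> \<le> d\<^sup>2 / 2" using g d nonneg[OF t x(1)] by (simp add: pressure_le_iff)
  also have "\<dots> \<le> d0\<^sup>2 / 2" using d by (simp add: power_mono)
  also have "\<dots> = barrier d d0 t x" using g by (simp add: barrier_def max_absorb2)
  finally show ?thesis .
qed

text \<open>On \<open>{g = \<epsilon>}\<close>, either the rescaled flow is at most half of \<open>f\<close>, or convexity bounds the gradient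
  gained by rescaling from below.\<close>

lemma rescaled_le_barrier_lateral:
  assumes \<epsilon>: "0 < \<epsilon>" "\<epsilon> < \<delta>" and t: "t \<in> {0..T}" and x: "x \<in> \<Omega> t" and c: "1 \<le> c" "c \<le> 2"
    and d: "d \<le> d0" "d0 \<le> \<epsilon> / 4" "d0 \<le> (c - 1) * (\<rho> * \<epsilon> / (8 * R))" and g: "pressure f t x = \<epsilon>"
  shows "rescaled c t x \<le> barrier d d0 t x"
proof -
  let ?s = "t / c ^ 3" and ?y = "(1 / c) *\<^sub>R x"
  have fx: "f t x = \<epsilon>\<^sup>2 / 2" using half_pressure_sq[of f t x] nonneg[OF t x] g by simp
  note pt = rescaled_point[OF \<epsilon> t x fx[THEN eq_refl] c(1)]
  have s: "?s \<in> {0..T}" by (rule rescaled_time(1)[OF t c(1)])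
  have b: "barrier d d0 t x = \<epsilon>\<^sup>2 / 2 - d * \<epsilon> + d\<^sup>2 / 2 + d0\<^sup>2 / 2"
    using d \<epsilon> by (simp add: barrier_def g max_absorb1 half_square_diff)
  have de: "d * \<epsilon> \<le> d0 * \<epsilon>" using d \<epsilon> by (simp add: mult_right_mono)
  show ?thesis
  proof (cases "rescaled c t x \<le> \<epsilon>\<^sup>2 / 4")
    case True
    have "d0 * \<epsilon> \<le> \<epsilon> / 4 * \<epsilon>" using d \<epsilon> by (intro mult_right_mono) auto
    then have "d * \<epsilon> \<le> \<epsilon>\<^sup>2 / 4" using de by (simp add: power2_eq_square)
    moreover have "0 \<le> d\<^sup>2" "0 \<le> d0\<^sup>2" by simp_all
    ultimately show ?thesis using True unfolding b by linarith
  next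
    case False
    have "rescaled c t x \<le> 2 * f ?s ?y"
      unfolding rescaled_def using c nonneg[OF s pt(1)] by (intro mult_right_mono) auto
    with False have "\<epsilon>\<^sup>2 / 8 \<le> f ?s ?y" by simp
    also have "\<dots> \<le> R * norm (grad (f ?s) ?y)" by (rule value_le_gradient[OF s pt(1)])
    finally have "\<epsilon>\<^sup>2 / (8 * R) \<le> norm (grad (f ?s) ?y)" using R by (simp add: field_simps)
    then have "(c - 1) * (\<rho> * (\<epsilon>\<^sup>2 / (8 * R))) \<le> (c - 1) * (\<rho> * norm (grad (f ?s) ?y))"
      using c \<rho> by (intro mult_left_mono) auto
    moreover have "d0 * \<epsilon> \<le> (c - 1) * (\<rho> * \<epsilon> / (8 * R)) * \<epsilon>" using d \<epsilon> by (intro mult_right_mono) auto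
    moreover have "(c - 1) * (\<rho> * \<epsilon> / (8 * R)) * \<epsilon> = (c - 1) * (\<rho> * (\<epsilon>\<^sup>2 / (8 * R)))"
      by (simp add: power2_eq_square)
    ultimately have "rescaled c t x \<le> \<epsilon>\<^sup>2 / 2 - d * \<epsilon>" using pt(3) fx de by linarith
    also have "\<dots> \<le> barrier d d0 t x" unfolding b by simp
    finally show ?thesis .
  qed
qed

text \<open>If \<open>g\<close> at most doubles from \<open>x / c\<close> to \<open>x\<close>, the initial nondegeneracy at \<open>x / c\<close> gives a gain comparable
  to \<open>g(x)\<close>. Otherwise the rescaled flow is at most \<open>g\<^sup>2/4\<close>, which lies below the barrier by
  \<open>(g/2 - d)\<^sup>2 \<ge> 0\<close>, for any offset \<open>d\<close>.\<close>

lemma rescaled_le_barrier_start: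
  assumes \<epsilon>: "0 < \<epsilon>" "\<epsilon> < \<delta>" and x: "x \<in> \<Omega> 0" "pressure f 0 x \<le> \<epsilon>" and c: "1 \<le> c" "c \<le> 2"
    and start: "\<And>y. y \<in> \<Omega> 0 \<Longrightarrow> 0 < pressure f 0 y \<Longrightarrow> pressure f 0 y \<le> \<epsilon> \<Longrightarrow> m \<le> norm (grad (pressure f 0) y)"
    and d: "0 < d" "d \<le> (c - 1) * (\<rho> * m / 2)" and g: "d < pressure f 0 x"
  shows "rescaled c 0 x \<le> barrier d d 0 x"
proof -
  let ?y = "(1 / c) *\<^sub>R x" and ?g = "pressure f 0 x"
  let ?gy = "pressure f 0 ?y"
  have t: "0 \<in> {0..T}" using T by simp
  have fx: "f 0 x = ?g\<^sup>2 / 2" by (simp add: half_pressure_sq nonneg[OF t x(1)])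
  have fx': "f 0 x \<le> \<epsilon>\<^sup>2 / 2" using x \<epsilon> nonneg[OF t x(1)] by (simp add: pressure_le_iff)
  note pt = rescaled_point[OF \<epsilon> t x(1) fx' c(1), simplified]
  have fy: "f 0 ?y = ?gy\<^sup>2 / 2" by (simp add: half_pressure_sq nonneg[OF t pt(1)])
  have b: "barrier d d 0 x = ?g\<^sup>2 / 2 - d * ?g + d\<^sup>2"
    using g by (simp add: barrier_def max_absorb1 half_square_diff)
  show ?thesis
  proof (cases "?g \<le> 2 * ?gy")
    case True
    with g d have gy: "0 < ?gy" by linarith
    have "?gy \<le> \<epsilon>" using pt(1,2) fx' \<epsilon> nonneg[OF t pt(1)] by (simp add: pressure_le_iff)
    have "?gy * m \<le> ?gy * norm (grad (pressure f 0) ?y)"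
      using start[OF pt(1) gy \<open>?gy \<le> \<epsilon>\<close>] gy by (intro mult_left_mono) auto
    also have "\<dots> = norm (grad (f 0) ?y)"
      using gy grad_pressure[OF t pt(1) gy[unfolded pressure_pos_iff]] by simp
    finally have "(c - 1) * (\<rho> * (?gy * m)) \<le> (c - 1) * (\<rho> * norm (grad (f 0) ?y))"
      using c \<rho> by (intro mult_left_mono) auto
    moreover have "d * ?g \<le> (c - 1) * (\<rho> * m / 2) * (2 * ?gy)"
      using d g True by (intro mult_mono) auto
    moreover have "(c - 1) * (\<rho> * m / 2) * (2 * ?gy) = (c - 1) * (\<rho> * (?gy * m))" by simp
    ultimately have "rescaled c 0 x \<le> ?g\<^sup>2 / 2 - d * ?g" using pt(3) fx by linarith
    also have "\<dots> \<le> barrier d d 0 x" unfolding b by simp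
    finally show ?thesis .
  next
    case False
    then have "?gy\<^sup>2 \<le> (?g / 2)\<^sup>2"
      using pressure_nonneg[of f 0 ?y, OF nonneg[OF t pt(1)]] by (intro power_mono) auto
    moreover have "rescaled c 0 x \<le> 2 * f 0 ?y"
      unfolding rescaled_def using c nonneg[OF t pt(1)] by (simp add: mult_right_mono)
    ultimately have "rescaled c 0 x \<le> ?g\<^sup>2 / 4" using fy by (simp add: power_divide)
    also have "\<dots> \<le> barrier d d 0 x"
      using zero_le_power2[of "?g / 2 - d"] unfolding b by (simp add: power2_eq_square algebra_simps)
    finally show ?thesis .
  qed
qed

lemma continuous_rescaled:
  assumes \<epsilon>: "0 < \<epsilon>" "\<epsilon> < \<delta>" and c: "1 \<le> c"
  shows "continuous_on {(x, t). t \<in> {0..T} \<and> x \<in> \<Omega> t \<and> f t x \<le> \<epsilon>\<^sup>2 / 2} (\<lambda>(x, t). rescaled c t x)"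
    (is "continuous_on ?C _")
proof -
  have "continuous_on ?C (\<lambda>q. (\<lambda>(x, t). f t x) ((1 / c) *\<^sub>R fst q, snd q / c ^ 3))"
  proof (rule continuous_on_compose2[OF continuous])
    show "continuous_on ?C (\<lambda>q. ((1 / c) *\<^sub>R fst q, snd q / c ^ 3))"
      using c by (intro continuous_intros) auto
    show "(\<lambda>q. ((1 / c) *\<^sub>R fst q, snd q / c ^ 3)) ` ?C \<subseteq> {(x, t). t \<in> {0..<Tc} \<and> x \<in> \<Omega> t}"
    proof clarify
      fix x t assume *: "t \<in> {0..T}" "x \<in> \<Omega> t" "f t x \<le> \<epsilon>\<^sup>2 / 2"
      show "snd (x, t) / c ^ 3 \<in> {0..<Tc} \<and> (1 / c) *\<^sub>R fst (x, t) \<in> \<Omega> (snd (x, t) / c ^ 3)"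
        using rescaled_point(1)[OF \<epsilon> * c] rescaled_time[OF *(1) c] T by auto
    qed
  qed
  then have "continuous_on ?C (\<lambda>q. c * f (snd q / c ^ 3) ((1 / c) *\<^sub>R fst q))"
    by (intro continuous_intros) simp
  then show ?thesis by (simp add: rescaled_def case_prod_beta)
qed

lemma continuous_pressure:
  "continuous_on {(x, t). t \<in> {0..T} \<and> x \<in> \<Omega> t} (\<lambda>(x, t). pressure f t x)"
proof -
  have "continuous_on {(x, t). t \<in> {0..T} \<and> x \<in> \<Omega> t} (\<lambda>(x, t). f t x)"
    by (rule continuous_on_subset[OF continuous]) (use T in auto)
  then show ?thesis unfolding pressure_def case_prod_beta by (intro continuous_intros)
qed

text \<open>Where the barrier is touched, the gradients agree and the Hessian of the rescaled flow lies below
  that of the barrier, so monotonicity and \<open>speed_half_square\<close> bound its velocity by \<open>(g - d) \<Psi>(g - d)\<close>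
  with \<open>\<Psi> = pressure_speed\<close>. The barrier moves with velocity \<open>(g - d) (\<Psi>(g) - d')\<close>. As \<open>\<Psi>\<close> is
  Lipschitz, the decay \<open>d' = - k d\<close> of the offset wins for large \<open>k\<close>.\<close>

lemma no_interior_touching:
  assumes \<epsilon>: "0 < \<epsilon>" "\<epsilon> < \<delta>" "\<epsilon> \<le> 1" and c: "1 < c"
    and lip: "\<And>(p::real^'n) M s s'. norm p \<le> L \<Longrightarrow> norm M \<le> L \<Longrightarrow> s \<in> {0..1} \<Longrightarrow> s' \<in> {0..1} \<Longrightarrow>
       \<bar>pressure_speed s p M - pressure_speed s' p M\<bar> \<le> C * \<bar>s - s'\<bar>"
    and k: "C < k" and d0: "0 < d0" and d: "d = (\<lambda>t. d0 * exp (- k * t))"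
    and t: "0 < t" "t \<le> T" and x: "x \<in> \<Omega> t" "d t < pressure f t x" "pressure f t x < \<epsilon>"
    and pos: "barrier (d t) d0 t x < rescaled c t x"
    and max: "\<And>s y. s \<in> {0..T} \<Longrightarrow> y \<in> \<Omega> s \<Longrightarrow> f s y \<le> \<epsilon>\<^sup>2 / 2 \<Longrightarrow>
      rescaled c s y - barrier (d s) d0 s y \<le> rescaled c t x - barrier (d t) d0 t x"
  shows False
proof -
  define g where "g = pressure f t x"
  define p where "p = grad (pressure f t) x"
  define M where "M = hess (pressure f t) x"
  define s where "s = t / c ^ 3"
  define y where "y = (1 / c) *\<^sub>R x"
  have tT: "t \<in> {0..T}" using t by simp
  have dt: "0 < d t" using d0 by (simp add: d)
  have g: "d t < g" "g < \<epsilon>" "0 < g" "g < \<delta>" using x dt \<epsilon> by (auto simp: g_def)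
  have fpos: "0 < f t x" using g(3) by (simp add: g_def pressure_pos_iff)
  have fx: "f t x < \<epsilon>\<^sup>2 / 2" using g fpos \<epsilon> by (simp add: g_def pressure_less_iff)
  have c1: "1 \<le> c" using c by simp
  have s: "s \<in> {0..T}" "0 < s" "s \<le> T"
    using rescaled_time[OF tT c1] t c by (auto simp: s_def)
  have y: "y \<in> \<Omega> s" unfolding y_def s_def by (rule rescaled_point(1)[OF \<epsilon>(1,2) tT x(1) _ c1]) (use fx in simp)
  have "0 < rescaled c t x" using pos by (rule le_less_trans[rotated]) (simp add: barrier_def)
  then have fy: "0 < f s y" using c by (simp add: rescaled_def s_def y_def zero_less_mult_iff)
  have pM: "twice_differentiable_at (pressure f t) x" "norm p \<le> L" "norm M \<le> L"
    using pressure_bounds[OF tT x(1)] g by (auto simp: g_def p_def M_def)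
  let ?N = "(g - d t) *\<^sub>R M + outer p" and ?A = "(1 / c) *\<^sub>R hess (f s) y"
  define r where "r = (g - d t) *\<^sub>R p"

  \<comment> \<open>At time \<open>t\<close>, the point \<open>x\<close> minimises the barrier minus the rescaled flow among nearby points.\<close>
  let ?k = "\<lambda>z. (pressure f t z - d t)\<^sup>2 / 2 + d0\<^sup>2 / 2"
  have k2: "second_order_at ?k x r ?N"
    using second_order_at_half_square[OF twice_differentiable_at_imp_second_order[OF pM(1)], of "d t" "d0\<^sup>2 / 2"]
    by (simp add: g_def p_def M_def r_def)
  have u2: "second_order_at (\<lambda>z. c * f s ((1 / c) *\<^sub>R z)) x (grad (f s) y) ?A"
    using twice_differentiable_at_imp_second_order[OF twice_differentiable[OF s(1) y fy]] c
    unfolding y_def by (intro second_order_at_rescale) auto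
  note diff2 = second_order_at_diff[OF k2 u2]
  have cont_f: "isCont (f t) x" using has_derivative_continuous[OF has_derivative_slice[OF tT x(1)]] .
  have "isCont (pressure f t) x" unfolding pressure_def[abs_def] using cont_f by (intro continuous_intros)
  then have "\<forall>\<^sub>F z in nhds x. d t < pressure f t z"
    using order_tendstoD(1)[of "pressure f t" "pressure f t x" "nhds x" "d t"] x(2)
    by (simp add: isCont_def tendsto_at_iff_tendsto_nhds)
  moreover have "\<forall>\<^sub>F z in nhds x. f t z < \<epsilon>\<^sup>2 / 2"
    using order_tendstoD(2)[of "f t" "f t x" "nhds x" "\<epsilon>\<^sup>2 / 2"] cont_f fx
    by (simp add: isCont_def tendsto_at_iff_tendsto_nhds)
  ultimately have min: "\<forall>\<^sub>F z in nhds x. ?k x - c * f s ((1 / c) *\<^sub>R x) \<le> ?k z - c * f s ((1 / c) *\<^sub>R z)"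
    using eventually_slice[OF tT x(1)]
  proof eventually_elim
    case (elim z)
    have "rescaled c t z - barrier (d t) d0 t z \<le> rescaled c t x - barrier (d t) d0 t x"
      using elim by (intro max tT) auto
    then show ?case using elim(1) x(2) by (simp add: rescaled_def barrier_def max_absorb1 s_def)
  qed
  have "r = grad (f s) y" using second_order_at_local_min(1)[OF diff2 min] by simp
  have "psd (?N - ?A)"
    using second_order_at_symmetric[OF diff2] second_order_at_local_min(2)[OF diff2 min] by (simp add: psd_def)
  moreover have "psd ?A" using psd_hess[OF s(1) y fy] c by (intro psd_scaleR) auto
  ultimately have "speed r ?A \<le> speed r ?N" by (intro speed_mono)
  then have up: "(1 / c)\<^sup>2 * graph_speed (f s) y \<le> (g - d t) * pressure_speed (g - d t) p M"
    by (simp add: graph_speed_eq speed_scaleR speed_half_square r_def flip: \<open>r = grad (f s) y\<close>)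

  \<comment> \<open>Shortly before \<open>t\<close>, the point \<open>x\<close> lies in the sublevel set as well, so the difference \<open>?\<phi>\<close>, maximal
    at \<open>t\<close>, has a derivative \<open>v \<ge> 0\<close> there.\<close>
  let ?\<phi> = "\<lambda>\<tau>. c * f (\<tau> / c ^ 3) y - ((pressure f \<tau> x - d \<tau>)\<^sup>2 / 2 + d0\<^sup>2 / 2)"
  define v where "v = c * (graph_speed (f s) y * (1 / c ^ 3))
      - (g - d t) * (pressure_speed g p M + k * d t)"
  have D1: "((\<lambda>\<tau>. f (\<tau> / c ^ 3) y) has_real_derivative graph_speed (f s) y * (1 / c ^ 3)) (at t)"
  proof -
    have "((\<lambda>\<tau>. \<tau> / c ^ 3) has_real_derivative 1 / c ^ 3) (at t)"
      by (rule DERIV_cdivide) (rule DERIV_ident)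
    from DERIV_chain2[OF _ this, of "\<lambda>s. f s y"] evolution_interior[OF s(2,3) y fy]
    show ?thesis by (simp add: s_def)
  qed
  have gs: "graph_speed (f t) x = g * pressure_speed g p M"
    using graph_speed_eq_pressure_speed[OF tT x(1)] g by (simp add: g_def p_def M_def)
  have D2: "((\<lambda>\<tau>. pressure f \<tau> x) has_real_derivative pressure_speed g p M) (at t)"
  proof -
    have "((\<lambda>\<tau>. sqrt (2 * f \<tau> x)) has_real_derivative inverse (sqrt (2 * f t x)) / 2 * (2 * graph_speed (f t) x)) (at t)"
      using evolution_interior[OF t x(1) fpos] fpos
      by (intro DERIV_chain2[OF DERIV_real_sqrt] DERIV_cmult) auto
    moreover have "sqrt (2 * f t x) = g" by (simp add: g_def pressure_def)
    moreover have "inverse g / 2 * (2 * graph_speed (f t) x) = pressure_speed g p M"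
      unfolding gs using g(3) by simp
    ultimately show ?thesis by (simp only: pressure_def)
  qed
  have D3: "(d has_real_derivative - k * d t) (at t)"
    unfolding d by (auto intro!: derivative_eq_intros)
  have D4: "((\<lambda>\<tau>. (pressure f \<tau> x - d \<tau>)\<^sup>2 / 2 + d0\<^sup>2 / 2) has_real_derivative
      (g - d t) * (pressure_speed g p M + k * d t)) (at t)"
    using DERIV_add[OF DERIV_cdivide[OF DERIV_power[OF DERIV_diff[OF D2 D3], of 2], of 2]
        DERIV_const[of "d0\<^sup>2 / 2"]]
    by (simp add: g_def mult.commute)
  have "(?\<phi> has_real_derivative v) (at t)"
    unfolding v_def by (rule DERIV_diff[OF DERIV_cmult[OF D1] D4])
  have "0 \<le> v"
  proof (rule ccontr)
    assume "\<not> 0 \<le> v"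
    then obtain h where h: "h > 0" "\<And>\<tau>. 0 < \<tau> \<Longrightarrow> \<tau> < h \<Longrightarrow> ?\<phi> t < ?\<phi> (t - \<tau>)"
      using DERIV_neg_dec_left[OF \<open>(?\<phi> has_real_derivative v) (at t)\<close>] by auto
    have "isCont (\<lambda>\<tau>. pressure f \<tau> x - d \<tau>) t"
      using DERIV_isCont[OF DERIV_diff[OF D2 D3]] .
    then have "((\<lambda>\<tau>. pressure f \<tau> x - d \<tau>) \<longlongrightarrow> pressure f t x - d t) (nhds t)"
      using tendsto_at_iff_tendsto_nhds[of "\<lambda>\<tau>. pressure f \<tau> x - d \<tau>" t] by (simp add: isCont_def)
    then have "\<forall>\<^sub>F \<tau> in nhds t. 0 < pressure f \<tau> x - d \<tau>"
      using order_tendstoD(1)[of _ _ _ 0] x(2) by fastforce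
    then obtain h' where h': "h' > 0" "\<And>\<tau>. \<bar>\<tau> - t\<bar> < h' \<Longrightarrow> d \<tau> < pressure f \<tau> x"
      unfolding eventually_nhds_metric by (auto simp: dist_real_def)
    define \<tau> where "\<tau> = min (min h h') t / 2"
    have \<tau>: "0 < \<tau>" "\<tau> < h" "\<tau> < h'" "\<tau> < t" using h h' t by (auto simp: \<tau>_def min_def)
    have old: "x \<in> \<Omega> (t - \<tau>)" "f (t - \<tau>) x \<le> f t x"
      using persistence[OF \<epsilon>(1,2) tT x(1), of "t - \<tau>"] fx \<tau> by auto
    have "rescaled c (t - \<tau>) x - barrier (d (t - \<tau>)) d0 (t - \<tau>) x \<le> rescaled c t x - barrier (d t) d0 t x"
      using old fx \<tau> t by (intro max) auto
    moreover have "rescaled c (t - \<tau>) x - barrier (d (t - \<tau>)) d0 (t - \<tau>) x = ?\<phi> (t - \<tau>)"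
      using h'(2)[of "t - \<tau>"] \<tau> by (simp add: rescaled_def barrier_def y_def max_absorb1)
    moreover have "rescaled c t x - barrier (d t) d0 t x = ?\<phi> t"
      using x(2) by (simp add: rescaled_def barrier_def y_def max_absorb1)
    ultimately show False using h(2)[OF \<tau>(1,2)] by linarith
  qed
  then have "(g - d t) * (pressure_speed g p M + k * d t) \<le> (1 / c)\<^sup>2 * graph_speed (f s) y"
    using c by (simp add: v_def power2_eq_square power3_eq_cube)
  with up have "(g - d t) * (pressure_speed g p M + k * d t) \<le> (g - d t) * pressure_speed (g - d t) p M"
    by linarith
  then have "pressure_speed g p M + k * d t \<le> pressure_speed (g - d t) p M"
    using g(1) by (simp add: mult_le_cancel_left)
  moreover have "\<bar>pressure_speed (g - d t) p M - pressure_speed g p M\<bar> \<le> C * \<bar>g - d t - g\<bar>"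
    using g dt \<epsilon> by (intro lip pM) auto
  moreover have "\<bar>g - d t - g\<bar> = d t" using dt by simp
  ultimately have "k * d t \<le> C * d t" by (simp only:)
  with k dt show False by simp
qed

text \<open>The difference attains its maximum on the compact sublevel set \<open>{g \<le> \<epsilon>}\<close>; all places where it
  could be positive have been excluded.\<close>

lemma rescaled_le_barrier:
  assumes \<epsilon>: "0 < \<epsilon>" "\<epsilon> < \<delta>" "\<epsilon> \<le> 1" and c: "1 < c" "c \<le> 2"
    and lip: "\<And>(p::real^'n) M s s'. norm p \<le> L \<Longrightarrow> norm M \<le> L \<Longrightarrow> s \<in> {0..1} \<Longrightarrow> s' \<in> {0..1} \<Longrightarrow>
       \<bar>pressure_speed s p M - pressure_speed s' p M\<bar> \<le> C * \<bar>s - s'\<bar>"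
    and k: "C < k" "0 < k"
    and start: "\<And>y. y \<in> \<Omega> 0 \<Longrightarrow> 0 < pressure f 0 y \<Longrightarrow> pressure f 0 y \<le> \<epsilon> \<Longrightarrow> m \<le> norm (grad (pressure f 0) y)"
    and d0: "0 < d0" "d0 \<le> \<epsilon> / 4" "d0 \<le> (c - 1) * (\<rho> * \<epsilon> / (8 * R))" "d0 \<le> (c - 1) * (\<rho> * m / 2)"
    and t: "t \<in> {0..T}" and x: "x \<in> \<Omega> t" "f t x \<le> \<epsilon>\<^sup>2 / 2"
  shows "rescaled c t x \<le> barrier (d0 * exp (- k * t)) d0 t x"
proof (rule ccontr)
  define d where "d = (\<lambda>t. d0 * exp (- k * t))"
  define D where "D = (\<lambda>q. rescaled c (snd q) (fst q) - barrier (d (snd q)) d0 (snd q) (fst q))"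
  let ?C = "{(x, t). t \<in> {0..T} \<and> x \<in> \<Omega> t \<and> f t x \<le> \<epsilon>\<^sup>2 / 2}"
  assume "\<not> ?thesis"
  then have Dpos: "0 < D (x, t)" by (simp add: D_def d_def)
  have c1: "1 \<le> c" using c by simp
  have dpos: "0 < d t" for t using d0 by (simp add: d_def)
  have dle: "d t \<le> d0" if "t \<in> {0..T}" for t using that d0 k by (simp add: d_def mult_le_cancel_left1)
  have "continuous_on ?C D"
  proof -
    have 1: "continuous_on ?C (\<lambda>q. rescaled c (snd q) (fst q))"
      using continuous_rescaled[OF \<epsilon>(1,2) c1] by (simp add: case_prod_beta)
    have "continuous_on ?C (\<lambda>(x, t). pressure f t x)"
      by (rule continuous_on_subset[OF continuous_pressure]) auto
    then have 2: "continuous_on ?C (\<lambda>q. pressure f (snd q) (fst q))" by (simp add: case_prod_beta)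
    show ?thesis unfolding D_def barrier_def d_def by (intro continuous_intros 1 2) auto
  qed
  moreover have "(x, t) \<in> ?C" using t x by simp
  ultimately obtain q where q: "q \<in> ?C" "\<And>q'. q' \<in> ?C \<Longrightarrow> D q' \<le> D q"
    using continuous_attains_sup[OF compact_sublevel[OF \<epsilon>(1,2)], of D] by blast
  obtain z s where zs: "q = (z, s)" by (cases q)
  have s: "s \<in> {0..T}" and z: "z \<in> \<Omega> s" "f s z \<le> \<epsilon>\<^sup>2 / 2" using q(1) zs by auto
  have "0 < D q" using Dpos q(2)[OF \<open>(x, t) \<in> ?C\<close>] by linarith
  then have pos: "barrier (d s) d0 s z < rescaled c s z" by (simp add: D_def zs)
  have g: "pressure f s z \<le> \<epsilon>" using z nonneg[OF s z(1)] \<epsilon> by (simp add: pressure_le_iff)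
  have 1: "d s < pressure f s z"
  proof (rule ccontr)
    assume "\<not> ?thesis"
    then have "rescaled c s z \<le> barrier (d s) d0 s z"
      using dpos[of s] dle[OF s] by (intro rescaled_le_barrier_flat[OF \<epsilon>(1,2) s z c1]) auto
    with pos show False by simp
  qed
  have 2: "0 < s"
  proof (rule ccontr)
    assume "\<not> ?thesis"
    with s have "s = 0" by simp
    then have "rescaled c 0 z \<le> barrier d0 d0 0 z"
      using z(1) g 1 d0 by (intro rescaled_le_barrier_start[OF \<epsilon>(1,2) _ _ c1 c(2) start]) (auto simp: d_def)
    with pos \<open>s = 0\<close> show False by (simp add: d_def)
  qed
  have 3: "pressure f s z < \<epsilon>"
  proof (rule ccontr)
    assume "\<not> ?thesis"
    with g have "pressure f s z = \<epsilon>" by simp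
    from rescaled_le_barrier_lateral[OF \<epsilon>(1,2) s z(1) c1 c(2) dle[OF s] d0(2,3) this] pos
    show False by simp
  qed
  show False
  proof (rule no_interior_touching[OF \<epsilon> c(1) lip k(1) d0(1) d_def 2 _ z(1) 1 3 pos])
    show "s \<le> T" using s by simp
    fix s' y assume "s' \<in> {0..T}" "y \<in> \<Omega> s'" "f s' y \<le> \<epsilon>\<^sup>2 / 2"
    then show "rescaled c s' y - barrier (d s') d0 s' y \<le> rescaled c s z - barrier (d s) d0 s z"
      using q(2)[of "(y, s')"] by (simp add: D_def zs)
  qed
qed

text \<open>The comparison to first order in \<open>c - 1\<close>: the right-hand side is minus the derivative of
  \<open>rescaled c t x\<close> at \<open>c = 1\<close>, and the terms of the barrier that are quadratic in its offsets
  disappear.\<close>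

lemma derivative_of_comparison:
  assumes t: "0 < t" "t \<le> T" and x: "x \<in> \<Omega> t" "0 < f t x" and a: "0 < a" and e: "0 < e" "e \<le> 1"
    and le: "\<And>c. 1 < c \<Longrightarrow> c \<le> 2 \<Longrightarrow> rescaled c t x \<le> barrier (a * (c - 1) * e) (a * (c - 1)) t x"
  shows "a * e * pressure f t x \<le> grad (f t) x \<bullet> x + 3 * t * graph_speed (f t) x - f t x"
proof -
  let ?F = "\<lambda>(x, t). f t x" and ?g = "pressure f t x"
  have tT: "t \<in> {0..T}" using t by simp
  have g: "0 < ?g" using x(2) by (simp add: pressure_pos_iff)
  obtain D where D: "(?F has_derivative D) (at (x, t))"
    using joint[OF t x] unfolding differentiable_def by blast
  have lin: "linear D" using D by (rule has_derivative_linear)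
  have Dx: "D (h, 0) = grad (f t) x \<bullet> h" for h
  proof -
    have "((\<lambda>y. (y, t)) has_derivative (\<lambda>h. (h, 0))) (at x)" by (auto intro!: derivative_eq_intros)
    from has_derivative_compose[OF this D] have "(f t has_derivative (\<lambda>h. D (h, 0))) (at x)" by simp
    from has_derivative_unique[OF this has_derivative_slice[OF tT x(1)]] show ?thesis by metis
  qed
  have Dt: "D (0, h) = graph_speed (f t) x * h" for h
  proof -
    have "((\<lambda>s. (x, s)) has_derivative (\<lambda>h. (0, h))) (at t)" by (auto intro!: derivative_eq_intros)
    from has_derivative_compose[OF this D] have "((\<lambda>s. f s x) has_derivative (\<lambda>h. D (0, h))) (at t)" by simp
    from has_derivative_unique[OF this evolution_interior[OF t x, unfolded has_field_derivative_def]]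
    show ?thesis by metis
  qed
  define v where "v = f t x - grad (f t) x \<bullet> x - 3 * t * graph_speed (f t) x"
  have "((\<lambda>c. rescaled c t x) has_real_derivative v) (at 1)"
  proof -
    have "((\<lambda>c. ((1 / c) *\<^sub>R x, t / c ^ 3)) has_derivative (\<lambda>h. ((- h) *\<^sub>R x, - (3 * t * h)))) (at (1::real))"
      by (auto intro!: derivative_eq_intros)
    from has_derivative_compose[OF this, of ?F D] D
    have "((\<lambda>c. f (t / c ^ 3) ((1 / c) *\<^sub>R x)) has_derivative (\<lambda>h. D ((- h) *\<^sub>R x, - (3 * t * h)))) (at 1)"
      by simp
    moreover have "D ((- h) *\<^sub>R x, - (3 * t * h)) = (- (grad (f t) x \<bullet> x) - 3 * t * graph_speed (f t) x) * h" for h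
    proof -
      have "((- h) *\<^sub>R x, - (3 * t * h)) = ((- h) *\<^sub>R x, 0) + (0, - (3 * t * h))" by simp
      then show ?thesis by (simp only: linear_add[OF lin] Dx Dt) (simp add: algebra_simps)
    qed
    ultimately have "((\<lambda>c. f (t / c ^ 3) ((1 / c) *\<^sub>R x)) has_real_derivative
        - (grad (f t) x \<bullet> x) - 3 * t * graph_speed (f t) x) (at 1)"
      by (simp add: has_field_derivative_def mult_commute_abs)
    from DERIV_mult[OF DERIV_ident this]
    have "((\<lambda>c. rescaled c t x) has_real_derivative
        f t x + (- (grad (f t) x \<bullet> x) - 3 * t * graph_speed (f t) x)) (at 1)"
      by (simp add: rescaled_def)
    moreover have "f t x + (- (grad (f t) x \<bullet> x) - 3 * t * graph_speed (f t) x) = v" by (simp add: v_def)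
    ultimately show ?thesis by simp
  qed
  then have "((\<lambda>c. (rescaled c t x - rescaled 1 t x) / (c - 1)) \<longlongrightarrow> v) (at_right 1)"
    by (auto simp: has_field_derivative_iff intro: tendsto_mono[OF at_le])
  moreover have "((\<lambda>c. a\<^sup>2 * (c - 1) - a * e * ?g) \<longlongrightarrow> a\<^sup>2 * (1 - 1) - a * e * ?g) (at_right 1)"
    by (intro tendsto_intros)
  moreover have "\<forall>\<^sub>F c in at_right 1. (rescaled c t x - rescaled 1 t x) / (c - 1) \<le> a\<^sup>2 * (c - 1) - a * e * ?g"
  proof (rule eventually_at_rightI[of 1 "1 + min 1 (?g / a)"])
    fix c assume "c \<in> {1<..<1 + min 1 (?g / a)}"
    then have c: "1 < c" "c \<le> 2" and "c - 1 < ?g / a" by auto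
    then have ag: "a * (c - 1) < ?g" using a by (simp add: pos_less_divide_eq mult.commute)
    let ?b = "a * (c - 1)"
    have b: "0 < ?b" using a c by simp
    have be: "?b * e \<le> ?b" using mult_left_mono[of e 1 ?b] b e by simp
    have "rescaled c t x \<le> barrier (?b * e) ?b t x" by (rule le) fact+
    also have "\<dots> = ?g\<^sup>2 / 2 - ?b * e * ?g + (?b * e)\<^sup>2 / 2 + ?b\<^sup>2 / 2"
      using be ag by (simp add: barrier_def max_absorb1 half_square_diff)
    also have "\<dots> \<le> f t x - ?b * e * ?g + ?b\<^sup>2"
    proof -
      have "(?b * e)\<^sup>2 \<le> ?b\<^sup>2" using be b e by (intro power_mono) auto
      then show ?thesis using half_pressure_sq[of f t x] x(2) by simp
    qed
    finally have "rescaled c t x - rescaled 1 t x \<le> (a\<^sup>2 * (c - 1) - a * e * ?g) * (c - 1)"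
      by (simp add: rescaled_def power2_eq_square algebra_simps)
    then show "(rescaled c t x - rescaled 1 t x) / (c - 1) \<le> a\<^sup>2 * (c - 1) - a * e * ?g"
      using c by (simp add: divide_le_eq)
  qed (use g a in simp)
  ultimately have "v \<le> a\<^sup>2 * (1 - 1) - a * e * ?g" by (intro tendsto_le[of "at_right 1"]) auto
  then show ?thesis by (simp add: v_def)
qed

text \<open>Dividing \<open>a e g \<le> x \<bullet> \<nabla>f + 3 t f\<^sub>t - f\<close> by \<open>g\<close> gives \<open>a e \<le> R |\<nabla>g| + 3 T B (g + |\<nabla>g|\<^sup>2)\<close>, because \<open>f\<^sub>t\<close> is \<open>g\<close>
  times \<open>pressure_speed\<close>. For small \<open>g\<close> this bounds \<open>|\<nabla>g|\<close> from below.\<close>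

theorem pressure_gradient_bound:
  assumes \<epsilon>: "0 < \<epsilon>" "\<epsilon> < \<delta>" "\<epsilon> \<le> 1" and m: "0 < m"
    and start: "\<And>y. y \<in> \<Omega> 0 \<Longrightarrow> 0 < pressure f 0 y \<Longrightarrow> pressure f 0 y \<le> \<epsilon> \<Longrightarrow> m \<le> norm (grad (pressure f 0) y)"
  shows "\<exists>b>0. \<forall>t\<in>{0..T}. \<forall>x\<in>\<Omega> t. 0 < pressure f t x \<longrightarrow> b \<le> norm (grad (pressure f t) x)"
proof -
  obtain C where C: "0 < C" and lip: "\<And>(p::real^'n) M s s'. norm p \<le> L \<Longrightarrow> norm M \<le> L \<Longrightarrow>
      s \<in> {0..1} \<Longrightarrow> s' \<in> {0..1} \<Longrightarrow> \<bar>pressure_speed s p M - pressure_speed s' p M\<bar> \<le> C * \<bar>s - s'\<bar>"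
    by (rule pressure_speed_lipschitz) blast
  obtain B where B: "0 < B" and bound: "\<And>(p::real^'n) M s. norm p \<le> L \<Longrightarrow> norm M \<le> L \<Longrightarrow>
      s \<in> {0..1} \<Longrightarrow> pressure_speed s p M \<le> B * (s + (norm p)\<^sup>2)"
    by (rule pressure_speed_bound) blast
  define k where "k = C + 1"
  \<comment> \<open>\<open>a\<close> meets the requirements at the lateral boundary and at the initial time, after
    division by \<open>c - 1\<close>; \<open>w\<close> is what the decay leaves of it until \<open>T\<close>.\<close>
  define a where "a = min (\<epsilon> / 4) (min (\<rho> * \<epsilon> / (8 * R)) (\<rho> * m / 2))"
  have a: "0 < a" "a \<le> \<epsilon> / 4" "a \<le> \<rho> * \<epsilon> / (8 * R)" "a \<le> \<rho> * m / 2"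
    using \<epsilon> \<rho> R m by (auto simp: a_def)
  define w where "w = a * exp (- k * T)"
  have w: "0 < w" using a by (simp add: w_def)
  \<comment> \<open>Below \<open>\<eta>\<close>, the term linear in \<open>g\<close> takes at most half of \<open>w\<close>.\<close>
  define \<eta> where "\<eta> = min \<epsilon> (w / (6 * T * B))"
  have \<eta>: "0 < \<eta>" "\<eta> \<le> \<epsilon>" "3 * T * B * \<eta> \<le> w / 2"
  proof -
    show "0 < \<eta>" "\<eta> \<le> \<epsilon>" using \<epsilon> w T B by (auto simp: \<eta>_def)
    have "3 * T * B * \<eta> \<le> 3 * T * B * (w / (6 * T * B))"
      using T B by (intro mult_left_mono) (auto simp: \<eta>_def)
    then show "3 * T * B * \<eta> \<le> w / 2" using T B by (simp add: field_simps)
  qed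
  define q where "q = R + 3 * T * B * L"
  have q: "0 < q" using R T B L by (auto simp: q_def intro!: add_pos_nonneg)
  define b where "b = min m (min (\<eta> / (2 * R)) (w / (2 * q)))"
  have "0 < b" using m \<eta> R w q by (simp add: b_def)
  moreover have "b \<le> norm (grad (pressure f t) x)"
    if t: "t \<in> {0..T}" and x: "x \<in> \<Omega> t" and g: "0 < pressure f t x" for t x
  proof -
    let ?g = "pressure f t x" and ?p = "grad (pressure f t) x"
    have fpos: "0 < f t x" using g by (simp add: pressure_pos_iff)
    show ?thesis
    proof (cases "?g \<le> \<eta>")
      case False
      have "\<eta> / (2 * R) \<le> norm ?p"
        using pressure_le_gradient[OF t x fpos] False R by (simp add: divide_le_eq mult.commute)
      then show ?thesis by (simp add: b_def)
    next
      case small: True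
      show ?thesis
      proof (cases "t = 0")
        case True
        have "m \<le> norm ?p" using start[of x] x g small \<eta> True by auto
        then show ?thesis by (simp add: b_def)
      next
        case False
        with t have t': "0 < t" "t \<le> T" by auto
        have fx: "f t x \<le> \<epsilon>\<^sup>2 / 2"
          using small \<eta> fpos \<epsilon> pressure_le_iff[of f t x \<epsilon>] by simp
        have p: "norm ?p \<le> L" "norm (hess (pressure f t) x) \<le> L"
          using pressure_bounds[OF t x g] small \<eta> \<epsilon> by auto
        have "rescaled c t x \<le> barrier (a * (c - 1) * exp (- k * t)) (a * (c - 1)) t x"
          if c: "1 < c" "c \<le> 2" for c
        proof (rule rescaled_le_barrier[OF \<epsilon> c lip _ _ start _ _ _ _ t x fx])
          have "a * (c - 1) \<le> a * 1" using a c by (intro mult_left_mono) auto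
          then show "a * (c - 1) \<le> \<epsilon> / 4" using a(2) by linarith
          show "a * (c - 1) \<le> (c - 1) * (\<rho> * \<epsilon> / (8 * R))"
            using mult_right_mono[OF a(3), of "c - 1"] c by (simp add: mult.commute)
          show "a * (c - 1) \<le> (c - 1) * (\<rho> * m / 2)"
            using mult_right_mono[OF a(4), of "c - 1"] c by (simp add: mult.commute)
        qed (use a c C in \<open>auto simp: k_def\<close>)
        moreover have "0 \<le> k * t" using C t' by (simp add: k_def)
        ultimately have "a * exp (- k * t) * ?g \<le> grad (f t) x \<bullet> x + 3 * t * graph_speed (f t) x - f t x"
          using t' by (intro derivative_of_comparison x fpos a) auto
        also have "\<dots> \<le> grad (f t) x \<bullet> x + 3 * t * graph_speed (f t) x" using fpos by simp
        also have "graph_speed (f t) x = ?g * pressure_speed ?g ?p (hess (pressure f t) x)"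
          using graph_speed_eq_pressure_speed[OF t x g] small \<eta> \<epsilon> by simp
        also have "grad (f t) x \<bullet> x = ?g * (?p \<bullet> x)"
          by (simp add: grad_pressure[OF t x fpos])
        finally have "?g * (a * exp (- k * t)) \<le> ?g * (?p \<bullet> x + 3 * t * pressure_speed ?g ?p (hess (pressure f t) x))"
          by (simp add: algebra_simps)
        then have "a * exp (- k * t) \<le> ?p \<bullet> x + 3 * t * pressure_speed ?g ?p (hess (pressure f t) x)"
          using g by simp
        moreover have "w \<le> a * exp (- k * t)"
          unfolding w_def using a t' C by (simp add: k_def)
        moreover have "?p \<bullet> x \<le> R * norm ?p"
        proof -
          have "?p \<bullet> x \<le> norm ?p * norm x" by (rule norm_cauchy_schwarz)
          also have "\<dots> \<le> norm ?p * R" using bounded[OF t] x by (intro mult_left_mono) auto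
          finally show ?thesis by (simp add: mult.commute)
        qed
        moreover have "3 * t * pressure_speed ?g ?p (hess (pressure f t) x) \<le> w / 2 + 3 * T * B * L * norm ?p"
        proof -
          have "(norm ?p)\<^sup>2 \<le> L * norm ?p" using p(1) by (simp add: power2_eq_square mult_right_mono)
          then have "B * (?g + (norm ?p)\<^sup>2) \<le> B * (\<eta> + L * norm ?p)"
            using B small by (intro mult_left_mono) auto
          moreover have "pressure_speed ?g ?p (hess (pressure f t) x) \<le> B * (?g + (norm ?p)\<^sup>2)"
            using g small \<eta> \<epsilon> by (intro bound p) auto
          ultimately have "3 * t * pressure_speed ?g ?p (hess (pressure f t) x) \<le> 3 * t * (B * (\<eta> + L * norm ?p))"
            using t' by (intro mult_left_mono) auto
          also have "\<dots> \<le> 3 * T * (B * (\<eta> + L * norm ?p))"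
            using t' B \<eta> L by (intro mult_right_mono) auto
          finally show ?thesis using \<eta>(3) by (simp add: algebra_simps)
        qed
        ultimately have "w / 2 \<le> q * norm ?p" by (simp add: q_def algebra_simps)
        then have "w / (2 * q) \<le> norm ?p" using q by (simp add: field_simps)
        then show ?thesis by (simp add: b_def)
      qed
    qed
  qed
  ultimately show ?thesis by blast
qed

end

section \<open>Nondegeneracy of the flow\<close>

context flat_side_solution
begin

text \<open>The gradient of the initial pressure is bounded below near the interface because otherwise, by
  compactness of the sublevel sets, points where it is small accumulate at an interface point, and
  its limit there is too small.\<close>

lemma initial_gradient_bound:
  assumes m: "0 < m"
    and limit: "\<And>z. z \<in> frontier {x \<in> \<Omega> 0. f 0 x = 0} \<Longrightarrow>
      \<exists>l. m \<le> norm l \<and> (grad (pressure f 0) \<longlongrightarrow> l) (at z within {x \<in> \<Omega> 0. 0 < f 0 x})"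
  obtains \<epsilon> where "0 < \<epsilon>" "\<epsilon> < \<delta>" "\<epsilon> \<le> 1"
    "\<And>y. y \<in> \<Omega> 0 \<Longrightarrow> 0 < pressure f 0 y \<Longrightarrow> pressure f 0 y \<le> \<epsilon> \<Longrightarrow> m / 2 \<le> norm (grad (pressure f 0) y)"
proof -
  define \<mu> where "\<mu> = min 1 (\<delta> / 2)"
  have \<mu>: "0 < \<mu>" "\<mu> < \<delta>" "\<mu> \<le> 1" using \<delta> by (auto simp: \<mu>_def)
  define e where "e = (\<lambda>n. \<mu> * inverse (real (Suc n)))"
  have t: "0 \<in> {0..T}" using T by simp
  have e0: "0 < e 0" "e 0 < \<delta>" "e 0 \<le> 1" using \<mu> by (simp_all add: e_def)
  have e: "0 < e n" "e n \<le> e 0" for n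
  proof -
    have "inverse (real (Suc n)) \<le> 1" by (simp add: inverse_le_1_iff)
    then show "e n \<le> e 0" unfolding e_def using \<mu> by (intro mult_left_mono) simp_all
    show "0 < e n" using \<mu> by (simp add: e_def)
  qed
  show thesis
  proof (rule ccontr)
    assume no: "\<not> thesis"
    have "\<forall>n. \<exists>y. y \<in> \<Omega> 0 \<and> 0 < pressure f 0 y \<and> pressure f 0 y \<le> e n \<and>
        norm (grad (pressure f 0) y) < m / 2"
    proof (rule ccontr)
      assume "\<not> ?thesis"
      then obtain n where n: "\<And>y. y \<in> \<Omega> 0 \<Longrightarrow> 0 < pressure f 0 y \<Longrightarrow> pressure f 0 y \<le> e n \<Longrightarrow>
          m / 2 \<le> norm (grad (pressure f 0) y)" using not_less by blast
      have thesis
      proof (rule that[of "e n"])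
        show "0 < e n" by (rule e(1))
        show "e n < \<delta>" "e n \<le> 1" using e(2)[of n] e0(2,3) by linarith+
      qed (rule n)
      with no show False ..
    qed
    from choice[OF this] obtain y where y': "\<forall>n. y n \<in> \<Omega> 0 \<and> 0 < pressure f 0 (y n) \<and>
        pressure f 0 (y n) \<le> e n \<and> norm (grad (pressure f 0) (y n)) < m / 2" by blast
    then have y: "\<And>n. y n \<in> \<Omega> 0" "\<And>n. 0 < pressure f 0 (y n)" "\<And>n. pressure f 0 (y n) \<le> e n"
      "\<And>n. norm (grad (pressure f 0) (y n)) < m / 2" by blast+
    have fy: "f 0 (y n) \<le> (e n)\<^sup>2 / 2" "0 < f 0 (y n)" for n
    proof -
      have "0 \<le> e n" using e(1)[of n] by simp
      from pressure_le_iff[of f 0 "y n", OF nonneg[OF t y(1)] this] y(3)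
      show "f 0 (y n) \<le> (e n)\<^sup>2 / 2" by blast
      show "0 < f 0 (y n)" using y(2)[of n] unfolding pressure_pos_iff .
    qed
    have "\<forall>n. (y n, 0) \<in> {(x, t). t \<in> {0..T} \<and> x \<in> \<Omega> t \<and> f t x \<le> (e 0)\<^sup>2 / 2}"
    proof
      fix n
      have "(e n)\<^sup>2 \<le> (e 0)\<^sup>2" using e[of n] by (intro power_mono) auto
      then show "(y n, 0) \<in> {(x, t). t \<in> {0..T} \<and> x \<in> \<Omega> t \<and> f t x \<le> (e 0)\<^sup>2 / 2}"
        using t y(1)[of n] fy(1)[of n] by simp
    qed
    then obtain q r where q: "q \<in> {(x, t). t \<in> {0..T} \<and> x \<in> \<Omega> t \<and> f t x \<le> (e 0)\<^sup>2 / 2}"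
      and r: "strict_mono r" "((\<lambda>n. (y n, 0)) \<circ> r) \<longlonglongrightarrow> q"
      by (rule seq_compactE[OF compact_imp_seq_compact[OF compact_sublevel[OF e0(1,2)]]])
    define z where "z = fst q"
    have yz: "(y \<circ> r) \<longlonglongrightarrow> z" using tendsto_fst[OF r(2)] by (simp add: z_def comp_def)
    have "snd q = 0" using tendsto_snd[OF r(2)] by (simp add: comp_def LIMSEQ_const_iff)
    then have z: "z \<in> \<Omega> 0" using q by (auto simp: z_def)
    have "f 0 z = 0"
    proof -
      have "(\<lambda>n. f 0 (y (r n))) \<longlonglongrightarrow> f 0 z"
        using has_derivative_continuous[OF has_derivative_slice[OF t z]] yz
        by (simp add: continuous_at_sequentially comp_def)
      moreover have "(\<lambda>n. (e (r n))\<^sup>2 / 2) \<longlonglongrightarrow> 0\<^sup>2 / 2"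
      proof -
        have "e \<longlonglongrightarrow> \<mu> * 0" unfolding e_def by (intro tendsto_intros LIMSEQ_inverse_real_of_nat)
        then have "e \<longlonglongrightarrow> 0" by simp
        from LIMSEQ_subseq_LIMSEQ[OF this r(1)] have "(\<lambda>n. e (r n)) \<longlonglongrightarrow> 0" by (simp add: comp_def)
        from tendsto_divide[OF tendsto_power[OF this, of 2] tendsto_const[of 2]] show ?thesis by simp
      qed
      ultimately have "f 0 z \<le> 0\<^sup>2 / 2" by (rule LIMSEQ_le) (use fy(1) in blast)
      with nonneg[OF t z] show ?thesis by simp
    qed
    have ne: "y (r n) \<noteq> z" for n
    proof
      assume "y (r n) = z"
      with fy(2)[of "r n"] \<open>f 0 z = 0\<close> show False by simp
    qed
    have "z \<in> frontier {x \<in> \<Omega> 0. f 0 x = 0}"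
      unfolding frontier_def
    proof
      have "z \<in> {x \<in> \<Omega> 0. f 0 x = 0}" using z \<open>f 0 z = 0\<close> by simp
      then show "z \<in> closure {x \<in> \<Omega> 0. f 0 x = 0}" by (rule closure_subset[THEN subsetD])
      show "z \<notin> interior {x \<in> \<Omega> 0. f 0 x = 0}"
      proof
        assume "z \<in> interior {x \<in> \<Omega> 0. f 0 x = 0}"
        then have "\<forall>\<^sub>F n in sequentially. (y \<circ> r) n \<in> interior {x \<in> \<Omega> 0. f 0 x = 0}"
          by (intro topological_tendstoD[OF yz]) auto
        then obtain n where "y (r n) \<in> interior {x \<in> \<Omega> 0. f 0 x = 0}"
          by (auto simp: eventually_sequentially)
        then have "f 0 (y (r n)) = 0" using interior_subset by blast
        with fy(2)[of "r n"] show False by simp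
      qed
    qed
    from limit[OF this] obtain l where l: "m \<le> norm l"
      "(grad (pressure f 0) \<longlongrightarrow> l) (at z within {x \<in> \<Omega> 0. 0 < f 0 x})" by blast
    have "filterlim (y \<circ> r) (at z within {x \<in> \<Omega> 0. 0 < f 0 x}) sequentially"
      unfolding filterlim_at
      using yz y(1) fy(2) ne by (intro conjI always_eventually) simp_all
    from filterlim_compose[OF l(2) this]
    have "(\<lambda>n. norm (grad (pressure f 0) (y (r n)))) \<longlonglongrightarrow> norm l" by (intro tendsto_norm) (simp add: comp_def)
    then have "norm l \<le> m / 2"
      by (rule LIMSEQ_le_const2) (use y(4) less_imp_le in blast)
    with l(1) m show False by simp
  qed
qed

end

text \<open>At interface points, the limits in the definition of the regularity class are taken from
  \<open>{0 < g < \<delta>}\<close>, and the derivatives of the pressure there are limits from \<open>{g > 0}\<close>. They agree by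
  continuity of \<open>f\<close>.\<close>

lemma interface_grad_limit:
  assumes "open (\<Omega> t)" and z: "z \<in> \<Omega> t" "z \<in> interface \<Omega> f t" and cont: "isCont (f t) z"
    and nonneg: "\<And>x. x \<in> \<Omega> t \<Longrightarrow> 0 \<le> f t x" and zero: "f t z = 0" and "0 < \<delta>"
    and lim: "(grad (pressure f t) \<longlongrightarrow> l) (at z within {x \<in> \<Omega> t. 0 < pressure f t x \<and> pressure f t x < \<delta>})"
  shows "interface_grad \<Omega> f t z = l"
    "(grad (pressure f t) \<longlongrightarrow> l) (at z within {x \<in> \<Omega> t. 0 < f t x})"
proof -
  have "isCont (pressure f t) z" unfolding pressure_def[abs_def] using cont by (intro continuous_intros)
  moreover have "pressure f t z < \<delta>" using zero \<open>0 < \<delta>\<close> by (simp add: pressure_def)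
  ultimately have "\<forall>\<^sub>F x in at z. pressure f t x < \<delta>"
    unfolding isCont_def by (rule order_tendstoD(2))
  then obtain W where W: "open W" "z \<in> W" "\<And>x. x \<in> W \<Longrightarrow> x \<noteq> z \<Longrightarrow> pressure f t x < \<delta>"
    unfolding eventually_at_topological by blast
  have "at z within {x \<in> \<Omega> t. 0 < f t x} = at z within {x \<in> \<Omega> t. 0 < pressure f t x \<and> pressure f t x < \<delta>}"
    by (rule at_within_nhd[OF W(2,1)]) (use W(3) in \<open>auto simp: pressure_pos_iff\<close>)
  with lim show l: "(grad (pressure f t) \<longlongrightarrow> l) (at z within {x \<in> \<Omega> t. 0 < f t x})" by simp
  have "z islimpt {x \<in> \<Omega> t. 0 < f t x}"
    unfolding islimpt_def
  proof (intro allI impI)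
    fix V assume V: "z \<in> V" "open V"
    have "z \<notin> interior (flat_side \<Omega> f t)" using z(2) by (simp add: interface_def frontier_def)
    then have "\<not> V \<inter> \<Omega> t \<subseteq> flat_side \<Omega> f t"
      using interior_maximal[of "V \<inter> \<Omega> t"] V z(1) \<open>open (\<Omega> t)\<close> by blast
    then obtain x where "x \<in> V" "x \<in> \<Omega> t" "f t x \<noteq> 0" by (auto simp: flat_side_def)
    then show "\<exists>x\<in>{x \<in> \<Omega> t. 0 < f t x}. x \<in> V \<and> x \<noteq> z"
      using nonneg[of x] zero by (intro bexI[of _ x]) auto
  qed
  then have "at z within {x \<in> \<Omega> t. 0 < f t x} \<noteq> bot" by (simp add: trivial_limit_within)
  from tendsto_Lim[OF this l] show "interface_grad \<Omega> f t z = l"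
    by (simp add: interface_grad_def positive_part_def)
qed

theorem lemma3p4:
  fixes K :: "real \<Rightarrow> ((real ^ 'n::finite) \<times> real) set"
    and X :: "(real ^ 'n) \<times> real \<Rightarrow> real \<Rightarrow> (real ^ 'n) \<times> real"
    and \<Omega> :: "real \<Rightarrow> (real ^ 'n) set"
    and f :: "real \<Rightarrow> real ^ 'n \<Rightarrow> real"
    and Tc T \<rho>0 R \<beta> lam :: real
  assumes dim: "CARD('n) \<ge> 3"
    and flow: "flat_side_flow K X \<Omega> f Tc"
    and T: "0 < T" "T < Tc"
    and disc: "\<rho>0 > 0" "\<And>t. t \<in> {0..T} \<Longrightarrow> cball 0 \<rho>0 \<subseteq> flat_side \<Omega> f t"
    and domain: "R > 0" "\<And>t. t \<in> {0..T} \<Longrightarrow> \<Omega> t \<subseteq> ball 0 R"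
    and area: "measure lebesgue (flat_side \<Omega> f T) > 0"
    and smooth: "smooth_up_to_interface_short_time \<Omega> f Tc"
    and hoelder: "0 < \<beta>" "\<beta> < 1" "C2_Hoelder_up_to_interface \<beta> \<Omega> f T"
    and nondeg: "lam > 0" "nondegenerate_at_start lam \<Omega> f"
    and height: "\<And>t. t \<in> {0..T} \<Longrightarrow> (SUP x\<in>\<Omega> t. f t x) \<ge> 2"
    and level_sets: "\<And>t \<epsilon>. t \<in> {0..T} \<Longrightarrow> \<epsilon> > 0 \<Longrightarrow>
           convex_hypersurface_in (\<Omega> t) {x \<in> \<Omega> t. pressure f t x = \<epsilon>}"
  shows "\<exists>C>0. \<forall>t\<in>{0..T}. \<forall>x\<in>\<Omega> t.
           0 < pressure f t x \<and> pressure f t x \<le> 1 \<longrightarrow> norm (grad (pressure f t) x) \<ge> C"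
proof -
  obtain \<delta> L0 where \<delta>: "0 < \<delta>" and reg: "\<And>t. t \<in> {0..T} \<Longrightarrow>
      (let g = pressure f t; P = {x\<in>\<Omega> t. 0 < g x \<and> g x < \<delta>} in
          (\<forall>x\<in>P. twice_differentiable_at g x \<and> norm (grad g x) \<le> L0 \<and> norm (hess g x) \<le> L0) \<and>
          (\<forall>x\<in>P. \<forall>y\<in>P. norm (hess g x - hess g y) \<le> L0 * norm (x - y) powr \<beta>) \<and>
          (\<forall>z\<in>interface \<Omega> f t. (\<exists>l. (grad g \<longlongrightarrow> l) (at z within P)) \<and>
                                (\<exists>l. (hess g \<longlongrightarrow> l) (at z within P))))"
    using hoelder(3) unfolding C2_Hoelder_up_to_interface_def by blast
  have graph: "flat_side_graph (K t) (\<Omega> t) (f t)" if "t \<in> {0..T}" for t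
  proof -
    have "\<forall>t\<in>{0..<Tc}. flat_side_graph (K t) (\<Omega> t) (f t)"
      using flow unfolding flat_side_flow_def by blast
    then show ?thesis using that T by simp
  qed
  have off_interface: "x \<in> \<Omega> t - interface \<Omega> f t" if t: "t \<in> {0..T}" and x: "x \<in> \<Omega> t" "0 < f t x" for t x
  proof -
    have "open (\<Omega> t)" "f t differentiable (at x)"
      using graph[OF t] x(1) unfolding flat_side_graph_def by auto
    then have "isCont (f t) x" using differentiable_imp_continuous_within by blast
    then have "\<forall>\<^sub>F y in at x. 0 < f t y" using x(2) unfolding isCont_def by (rule order_tendstoD(1))
    then obtain W where W: "open W" "x \<in> W" "\<And>y. y \<in> W \<Longrightarrow> y \<noteq> x \<Longrightarrow> 0 < f t y"
      unfolding eventually_at_topological by blast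
    have "W \<inter> flat_side \<Omega> f t = {}" using W(3) x(2) by (fastforce simp: flat_side_def)
    then have "W \<inter> closure (flat_side \<Omega> f t) = {}" using open_Int_closure_eq_empty[OF W(1)] by blast
    with W(2) x(1) show ?thesis by (auto simp: interface_def frontier_def)
  qed
  interpret flat_side_solution \<Omega> f Tc T \<rho>0 R \<delta> "max 1 L0"
  proof
    show "openin (top_of_set (UNIV \<times> {0..<Tc})) {(x, t). t \<in> {0..<Tc} \<and> x \<in> \<Omega> t}"
      "continuous_on {(x, t). t \<in> {0..<Tc} \<and> x \<in> \<Omega> t} (\<lambda>(x, t). f t x)"
      using flow unfolding flat_side_flow_def by blast+
    show "0 < \<rho>0" "0 < R" "0 < \<delta>" "1 \<le> max 1 L0" using disc domain \<delta> by auto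
    fix t assume t: "t \<in> {0..T}"
    show "open (\<Omega> t)" "convex_on (\<Omega> t) (f t)"
      using graph[OF t] unfolding flat_side_graph_def by auto
    show "\<Omega> t \<subseteq> ball 0 R" by (rule domain(2)[OF t])
    show "filterlim (\<lambda>x. norm (grad (f t) x)) at_top (at z within \<Omega> t)" if "z \<in> frontier (\<Omega> t)" for z
      using graph[OF t] that unfolding flat_side_graph_def by auto
    show "x \<in> \<Omega> t \<and> f t x = 0" if "x \<in> cball 0 \<rho>0" for x
      using disc(2)[OF t] that by (auto simp: flat_side_def)
    fix x assume x: "x \<in> \<Omega> t"
    show "0 \<le> f t x" "f t differentiable (at x)"
      using graph[OF t] x unfolding flat_side_graph_def by auto
    show "twice_differentiable_at (f t) x"
      "((\<lambda>s. f s x) has_real_derivative graph_speed (f t) x) (at t within {0..<Tc})" if "0 < f t x"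
    proof -
      have "\<forall>t\<in>{0..<Tc}. \<forall>x\<in>\<Omega> t - interface \<Omega> f t. twice_differentiable_at (f t) x \<and>
          ((\<lambda>s. f s x) has_real_derivative graph_speed (f t) x) (at t within {0..<Tc})"
        using flow unfolding flat_side_flow_def by blast
      moreover have "t \<in> {0..<Tc}" using t T by simp
      ultimately show "twice_differentiable_at (f t) x"
        "((\<lambda>s. f s x) has_real_derivative graph_speed (f t) x) (at t within {0..<Tc})"
        using off_interface[OF t x that] by blast+
    qed
    show "twice_differentiable_at (pressure f t) x \<and>
        norm (grad (pressure f t) x) \<le> max 1 L0 \<and> norm (hess (pressure f t) x) \<le> max 1 L0"
      if "0 < pressure f t x" "pressure f t x < \<delta>"
      using reg[OF t] x that by (force simp: Let_def)
  next
    fix t x assume "0 < t" "t \<le> T" "x \<in> \<Omega> t" "0 < f t x"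
    then have mem: "(x, t) \<in> {(x, t). 0 < t \<and> t < Tc \<and> x \<in> positive_part \<Omega> f t}"
      using T by (simp add: positive_part_def)
    have "smooth_in {(x, t). 0 < t \<and> t < Tc \<and> x \<in> positive_part \<Omega> f t} (\<lambda>(x, t). f t x)"
      using flow unfolding flat_side_flow_def by blast
    from this[unfolded smooth_in_def, rule_format, OF _ mem, of "[]"]
    have "iterated_partial [] (\<lambda>(x, t). f t x) differentiable (at (x, t))" by simp
    then show "(\<lambda>(x, t). f t x) differentiable (at (x, t))" by simp
  qed (use T in auto)
  have t0: "0 \<in> {0..T}" using T by simp
  have "\<exists>l. lam \<le> norm l \<and> (grad (pressure f 0) \<longlongrightarrow> l) (at z within {x \<in> \<Omega> 0. 0 < f 0 x})"
    if z: "z \<in> frontier {x \<in> \<Omega> 0. f 0 x = 0}" for z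
  proof -
    have zi: "z \<in> interface \<Omega> f 0" using z by (simp add: interface_def flat_side_def)
    have "z \<in> \<Omega> 0 \<and> f 0 z = 0"
    proof -
      define S where "S = {x \<in> \<Omega> 0. f 0 x = 0}"
      have "z \<in> closure S" using z by (simp add: frontier_def S_def)
      then obtain w where w: "\<And>n. w n \<in> S" "w \<longlonglongrightarrow> z" using closure_sequential by blast
      have "(z, 0) \<in> {(x, t). t \<in> {0..T} \<and> x \<in> \<Omega> t \<and> f t x \<le> (\<delta> / 2)\<^sup>2 / 2}"
      proof (rule closed_sequentially[OF closed_sublevel])
        show "(w n, 0) \<in> {(x, t). t \<in> {0..T} \<and> x \<in> \<Omega> t \<and> f t x \<le> (\<delta> / 2)\<^sup>2 / 2}" for n
          using w(1)[of n] t0 by (simp add: S_def)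
        show "(\<lambda>n. (w n, 0)) \<longlonglongrightarrow> (z, 0)" using w(2) by (intro tendsto_intros)
      qed (use \<delta> in auto)
      then have "z \<in> \<Omega> 0" by simp
      have "(\<lambda>n. f 0 (w n)) \<longlonglongrightarrow> f 0 z"
        using has_derivative_continuous[OF has_derivative_slice[OF t0 \<open>z \<in> \<Omega> 0\<close>]] w(2)
        by (simp add: continuous_at_sequentially comp_def)
      moreover have "(\<lambda>n. f 0 (w n)) = (\<lambda>n. 0)" using w(1) by (simp add: S_def)
      ultimately have "f 0 z = 0" by (simp add: LIMSEQ_const_iff)
      with \<open>z \<in> \<Omega> 0\<close> show ?thesis by simp
    qed
    then have z0: "z \<in> \<Omega> 0" "f 0 z = 0" by auto
    have cont: "isCont (f 0) z"
      by (rule has_derivative_continuous[OF has_derivative_slice[OF t0 z0(1)]])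
    obtain l where l: "(grad (pressure f 0) \<longlongrightarrow> l)
        (at z within {x \<in> \<Omega> 0. 0 < pressure f 0 x \<and> pressure f 0 x < \<delta>})"
      using reg[OF t0] zi by (auto simp: Let_def)
    note lim = interface_grad_limit[OF open_slice[OF t0] z0(1) zi cont nonneg[OF t0] z0(2) \<delta> l]
    have "lam \<le> norm l" using nondeg(2) zi lim(1) unfolding nondegenerate_at_start_def by auto
    with lim(2) show ?thesis by blast
  qed
  from initial_gradient_bound[OF nondeg(1) this] obtain \<epsilon> where \<epsilon>: "0 < \<epsilon>" "\<epsilon> < \<delta>" "\<epsilon> \<le> 1"
    "\<And>y. y \<in> \<Omega> 0 \<Longrightarrow> 0 < pressure f 0 y \<Longrightarrow> pressure f 0 y \<le> \<epsilon> \<Longrightarrow> lam / 2 \<le> norm (grad (pressure f 0) y)"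
    by blast
  have "0 < lam / 2" using nondeg(1) by simp
  from pressure_gradient_bound[OF \<epsilon>(1-3) this \<epsilon>(4)] show ?thesis by blast
qed

end
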